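(* Let $k:\mathcal P\otimes\mathcal Q\to\mathbb R$ be differentiable at $P_0\otimes Q_0$ with canonical gradient $\widetilde k=\widetilde k_1\circ\pi_1+\widetilde k_2\circ\pi_2$, $\int\widetilde k^2\,dP_0\otimes Q_0\ne0$, let $\alpha\in(0,1)$, and let $(n_1)_n,(n_2)_n\subset\mathbb N$ satisfy $n_1+n_2=n$ and $\lim_{n\to\infty}\frac{n_2}n=d\in(0,1)$. Suppose that the tangent cone $K(P_0\otimes Q_0,\mathcal P\otimes\mathcal Q)$ is convex. Let $\psi_n=1$ if $T_n>c$ and $\psi_n=0$ if $T_n\le c$, where $$T_n=\frac{\sqrt n}{n_1}\sum_{i=1}^{n_1}\widetilde k_1(\omega_{1,i})+\frac{\sqrt n}{n_2}\sum_{j=1}^{n_2}\widetilde k_2(\omega_{2,j}),\qquad c=u_{1-\alpha}\Bigl(\frac1{1-d}\int\widetilde k_1^2\,dP_0+\frac1d\int\widetilde k_2^2\,dQ_0\Bigr)^{1/2}.$$ Then, for each fixed $\vartheta>0$, $(\psi_n)_n$ is an asymptotic maximin-$\alpha$ test sequence for the hypotheses $(P_0^{n_1}\otimes Q_0^{n_2})_n$ against the implicit alternatives with implicit parameter $\vartheta$, i.e. $$\inf\ \lim_{n\to\infty}\int\psi_n\,dP_{t_n}^{n_1}\otimes Q_{t_n}^{n_2}=\max_{(\phi_n)}\ \inf\ \limsup_{n\to\infty}\int\phi_n\,dP_{t_n}^{n_1}\otimes Q_{t_n}^{n_2},$$ where both infima are over all $(P_{t_n}\otimes Q_{t_n})_n\in\mathcal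 K_1$ with $$\lim_{n\to\infty}\frac{k(P_{t_n}\otimes Q_{t_n})-k(P_0\otimes Q_0)}{n^{-1/2}}=\vartheta,$$ and the maximum is over all asymptotically $\{0\}$-$\alpha$-similar test sequences $(\phi_n)_n$ (and is attained).
   Context: $\mathcal P,\mathcal Q$ are nonempty families of probability measures on $(\Omega_1,\mathcal A_1)$, $(\Omega_2,\mathcal A_2)$; $\mathcal P\otimes\mathcal Q=\{P\otimes Q:P\in\mathcal P,Q\in\mathcal Q\}$; $(\omega_{1,1},\dots,\omega_{1,n_1},\omega_{2,1},\dots,\omega_{2,n_2})$ is the generic point of $\Omega_1^{n_1}\times\Omega_2^{n_2}$. $\Phi$ is the standard normal distribution function and $u_{1-\alpha}=\Phi^{-1}(1-\alpha)$. A test is a measurable function with values in $[0,1]$; a sequence of tests $\phi_n$ on $\Omega_1^{n_1}\times\Omega_2^{n_2}$ is asymptotically $\{0\}$-$\alpha$-similar if $\lim_n\int\phi_n\,dP_0^{n_1}\otimes Q_0^{n_2}=\alpha$. $L_2^{(0)}(P)=\{h\in L_2(P):\int h\,dP=0\}$. With $dP/dQ$ the density quotient (a $[0,\infty]$-valued measurable $L$ with $P(A)=\int_AL\,dQ+P(A\cap\{L=\infty\})$, $Q(L<\infty)=1$), a curve $t\mapsto R_t$, $|t|<\varepsilon$, in a family $\mathcal R$ is $L_2(R_0)$-differentiable with tangent $g\in L_2(R_0)$ if $\|2((dR_t/dR_0)^{1/2}-1)-tg\|_{L_2(R_0)}=o(|t|)$ and $R_t(dR_t/dR_0=\infty)=o(t^2)$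 as $t\to0$. The tangent cone $K(R,\mathcal R)$ is the set of tangents of all such curves in $\mathcal R$ with $R_0=R$; the tangent space $T(R,\mathcal R)$ is the $L_2(R)$-closure of its linear span. A functional $k$ on $\mathcal R$ is differentiable at $R\in\mathcal R$ with gradient $\dot k\in L_2^{(0)}(R)$ if $\lim_{t\downarrow0}t^{-1}(k(R_t)-k(R))=\int\dot kg\,dR$ for each $L_2$-differentiable curve in $\mathcal R$ with $R_0=R$ and tangent $g$; the canonical gradient is the unique gradient in $T(R,\mathcal R)$. At $P_0\otimes Q_0$ it decomposes uniquely as $\widetilde k(\omega_1,\omega_2)=\widetilde k_1(\omega_1)+\widetilde k_2(\omega_2)$ with $\widetilde k_1\in L_2^{(0)}(P_0)$, $\widetilde k_2\in L_2^{(0)}(Q_0)$. $\mathcal F_2$ is the set of all sequences $(P_{t_n}\otimes Q_{t_n})_n$ such that $t_n\to0$, $\lim_nt_n\sqrt n>0$, and there are $\varepsilon>0$ and an $L_2(P_0\otimes Q_0)$-differentiable curve $f:(-\varepsilon,\varepsilon)\to\mathcal P\otimes\mathcal Q$, $t\mapsto P_t\otimes Q_t$ (passing through $P_0\otimes Q_0$ at $t=0$) with $f(t_n)=P_{t_n}\otimes Q_{t_n}$ for all $n$. The set of implicit alternatives is $\mathcal K_1=\{(P_{t_n}\otimes Q_{t_n})_n\in\mathcal F_2:\lim_n\sqrt n(k(P_{t_n}\otimes Q_{t_n})-k(P_0\otimes Q_0))>0\}$. *)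

theory Defs
  imports "HOL-Probability.Probability" "HOL-Library.Landau_Symbols"
begin

text \<open>
  Elements of \<open>L\<^sub>2\<close> are represented by functions; all notions below are invariant under
  changing a function on a null set.
\<close>

definition L2 :: "'a measure \<Rightarrow> ('a \<Rightarrow> real) set" where
  "L2 R = {h \<in> borel_measurable R. integrable R (\<lambda>x. (h x)\<^sup>2)}"

definition L2_norm :: "'a measure \<Rightarrow> ('a \<Rightarrow> real) \<Rightarrow> real" where
  "L2_norm R h = sqrt (\<integral>x. (h x)\<^sup>2 \<partial>R)"

definition L2_centered :: "'a measure \<Rightarrow> ('a \<Rightarrow> real) set" where
  "L2_centered R = {h \<in> L2 R. (\<integral>x. h x \<partial>R) = 0}"

text \<open>\<open>density_quotient P Q L\<close>: the function \<open>L\<close> is a version of \<open>dP/dQ\<close>.\<close>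

definition density_quotient :: "'a measure \<Rightarrow> 'a measure \<Rightarrow> ('a \<Rightarrow> ennreal) \<Rightarrow> bool" where
  "density_quotient P Q L \<longleftrightarrow>
     L \<in> borel_measurable Q \<and>
     (\<forall>A\<in>sets Q. emeasure P A =
        (\<integral>\<^sup>+x\<in>A. L x \<partial>Q) + emeasure P (A \<inter> {x. L x = \<infinity>})) \<and>
     (AE x in Q. L x < \<infinity>)"

text \<open>
  Since \<open>L t < \<infinity>\<close> holds \<open>R 0\<close>-almost surely, the value \<open>enn2real \<infinity> = 0\<close> plays no role in the norm.
\<close>

definition L2_differentiable :: "real \<Rightarrow> (real \<Rightarrow> 'a measure) \<Rightarrow> ('a \<Rightarrow> real) \<Rightarrow> bool" where
  "L2_differentiable \<epsilon> R g \<longleftrightarrow>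
     g \<in> L2 (R 0) \<and>
     (\<exists>L :: real \<Rightarrow> 'a \<Rightarrow> ennreal.
        (\<forall>t. \<bar>t\<bar> < \<epsilon> \<longrightarrow> density_quotient (R t) (R 0) (L t)) \<and>
        (\<lambda>t. L2_norm (R 0) (\<lambda>x. 2 * (sqrt (enn2real (L t x)) - 1) - t * g x))
          \<in> o[at 0](\<lambda>t. \<bar>t\<bar>) \<and>
        (\<lambda>t. measure (R t) {x \<in> space (R t). L t x = \<infinity>}) \<in> o[at 0](\<lambda>t. t\<^sup>2))"

definition L2_curve ::
  "'a measure set \<Rightarrow> 'a measure \<Rightarrow> real \<Rightarrow> (real \<Rightarrow> 'a measure) \<Rightarrow> ('a \<Rightarrow> real) \<Rightarrow> bool" where
  "L2_curve \<R> R0 \<epsilon> R g \<longleftrightarrow>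
     \<epsilon> > 0 \<and> (\<forall>t. \<bar>t\<bar> < \<epsilon> \<longrightarrow> R t \<in> \<R>) \<and> R 0 = R0 \<and> L2_differentiable \<epsilon> R g"

definition tangent_cone :: "'a measure \<Rightarrow> 'a measure set \<Rightarrow> ('a \<Rightarrow> real) set" where
  "tangent_cone R0 \<R> = {g. \<exists>\<epsilon> R. L2_curve \<R> R0 \<epsilon> R g}"

text \<open>
  \<^const>\<open>convex\<close> and \<^const>\<open>span\<close> require an instance of the class \<^class>\<open>real_vector\<close>,
  which the function type is not; the following are their pointwise versions.
\<close>

definition convex_fun_set :: "('a \<Rightarrow> real) set \<Rightarrow> bool" where
  "convex_fun_set S \<longleftrightarrow>
     (\<forall>g\<in>S. \<forall>h\<in>S. \<forall>u\<ge>0. \<forall>v\<ge>0. u + v = 1 \<longrightarrow> (\<lambda>x. u * g x + v * h x) \<in> S)"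

definition fun_span :: "('a \<Rightarrow> real) set \<Rightarrow> ('a \<Rightarrow> real) set" where
  "fun_span S = {(\<lambda>x. \<Sum>g\<in>F. c g * g x) | F c. finite F \<and> F \<subseteq> S}"

definition tangent_space :: "'a measure \<Rightarrow> 'a measure set \<Rightarrow> ('a \<Rightarrow> real) set" where
  "tangent_space R0 \<R> =
     {g \<in> L2 R0. \<forall>e>0. \<exists>h\<in>fun_span (tangent_cone R0 \<R>). L2_norm R0 (\<lambda>x. g x - h x) < e}"

definition is_gradient ::
  "('a measure \<Rightarrow> real) \<Rightarrow> 'a measure \<Rightarrow> 'a measure set \<Rightarrow> ('a \<Rightarrow> real) \<Rightarrow> bool" where
  "is_gradient k R0 \<R> kd \<longleftrightarrow>
     kd \<in> L2_centered R0 \<and>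
     (\<forall>\<epsilon> R g. L2_curve \<R> R0 \<epsilon> R g \<longrightarrow>
        ((\<lambda>t. (k (R t) - k R0) / t) \<longlongrightarrow> (\<integral>x. kd x * g x \<partial>R0)) (at_right 0))"

definition canonical_gradient ::
  "('a measure \<Rightarrow> real) \<Rightarrow> 'a measure \<Rightarrow> 'a measure set \<Rightarrow> ('a \<Rightarrow> real) \<Rightarrow> bool" where
  "canonical_gradient k R0 \<R> kt \<longleftrightarrow> is_gradient k R0 \<R> kt \<and> kt \<in> tangent_space R0 \<R>"

definition product_family ::
  "'a measure set \<Rightarrow> 'b measure set \<Rightarrow> ('a \<times> 'b) measure set" where
  "product_family \<P> \<Q> = {P \<Otimes>\<^sub>M Q | P Q. P \<in> \<P> \<and> Q \<in> \<Q>}"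

definition two_sample ::
  "nat \<Rightarrow> nat \<Rightarrow> 'a measure \<Rightarrow> 'b measure \<Rightarrow> ((nat \<Rightarrow> 'a) \<times> (nat \<Rightarrow> 'b)) measure" where
  "two_sample m1 m2 P Q = (\<Pi>\<^sub>M i\<in>{..<m1}. P) \<Otimes>\<^sub>M (\<Pi>\<^sub>M j\<in>{..<m2}. Q)"

definition is_test :: "'a measure \<Rightarrow> ('a \<Rightarrow> real) \<Rightarrow> bool" where
  "is_test M \<phi> \<longleftrightarrow> \<phi> \<in> borel_measurable M \<and> (\<forall>\<omega>\<in>space M. 0 \<le> \<phi> \<omega> \<and> \<phi> \<omega> \<le> 1)"

text \<open>
  Being a test on \<open>two_sample m1 m2 P0 Q0\<close> depends only on the \<open>\<sigma>\<close>-algebras of \<open>P0\<close> and \<open>Q0\<close>.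
\<close>

definition similar_tests ::
  "(nat \<Rightarrow> nat) \<Rightarrow> (nat \<Rightarrow> nat) \<Rightarrow> 'a measure \<Rightarrow> 'b measure \<Rightarrow> real \<Rightarrow>
   (nat \<Rightarrow> (nat \<Rightarrow> 'a) \<times> (nat \<Rightarrow> 'b) \<Rightarrow> real) set" where
  "similar_tests n1 n2 P0 Q0 \<alpha> =
     {\<phi>. (\<forall>n. is_test (two_sample (n1 n) (n2 n) P0 Q0) (\<phi> n)) \<and>
         (\<lambda>n. \<integral>\<omega>. \<phi> n \<omega> \<partial>two_sample (n1 n) (n2 n) P0 Q0) \<longlonglongrightarrow> \<alpha>}"

text \<open>
  A sequence of product measures is represented by the sequence of the pairs of its factors,
  which are determined by the product because they are probability measures.
\<close>

definition F2 ::
  "'a measure set \<Rightarrow> 'b measure set \<Rightarrow> 'a measure \<Rightarrow> 'b measure \<Rightarrow>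
   (nat \<Rightarrow> 'a measure \<times> 'b measure) set" where
  "F2 \<P> \<Q> P0 Q0 =
     {S. \<exists>t \<epsilon> P Q g.
        t \<longlonglongrightarrow> 0 \<and>
        (\<exists>l>0. (\<lambda>n. t n * sqrt (real n)) \<longlonglongrightarrow> l) \<and>
        (\<forall>s. \<bar>s\<bar> < \<epsilon> \<longrightarrow> P s \<in> \<P> \<and> Q s \<in> \<Q>) \<and>
        L2_curve (product_family \<P> \<Q>) (P0 \<Otimes>\<^sub>M Q0) \<epsilon> (\<lambda>s. P s \<Otimes>\<^sub>M Q s) g \<and>
        (\<forall>n. \<bar>t n\<bar> < \<epsilon> \<and> S n = (P (t n), Q (t n)))}"

definition K1 ::
  "(('a \<times> 'b) measure \<Rightarrow> real) \<Rightarrow> 'a measure set \<Rightarrow> 'b measure set \<Rightarrow> 'a measure \<Rightarrow> 'b measure \<Rightarrow>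
   (nat \<Rightarrow> 'a measure \<times> 'b measure) set" where
  "K1 k \<P> \<Q> P0 Q0 =
     {S \<in> F2 \<P> \<Q> P0 Q0.
        \<exists>l>0. (\<lambda>n. sqrt (real n) * (k (fst (S n) \<Otimes>\<^sub>M snd (S n)) - k (P0 \<Otimes>\<^sub>M Q0))) \<longlonglongrightarrow> l}"

definition implicit_alternatives ::
  "(('a \<times> 'b) measure \<Rightarrow> real) \<Rightarrow> 'a measure set \<Rightarrow> 'b measure set \<Rightarrow> 'a measure \<Rightarrow> 'b measure \<Rightarrow>
   real \<Rightarrow> (nat \<Rightarrow> 'a measure \<times> 'b measure) set" where
  "implicit_alternatives k \<P> \<Q> P0 Q0 \<theta> =
     {S \<in> K1 k \<P> \<Q> P0 Q0.
        (\<lambda>n. (k (fst (S n) \<Otimes>\<^sub>M snd (S n)) - k (P0 \<Otimes>\<^sub>M Q0)) / real n powr (-1/2)) \<longlonglongrightarrow> \<theta>}"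

definition power_seq ::
  "(nat \<Rightarrow> nat) \<Rightarrow> (nat \<Rightarrow> nat) \<Rightarrow> (nat \<Rightarrow> (nat \<Rightarrow> 'a) \<times> (nat \<Rightarrow> 'b) \<Rightarrow> real) \<Rightarrow>
   (nat \<Rightarrow> 'a measure \<times> 'b measure) \<Rightarrow> nat \<Rightarrow> real" where
  "power_seq n1 n2 \<phi> S n =
     (\<integral>\<omega>. \<phi> n \<omega> \<partial>two_sample (n1 n) (n2 n) (fst (S n)) (snd (S n)))"

text \<open>
  Infima are taken in \<^typ>\<open>ereal\<close>. The limits in the infimum for \<open>\<psi>\<close> are part of the claim,
  and so is the fact that \<open>\<psi>\<close> is itself one of the competing test sequences.
\<close>

definition asymptotic_maximin ::
  "(nat \<Rightarrow> nat) \<Rightarrow> (nat \<Rightarrow> nat) \<Rightarrow> (nat \<Rightarrow> 'a measure \<times> 'b measure) set \<Rightarrow>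
   (nat \<Rightarrow> (nat \<Rightarrow> 'a) \<times> (nat \<Rightarrow> 'b) \<Rightarrow> real) set \<Rightarrow>
   (nat \<Rightarrow> (nat \<Rightarrow> 'a) \<times> (nat \<Rightarrow> 'b) \<Rightarrow> real) \<Rightarrow> bool" where
  "asymptotic_maximin n1 n2 Alt Tests \<psi> \<longleftrightarrow>
     \<psi> \<in> Tests \<and>
     (\<forall>S\<in>Alt. convergent (power_seq n1 n2 \<psi> S)) \<and>
     (let v = (INF S\<in>Alt. ereal (lim (power_seq n1 n2 \<psi> S)));
          V = (\<lambda>\<phi>. INF S\<in>Alt. limsup (\<lambda>n. ereal (power_seq n1 n2 \<phi> S n)))
      in (\<exists>\<phi>\<in>Tests. V \<phi> = v) \<and> (\<forall>\<phi>\<in>Tests. V \<phi> \<le> v))"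

end

theory Submission
  imports Defs "HOL-Real_Asymp.Real_Asymp"
begin

text \<open>
  Along a differentiable curve the characteristic functions of the summands can be expanded directly:
  if \<open>f\<close> is the square root of the density and \<open>2 \<surd>n (f - 1) \<rightarrow> G\<close> in \<open>L\<^sub>2\<close>, then
  \<open>n (E exp (i a k / \<surd>n) - 1) \<rightarrow> - a\<^sup>2 \<parallel>k\<parallel>\<^sup>2 / 2 + i a \<langle>k, G\<rangle>\<close> under the alternative, and
  \<open>n (E exp (2 i u ln f) - 1) \<rightarrow> - (u\<^sup>2 + i u) \<parallel>G\<parallel>\<^sup>2 / 2\<close> under the hypothesis. By Levy's theorem the
  test statistic is asymptotically normal with mean \<open>\<theta>\<close> along every implicit alternative, which makes
  the power of \<open>\<psi>\<close> constant there, and the log-likelihood ratio is asymptotically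
  \<open>N (- \<sigma>\<^sup>2 / 2, \<sigma>\<^sup>2)\<close>, so the Neyman--Pearson inequality bounds every power by \<open>1 - \<Phi> (u - \<sigma>)\<close>.

  It remains to find alternatives with \<open>\<sigma>\<close> close to \<open>\<theta> / \<surd>V\<close>. The least favourable direction is
  \<open>kt1 / (1 - d) + kt2 / d\<close>. Curves may be reversed, so a convex tangent cone is a linear space; its
  closure contains \<open>kt\<close>; and with a tangent \<open>h\<close> of \<open>P\<^sub>t \<otimes> Q\<^sub>t\<close> it contains the two marginals of \<open>h\<close>,
  which are tangents of \<open>P\<^sub>t \<otimes> Q\<^sub>0\<close> and \<open>P\<^sub>0 \<otimes> Q\<^sub>t\<close>. Hence the least favourable direction is a limit of
  tangents.
\<close>

section \<open>Convergence in \<open>L\<^sub>2\<close>\<close>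

text \<open>Only the product curve is assumed differentiable, but its factors are sampled n1 and n2
  times, so each factor curve must first be shown differentiable. Square roots of densities make
  this possible: averaging f1 f2 over one variable multiplies the other factor by a constant 1 -
  O(t^2).

  Let g1, g2 be the marginals of a tangent g and s = lim t_n sqrt n. The mean \<theta> of the test
  statistic is s (<kt1, g1> + <kt2, g2>), while \<sigma>^2 = s^2 ((1 - d) |g1|^2 + d |g2|^2). By
  Cauchy-Schwarz \<sigma> \<ge> \<theta> / sqrt V, with equality when (1 - d) g1 and d g2 are the
  same positive multiple of kt1 and kt2; this singles out the least favourable direction. At this
  \<sigma> the bound 1 - \<Phi> (u - \<sigma>) is the power of \<psi>, so the two sides of the claim
  meet.

  A density quotient may be infinite or zero. Its infinite part carries mass o(1/n) under the
  alternative; its zeros have probability o(1/n) under the hypothesis, and they enter as an error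
  term because the logarithm of 0 is a default value.\<close>

lemma tendsto_zero_if_square:
  fixes a :: "nat \<Rightarrow> real"
  assumes "(\<lambda>n. (a n)^2) \<longlonglongrightarrow> 0"
  shows "a \<longlonglongrightarrow> 0"
  using tendsto_real_sqrt[OF assms] by (simp add: tendsto_rabs_zero_iff)

lemma L2_measurable: "X \<in> L2 M \<Longrightarrow> X \<in> borel_measurable M"
  by (simp add: L2_def)

lemma L2_square_integrable: "X \<in> L2 M \<Longrightarrow> integrable M (\<lambda>x. (X x)^2)"
  by (simp add: L2_def)

lemma L2_mult_integrable:
  assumes X: "X \<in> L2 M" and Y: "Y \<in> L2 M"
  shows "integrable M (\<lambda>x. X x * Y x)"
proof (rule Bochner_Integration.integrable_bound)
  show "integrable M (\<lambda>x. (X x)^2 + (Y x)^2)"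
    using assms by (simp add: L2_def)
  show "(\<lambda>x. X x * Y x) \<in> borel_measurable M"
    using assms by (auto simp: L2_def)
  have "\<bar>a * b\<bar> \<le> a^2 + b^2" for a b :: real
    using sum_squares_bound[of "\<bar>a\<bar>" "\<bar>b\<bar>"] by (simp add: abs_mult mult.assoc) (smt (verit) mult_nonneg_nonneg abs_ge_zero)
  then show "AE x in M. norm (X x * Y x) \<le> norm ((X x)^2 + (Y x)^2)"
    by (intro AE_I2) (metis abs_of_nonneg add_nonneg_nonneg real_norm_def zero_le_power2)
qed

lemma L2_cmult: "X \<in> L2 M \<Longrightarrow> (\<lambda>x. c * X x) \<in> L2 M"
  by (auto simp: L2_def power_mult_distrib)

lemma L2_add:
  assumes X: "X \<in> L2 M" and Y: "Y \<in> L2 M"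
  shows "(\<lambda>x. X x + Y x) \<in> L2 M"
  using assms L2_mult_integrable[OF L2_cmult[OF X, of 2] Y]
  by (auto simp: L2_def power2_sum)

lemma L2_diff:
  assumes X: "X \<in> L2 M" and Y: "Y \<in> L2 M"
  shows "(\<lambda>x. X x - Y x) \<in> L2 M"
  using L2_add[OF X L2_cmult[OF Y, of "-1"]] by simp

lemma L2_const: "prob_space M \<Longrightarrow> (\<lambda>x. c) \<in> L2 M"
  by (simp add: L2_def prob_space.finite_measure finite_measure.integrable_const)

lemma L2_bounded_mult:
  assumes X: "X \<in> L2 M" and b: "b \<in> borel_measurable M" and bd: "\<And>x. x \<in> space M \<Longrightarrow> \<bar>b x\<bar> \<le> C"
  shows "(\<lambda>x. b x * X x) \<in> L2 M"
  unfolding L2_def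
proof (intro CollectI conjI)
  show "(\<lambda>x. b x * X x) \<in> borel_measurable M"
    using b L2_measurable[OF X] by measurable
  show "integrable M (\<lambda>x. (b x * X x)^2)"
  proof (rule Bochner_Integration.integrable_bound)
    show "integrable M (\<lambda>x. C^2 * (X x)^2)"
      using X by (simp add: L2_def)
    show "(\<lambda>x. (b x * X x)^2) \<in> borel_measurable M"
      using b L2_measurable[OF X] by measurable
    show "AE x in M. norm ((b x * X x)^2) \<le> norm (C^2 * (X x)^2)"
    proof (rule AE_I2)
      fix x assume "x \<in> space M"
      then have "(b x)^2 \<le> C^2"
        using bd power_mono[of "\<bar>b x\<bar>" C 2] by simp
      then show "norm ((b x * X x)^2) \<le> norm (C^2 * (X x)^2)"
        by (simp add: power_mult_distrib mult_right_mono)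
    qed
  qed
qed

lemma L2_integrable: "prob_space M \<Longrightarrow> X \<in> L2 M \<Longrightarrow> integrable M X"
  using L2_mult_integrable[of X M "\<lambda>x. 1"] by (simp add: L2_const)

text \<open>The square of X - l Y has a nonnegative integral for every l. If C > 0, take the
  minimiser l = B / C; if C = 0, the quadratic is affine in l and would reach -1 for some l unless B
  = 0.\<close>

lemma L2_Cauchy_Schwarz:
  assumes X: "X \<in> L2 M" and Y: "Y \<in> L2 M"
  shows "(LINT x|M. X x * Y x)^2 \<le> (LINT x|M. (X x)^2) * (LINT x|M. (Y x)^2)"
proof -
  let ?A = "LINT x|M. (X x)^2" and ?B = "LINT x|M. X x * Y x" and ?C = "LINT x|M. (Y x)^2"
  have quad: "0 \<le> ?A - 2 * l * ?B + l^2 * ?C" for l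
  proof -
    have "0 \<le> (LINT x|M. (X x - l * Y x)^2)" by simp
    also have "\<dots> = (LINT x|M. (X x)^2 - 2 * l * (X x * Y x) + l^2 * (Y x)^2)"
      by (rule Bochner_Integration.integral_cong) (auto simp: power2_eq_square algebra_simps)
    also have "\<dots> = ?A - 2 * l * ?B + l^2 * ?C"
      using X Y L2_mult_integrable[OF X Y] by (simp add: L2_def)
    finally show ?thesis .
  qed
  have C: "?C \<ge> 0" by simp
  show ?thesis
  proof (cases "?C = 0")
    case True
    have "?B = 0"
    proof (rule ccontr)
      assume "?B \<noteq> 0"
      then show False
        using quad[of "(?A + 1) / (2 * ?B)"] True by (simp add: field_simps)
    qed
    then show ?thesis using True by simp
  next
    case False
    then have "?C > 0" using C by linarith
    then show ?thesis
      using quad[of "?B / ?C"] by (simp add: field_simps power2_eq_square)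
  qed
qed

text \<open>Membership in \<open>L2\<close> is part of the notion because the Bochner integral of a
  non-integrable function is 0, so that the limit alone would say nothing.\<close>

definition L2_conv :: "'a measure \<Rightarrow> (nat \<Rightarrow> 'a \<Rightarrow> real) \<Rightarrow> ('a \<Rightarrow> real) \<Rightarrow> bool" where
  "L2_conv M X Y \<longleftrightarrow>
     (\<forall>n. X n \<in> L2 M) \<and> Y \<in> L2 M \<and> (\<lambda>n. LINT x|M. (X n x - Y x)^2) \<longlonglongrightarrow> 0"

lemma L2_convD:
  assumes "L2_conv M X Y"
  shows "X n \<in> L2 M" "Y \<in> L2 M" "(\<lambda>n. LINT x|M. (X n x - Y x)^2) \<longlonglongrightarrow> 0"
  using assms by (auto simp: L2_conv_def)

lemma L2_conv_const: "Y \<in> L2 M \<Longrightarrow> L2_conv M (\<lambda>n. Y) Y"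
  by (simp add: L2_conv_def)

lemma L2_conv_subseq: "L2_conv M X Y \<Longrightarrow> strict_mono r \<Longrightarrow> L2_conv M (\<lambda>n. X (r n)) Y"
  unfolding L2_conv_def using LIMSEQ_subseq_LIMSEQ by (fastforce simp: o_def)

lemma tendsto_integral_mult_zero:
  assumes X: "\<And>n. X n \<in> L2 M" and Y: "\<And>n. Y n \<in> L2 M"
    and lim: "(\<lambda>n. (LINT x|M. (X n x)^2) * (LINT x|M. (Y n x)^2)) \<longlonglongrightarrow> 0"
  shows "(\<lambda>n. LINT x|M. X n x * Y n x) \<longlonglongrightarrow> 0"
proof -
  have "(\<lambda>n. (LINT x|M. X n x * Y n x)^2) \<longlonglongrightarrow> 0"
    by (rule tendsto_sandwich[OF _ _ tendsto_const lim])
       (auto intro!: always_eventually L2_Cauchy_Schwarz X Y)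
  then show ?thesis
    by (rule tendsto_zero_if_square)
qed

lemma L2_conv_inner:
  assumes X: "L2_conv M X X'" and Y: "L2_conv M Y Y'"
  shows "(\<lambda>n. LINT x|M. X n x * Y n x) \<longlonglongrightarrow> (LINT x|M. X' x * Y' x)"
proof -
  note [simp] = L2_convD(1,2)[OF X] L2_convD(1,2)[OF Y]
  note LX = L2_convD(3)[OF X] and LY = L2_convD(3)[OF Y]
  have 1: "(\<lambda>n. LINT x|M. (X n x - X' x) * (Y n x - Y' x)) \<longlonglongrightarrow> 0"
    by (rule tendsto_integral_mult_zero) (use tendsto_mult[OF LX LY] in \<open>auto intro: L2_diff\<close>)
  have 2: "(\<lambda>n. LINT x|M. (X n x - X' x) * Y' x) \<longlonglongrightarrow> 0"
    by (rule tendsto_integral_mult_zero) (use tendsto_mult[OF LX tendsto_const] in \<open>auto intro: L2_diff\<close>)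
  have 3: "(\<lambda>n. LINT x|M. X' x * (Y n x - Y' x)) \<longlonglongrightarrow> 0"
    by (rule tendsto_integral_mult_zero) (use tendsto_mult[OF tendsto_const LY] in \<open>auto intro: L2_diff\<close>)
  have "(LINT x|M. X n x * Y n x) = (LINT x|M. X' x * Y' x) +
      ((LINT x|M. (X n x - X' x) * (Y n x - Y' x)) + (LINT x|M. (X n x - X' x) * Y' x)
        + (LINT x|M. X' x * (Y n x - Y' x)))" for n
  proof -
    have "(LINT x|M. X n x * Y n x) = (LINT x|M. X' x * Y' x +
        ((X n x - X' x) * (Y n x - Y' x) + (X n x - X' x) * Y' x + X' x * (Y n x - Y' x)))"
      by (rule Bochner_Integration.integral_cong) (auto simp: algebra_simps)
    also have "\<dots> = (LINT x|M. X' x * Y' x) +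
      ((LINT x|M. (X n x - X' x) * (Y n x - Y' x)) + (LINT x|M. (X n x - X' x) * Y' x)
        + (LINT x|M. X' x * (Y n x - Y' x)))"
      by (subst Bochner_Integration.integral_add;
          (intro Bochner_Integration.integrable_add L2_mult_integrable L2_diff; simp)?)+ simp
    finally show ?thesis .
  qed
  then show ?thesis
    using tendsto_add[OF tendsto_const tendsto_add[OF tendsto_add[OF 1 2] 3], of "LINT x|M. X' x * Y' x"]
    by simp
qed

lemma L2_conv_norm:
  assumes X: "L2_conv M X X'"
  shows "(\<lambda>n. LINT x|M. (X n x)^2) \<longlonglongrightarrow> (LINT x|M. (X' x)^2)"
  using L2_conv_inner[OF X X] by (simp add: power2_eq_square)

lemma L2_conv_add:
  assumes X: "L2_conv M X X'" and Y: "L2_conv M Y Y'"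
  shows "L2_conv M (\<lambda>n x. X n x + Y n x) (\<lambda>x. X' x + Y' x)"
  unfolding L2_conv_def
proof (intro conjI allI)
  note [simp] = L2_convD(1,2)[OF X] L2_convD(1,2)[OF Y]
  show "(\<lambda>x. X n x + Y n x) \<in> L2 M" for n by (simp add: L2_add)
  show "(\<lambda>x. X' x + Y' x) \<in> L2 M" by (simp add: L2_add)
  have "(\<lambda>n. 2 * (LINT x|M. (X n x - X' x)^2) + 2 * (LINT x|M. (Y n x - Y' x)^2)) \<longlonglongrightarrow> 2 * 0 + 2 * 0"
    by (intro tendsto_intros L2_convD(3)[OF X] L2_convD(3)[OF Y])
  then have lim: "(\<lambda>n. 2 * (LINT x|M. (X n x - X' x)^2) + 2 * (LINT x|M. (Y n x - Y' x)^2)) \<longlonglongrightarrow> 0"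
    by simp
  show "(\<lambda>n. LINT x|M. (X n x + Y n x - (X' x + Y' x))^2) \<longlonglongrightarrow> 0"
  proof (rule tendsto_sandwich[OF _ _ tendsto_const lim]; intro always_eventually allI)
    fix n
    have iX: "integrable M (\<lambda>x. (X n x - X' x)^2)" and iY: "integrable M (\<lambda>x. (Y n x - Y' x)^2)"
      by (auto intro!: L2_square_integrable L2_diff)
    have "(LINT x|M. (X n x + Y n x - (X' x + Y' x))^2) \<le> (LINT x|M. 2 * (X n x - X' x)^2 + 2 * (Y n x - Y' x)^2)"
    proof (rule integral_mono)
      show "integrable M (\<lambda>x. (X n x + Y n x - (X' x + Y' x))^2)"
        by (auto intro!: L2_square_integrable L2_diff L2_add)
      show "integrable M (\<lambda>x. 2 * (X n x - X' x)^2 + 2 * (Y n x - Y' x)^2)"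
        using iX iY by simp
      fix x
      show "(X n x + Y n x - (X' x + Y' x))^2 \<le> 2 * (X n x - X' x)^2 + 2 * (Y n x - Y' x)^2"
        using sum_squares_bound[of "X n x - X' x" "Y n x - Y' x"]
        by (simp add: power2_eq_square algebra_simps)
    qed
    then show "(LINT x|M. (X n x + Y n x - (X' x + Y' x))^2)
        \<le> 2 * (LINT x|M. (X n x - X' x)^2) + 2 * (LINT x|M. (Y n x - Y' x)^2)"
      using iX iY by simp
  qed simp
qed

lemma L2_conv_cmult:
  assumes X: "L2_conv M X X'"
  shows "L2_conv M (\<lambda>n x. c * X n x) (\<lambda>x. c * X' x)"
  unfolding L2_conv_def
proof (intro conjI allI)
  have "(\<lambda>n. c^2 * (LINT x|M. (X n x - X' x)^2)) \<longlonglongrightarrow> c^2 * 0"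
    by (intro tendsto_intros L2_convD(3)[OF X])
  then show "(\<lambda>n. LINT x|M. (c * X n x - c * X' x)^2) \<longlonglongrightarrow> 0"
    by (simp add: right_diff_distrib[symmetric] power_mult_distrib)
qed (use X in \<open>auto simp: L2_convD intro: L2_cmult\<close>)

lemma L2_conv_dominated:
  assumes X: "\<And>n. X n \<in> borel_measurable M" and Y: "Y \<in> borel_measurable M"
    and h: "h \<in> L2 M" and bd: "\<And>n. AE x in M. \<bar>X n x\<bar> \<le> h x"
    and lim: "AE x in M. (\<lambda>n. X n x) \<longlonglongrightarrow> Y x"
  shows "L2_conv M X Y"
proof -
  note [measurable] = L2_measurable[OF h]
  note [measurable] = X Y
  have L2I: "Z \<in> L2 M" if Z [measurable]: "Z \<in> borel_measurable M" and "AE x in M. \<bar>Z x\<bar> \<le> h x" for Z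
  proof -
    have "integrable M (\<lambda>x. (Z x)^2)"
    proof (rule Bochner_Integration.integrable_bound[OF L2_square_integrable[OF h]])
      show "AE x in M. norm ((Z x)^2) \<le> norm ((h x)^2)"
        using that(2)
      proof eventually_elim
        case (elim x)
        then show ?case using power_mono[of "\<bar>Z x\<bar>" "h x" 2] by simp
      qed
    qed measurable
    then show ?thesis by (simp add: L2_def Z)
  qed
  have "AE x in M. \<forall>n. \<bar>X n x\<bar> \<le> h x"
    using bd by (simp add: AE_all_countable)
  with lim have bdY: "AE x in M. \<bar>Y x\<bar> \<le> h x"
  proof eventually_elim
    case (elim x)
    show ?case
      by (rule LIMSEQ_le_const2[OF tendsto_rabs[OF elim(1)]]) (use elim in auto)
  qed
  have YL: "Y \<in> L2 M" using L2I[OF Y bdY] .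
  have XL: "X n \<in> L2 M" for n using L2I[OF X bd] .
  have "(\<lambda>n. LINT x|M. (X n x - Y x)^2) \<longlonglongrightarrow> (LINT x|M. 0)"
  proof (rule integral_dominated_convergence[where w="\<lambda>x. (2 * h x)^2"])
    show "integrable M (\<lambda>x. (2 * h x)^2)"
      using h by (auto intro: L2_square_integrable L2_cmult)
    show "AE x in M. norm ((X n x - Y x)^2) \<le> (2 * h x)^2" for n
      using bd[of n] bdY
    proof eventually_elim
      case (elim x)
      then have "\<bar>X n x - Y x\<bar> \<le> 2 * h x" by linarith
      then show ?case using power_mono[of "\<bar>X n x - Y x\<bar>" "2 * h x" 2] by simp
    qed
    show "AE x in M. (\<lambda>n. (X n x - Y x)^2) \<longlonglongrightarrow> 0"
      using lim
    proof eventually_elim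
      case (elim x)
      have "(\<lambda>n. (X n x - Y x)^2) \<longlonglongrightarrow> (Y x - Y x)^2"
        by (intro tendsto_intros elim)
      then show ?case by simp
    qed
  qed measurable
  then show ?thesis using XL YL by (simp add: L2_conv_def)
qed

text \<open>Split b_n X_n = b_n Y + b_n (X_n - Y): the first summand is dominated by C |Y|, the
  second has norm at most C times that of X_n - Y.\<close>

lemma L2_conv_bounded_mult:
  assumes X: "L2_conv M X Y"
    and b [measurable]: "\<And>n. b n \<in> borel_measurable M" and b' [measurable]: "b' \<in> borel_measurable M"
    and bd: "\<And>n x. x \<in> space M \<Longrightarrow> \<bar>b n x\<bar> \<le> C"
    and lim: "AE x in M. (\<lambda>n. b n x) \<longlonglongrightarrow> b' x"
  shows "L2_conv M (\<lambda>n x. b n x * X n x) (\<lambda>x. b' x * Y x)"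
proof -
  note [simp] = L2_convD(1,2)[OF X] and [measurable] = L2_convD(1,2)[OF X, THEN L2_measurable]
  have 1: "L2_conv M (\<lambda>n x. b n x * Y x) (\<lambda>x. b' x * Y x)"
  proof (rule L2_conv_dominated)
    show "(\<lambda>x. C * \<bar>Y x\<bar>) \<in> L2 M"
      using L2_cmult[of "\<lambda>x. \<bar>Y x\<bar>" M C] L2_convD(2)[OF X] by (simp add: L2_def)
    show "AE x in M. \<bar>b n x * Y x\<bar> \<le> C * \<bar>Y x\<bar>" for n
      using bd by (auto simp: abs_mult intro!: mult_right_mono)
    show "AE x in M. (\<lambda>n. b n x * Y x) \<longlonglongrightarrow> b' x * Y x"
      using lim by eventually_elim (intro tendsto_intros)
  qed measurable
  have 2: "L2_conv M (\<lambda>n x. b n x * (X n x - Y x)) (\<lambda>x. 0)"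
    unfolding L2_conv_def
  proof (intro conjI allI)
    show "(\<lambda>x. b n x * (X n x - Y x)) \<in> L2 M" for n
      using bd by (intro L2_bounded_mult L2_diff) auto
    show "(\<lambda>x. 0) \<in> L2 M" by (simp add: L2_def)
    have lim: "(\<lambda>n. C^2 * (LINT x|M. (X n x - Y x)^2)) \<longlonglongrightarrow> 0"
      using tendsto_mult[OF tendsto_const L2_convD(3)[OF X]] by simp
    show "(\<lambda>n. LINT x|M. (b n x * (X n x - Y x) - 0)^2) \<longlonglongrightarrow> 0"
    proof (rule tendsto_sandwich[OF _ _ tendsto_const lim]; intro always_eventually allI)
      fix n
      have "(LINT x|M. (b n x * (X n x - Y x) - 0)^2) \<le> (LINT x|M. C^2 * (X n x - Y x)^2)"
      proof (rule integral_mono)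
        show "integrable M (\<lambda>x. (b n x * (X n x - Y x) - 0)^2)"
          using bd by (simp, intro L2_square_integrable L2_bounded_mult L2_diff) auto
        show "integrable M (\<lambda>x. C^2 * (X n x - Y x)^2)"
          by (auto intro!: L2_square_integrable L2_diff)
        fix x assume "x \<in> space M"
        then have "(b n x)^2 \<le> C^2" using bd power_mono[of "\<bar>b n x\<bar>" C 2] by simp
        then show "(b n x * (X n x - Y x) - 0)^2 \<le> C^2 * (X n x - Y x)^2"
          by (simp add: power_mult_distrib mult_right_mono)
      qed
      then show "(LINT x|M. (b n x * (X n x - Y x) - 0)^2) \<le> C^2 * (LINT x|M. (X n x - Y x)^2)"
        by simp
    qed simp
  qed
  show ?thesis
    using L2_conv_add[OF 1 2] by (simp add: algebra_simps)
qed

text \<open>Convergence in L2 gives almost sure convergence only along subsequences; this criterion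
  brings the conclusion back to the whole sequence.\<close>

lemma tendsto_if_subseq_subseq:
  fixes a :: "nat \<Rightarrow> 'a::metric_space"
  assumes "\<And>r :: nat \<Rightarrow> nat. strict_mono r \<Longrightarrow> \<exists>s :: nat \<Rightarrow> nat. strict_mono s \<and> (\<lambda>n. a (r (s n))) \<longlonglongrightarrow> L"
  shows "a \<longlonglongrightarrow> L"
proof (rule ccontr)
  assume "\<not> a \<longlonglongrightarrow> L"
  then obtain e where e: "e > 0" and *: "\<not> (\<forall>\<^sub>F n in sequentially. dist (a n) L < e)"
    by (auto simp: tendsto_iff)
  from * have "infinite {n. \<not> dist (a n) L < e}"
    by (simp add: frequently_def[symmetric] INFM_iff_infinite[symmetric] cofinite_eq_sequentially not_eventually)
  then obtain r :: "nat \<Rightarrow> nat" where r: "strict_mono r" "\<And>n. r n \<in> {n. \<not> dist (a n) L < e}"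
    using infinite_enumerate by blast
  obtain s where "(\<lambda>n. a (r (s n))) \<longlonglongrightarrow> L"
    using assms[OF r(1)] by blast
  then have "\<forall>\<^sub>F n in sequentially. dist (a (r (s n))) L < e"
    using e by (auto simp: tendsto_iff)
  then show False using r(2) by (auto simp: eventually_sequentially)
qed

text \<open>Along a subsequence X n tends to 0 almost surely, hence \<rho> (X n) tends to \<rho> 0
  and the bounded multiplier lemma applies. In the sequel X n is f n - 1 and \<rho> is the
  coefficient of a Taylor remainder, which makes expansions possible with second moments
  alone.\<close>

lemma L2_conv_multiplier:
  assumes M: "prob_space M"
    and X: "L2_conv M X (\<lambda>x. 0)" and Z: "L2_conv M Z Y"
    and \<rho> [measurable]: "\<rho> \<in> borel_measurable borel" and cont: "isCont \<rho> 0"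
    and bd: "\<And>n x. x \<in> space M \<Longrightarrow> \<bar>\<rho> (X n x)\<bar> \<le> C"
  shows "L2_conv M (\<lambda>n x. \<rho> (X n x) * Z n x) (\<lambda>x. \<rho> 0 * Y x)"
  unfolding L2_conv_def
proof (intro conjI allI)
  note [simp] = L2_convD(1,2)[OF X] L2_convD(1,2)[OF Z]
  note [measurable] = L2_convD(1)[OF X, THEN L2_measurable]
  show "(\<lambda>x. \<rho> (X n x) * Z n x) \<in> L2 M" for n
    by (rule L2_bounded_mult) (auto intro: bd)
  show "(\<lambda>x. \<rho> 0 * Y x) \<in> L2 M" by (simp add: L2_cmult)
  show "(\<lambda>n. LINT x|M. (\<rho> (X n x) * Z n x - \<rho> 0 * Y x)^2) \<longlonglongrightarrow> 0"
  proof (rule tendsto_if_subseq_subseq)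
    fix r :: "nat \<Rightarrow> nat" assume r: "strict_mono r"
    have "(\<lambda>n. LINT x|M. norm ((X (r n) x)^2)) \<longlonglongrightarrow> 0"
      using L2_convD(3)[OF L2_conv_subseq[OF X r]] by simp
    from tendsto_L1_AE_subseq[OF L2_square_integrable[OF L2_convD(1)[OF X]] this]
    obtain s :: "nat \<Rightarrow> nat" where s: "strict_mono s" and ae: "AE x in M. (\<lambda>n. (X (r (s n)) x)^2) \<longlonglongrightarrow> 0"
      by auto
    have rs: "strict_mono (\<lambda>n. r (s n))" using r s by (simp add: strict_mono_def)
    have "L2_conv M (\<lambda>n x. \<rho> (X (r (s n)) x) * Z (r (s n)) x) (\<lambda>x. \<rho> 0 * Y x)"
    proof (rule L2_conv_bounded_mult[OF L2_conv_subseq[OF Z rs], where C=C])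
      show "AE x in M. (\<lambda>n. \<rho> (X (r (s n)) x)) \<longlonglongrightarrow> \<rho> 0"
        using ae
      proof eventually_elim
        case (elim x)
        then have "(\<lambda>n. X (r (s n)) x) \<longlonglongrightarrow> 0" by (rule tendsto_zero_if_square)
        then show ?case by (rule isCont_tendsto_compose[OF cont])
      qed
    qed (auto intro: bd)
    then show "\<exists>s. strict_mono s \<and> (\<lambda>n. LINT x|M. (\<rho> (X (r (s n)) x) * Z (r (s n)) x - \<rho> 0 * Y x)^2) \<longlonglongrightarrow> 0"
      using s L2_convD(3) by blast
  qed
qed

section \<open>Characteristic functions along local sequences\<close>

text \<open>Imaginary part of the Taylor bound for exp (i y). The quadratic bound yields an
  integrable majorant for square-integrable k.\<close>

lemma abs_sin_minus_le_square: "\<bar>sin y - y\<bar> \<le> y^2 / 2" for y :: real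
proof -
  have "\<bar>Im (iexp y - (\<Sum>k\<le>1. (\<i> * y)^k / fact k))\<bar> \<le> \<bar>y\<bar>^Suc 1 / fact (Suc 1)"
    using order_trans[OF abs_Im_le_cmod iexp_approx1[of y 1]] .
  then show ?thesis by (simp add: Im_exp power2_eq_square)
qed

lemma abs_sin_minus_le_cube: "\<bar>sin y - y\<bar> \<le> \<bar>y\<bar>^3 / 6" for y :: real
proof -
  have "\<bar>Im (iexp y - (\<Sum>k\<le>2. (\<i> * y)^k / fact k))\<bar> \<le> \<bar>y\<bar>^Suc 2 / fact (Suc 2)"
    using order_trans[OF abs_Im_le_cmod iexp_approx1[of y 2]] .
  then show ?thesis by (simp add: Im_exp power2_eq_square numeral_2_eq_2 numeral_3_eq_3)
qed

text \<open>Continuity bounds \<rho> near 0 and the decay bounds it elsewhere. It supplies the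
  boundedness required of multipliers that are quotients by x or x^2.\<close>

lemma bounded_if_isCont_zero_and_decay:
  fixes \<rho> :: "real \<Rightarrow> real"
  assumes cont: "isCont \<rho> 0" and decay: "\<And>x. x \<noteq> 0 \<Longrightarrow> \<bar>\<rho> x\<bar> \<le> A + B / \<bar>x\<bar> + D / x^2"
    and nn: "A \<ge> 0" "B \<ge> 0" "D \<ge> 0"
  shows "\<exists>C. \<forall>x. \<bar>\<rho> x\<bar> \<le> C"
proof -
  obtain s where s: "s > 0" "\<And>x. \<bar>x\<bar> < s \<Longrightarrow> \<bar>\<rho> x - \<rho> 0\<bar> < 1"
    using cont unfolding continuous_at_eps_delta by (auto simp: dist_real_def dest: spec[of _ 1])
  have "\<bar>\<rho> x\<bar> \<le> \<bar>\<rho> 0\<bar> + 1 + A + B / s + D / s^2" for x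
  proof (cases "\<bar>x\<bar> < s")
    case True
    have "0 \<le> B / s" "0 \<le> D / s^2" using s(1) nn by auto
    then show ?thesis using s(2)[OF True] nn by linarith
  next
    case False
    then have x: "s \<le> \<bar>x\<bar>" "x \<noteq> 0" using s(1) by auto
    have "B / \<bar>x\<bar> \<le> B / s" "D / x^2 \<le> D / s^2"
      using x s(1) nn power_mono[of s "\<bar>x\<bar>" 2] by (auto intro!: divide_left_mono)
    then show ?thesis using decay[OF x(2)] by linarith
  qed
  then show ?thesis by blast
qed

lemma tendsto_zero_if_sqrt_mult:
  assumes "(\<lambda>n. sqrt (real n) * a n) \<longlonglongrightarrow> l"
  shows "a \<longlonglongrightarrow> 0"
proof -
  have "(\<lambda>n. 1 / sqrt (real n)) \<longlonglongrightarrow> 0" by real_asymp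
  from tendsto_mult[OF this assms] have "(\<lambda>n. 1 / sqrt (real n) * (sqrt (real n) * a n)) \<longlonglongrightarrow> 0"
    by simp
  then show ?thesis
    by (rule Lim_transform_eventually)
       (use eventually_gt_at_top[of 0] in \<open>eventually_elim, simp\<close>)
qed

lemma (in prob_space) integral_iexp:
  assumes [measurable]: "w \<in> borel_measurable M"
  shows "(LINT x|M. iexp (w x)) = complex_of_real (LINT x|M. cos (w x)) + \<i> * complex_of_real (LINT x|M. sin (w x))"
proof -
  have [simp]: "integrable M (\<lambda>x. cos (w x))" "integrable M (\<lambda>x. sin (w x))"
    by (auto intro!: integrable_const_bound[where B=1])
  have "(LINT x|M. iexp (w x)) = (LINT x|M. complex_of_real (cos (w x)) + \<i> * complex_of_real (sin (w x)))"
    by (simp add: exp_Euler cos_of_real sin_of_real)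
  also have "\<dots> = complex_of_real (LINT x|M. cos (w x)) + \<i> * complex_of_real (LINT x|M. sin (w x))"
    by (subst Bochner_Integration.integral_add) auto
  finally show ?thesis .
qed

text \<open>
  \<open>f n\<close> is the square root of a density of a part of \<open>R n\<close>; it need not be the full absolutely
  continuous part, since only the mass \<open>1 - \<integral>(f n)\<^sup>2\<close> of the remainder has to be \<open>o(1/n)\<close>.
\<close>

locale local_sequence = prob_space M for M :: "'a measure" +
  fixes R :: "nat \<Rightarrow> 'a measure" and f :: "nat \<Rightarrow> 'a \<Rightarrow> real" and G :: "'a \<Rightarrow> real"
  assumes R_prob: "\<And>n. prob_space (R n)"
    and R_sets: "\<And>n. sets (R n) = sets M"
    and f_L2: "\<And>n. f n \<in> L2 M"
    and f_nonneg: "\<And>n x. 0 \<le> f n x"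
    and f_le: "\<And>n h. h \<in> borel_measurable M \<Longrightarrow>
        (\<integral>\<^sup>+x. h x * ennreal ((f n x)^2) \<partial>M) \<le> (\<integral>\<^sup>+x. h x \<partial>R n)"
    and f_conv: "L2_conv M (\<lambda>n x. 2 * sqrt (real n) * (f n x - 1)) G"
    and f_mass: "(\<lambda>n. real n * (1 - (LINT x|M. (f n x)^2))) \<longlonglongrightarrow> 0"
begin

lemma f_measurable [measurable]: "f n \<in> borel_measurable M"
  using f_L2 by (rule L2_measurable)

lemma integrable_f_square [simp]: "integrable M (\<lambda>x. (f n x)^2)"
  using f_L2 by (rule L2_square_integrable)

lemma integrable_bounded_mult_f_square:
  assumes [measurable]: "h \<in> borel_measurable M" and "\<And>x. \<bar>h x\<bar> \<le> 1"
  shows "integrable M (\<lambda>x. h x * (f n x)^2)"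
  by (rule Bochner_Integration.integrable_bound[OF integrable_f_square[of n]])
     (auto simp: abs_mult intro!: mult_left_le_one_le assms)

text \<open>The domination \<open>f_le\<close> is one-sided and for nonnegative functions; applied
  to 1 + h and to 1 - h it bounds the difference from both sides.\<close>

lemma integral_diff_le_mass:
  assumes h [measurable]: "h \<in> borel_measurable M" and bd: "\<And>x. \<bar>h x\<bar> \<le> 1"
  shows "\<bar>(LINT x|R n. h x) - (LINT x|M. h x * (f n x)^2)\<bar> \<le> 1 - (LINT x|M. (f n x)^2)"
proof -
  interpret R: prob_space "R n" by (rule R_prob)
  have hR: "h \<in> borel_measurable (R n)"
    using h measurable_cong_sets[OF R_sets refl] by blast
  have intR: "integrable (R n) h"
    by (rule R.integrable_const_bound[where B=1]) (auto simp: bd hR)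
  have "(LINT x|M. (1 + c * h x) * (f n x)^2) \<le> (LINT x|R n. 1 + c * h x)" if c: "\<bar>c\<bar> = 1" for c :: real
  proof -
    have nn: "0 \<le> 1 + c * h x" for x
    proof -
      have "\<bar>c * h x\<bar> \<le> 1" using bd[of x] c by (simp add: abs_mult)
      then show ?thesis by linarith
    qed
    have int: "integrable M (\<lambda>x. (1 + c * h x) * (f n x)^2)"
      using integrable_bounded_mult_f_square[OF h bd, of n] by (simp add: distrib_right mult.assoc)
    have "ennreal (LINT x|M. (1 + c * h x) * (f n x)^2) = (\<integral>\<^sup>+x. ennreal ((1 + c * h x) * (f n x)^2) \<partial>M)"
      by (rule nn_integral_eq_integral[OF int, symmetric]) (simp add: nn)
    also have "\<dots> = (\<integral>\<^sup>+x. ennreal (1 + c * h x) * ennreal ((f n x)^2) \<partial>M)"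
      by (simp add: ennreal_mult nn)
    also have "\<dots> \<le> (\<integral>\<^sup>+x. ennreal (1 + c * h x) \<partial>R n)"
      by (rule f_le) measurable
    also have "\<dots> = ennreal (LINT x|R n. 1 + c * h x)"
      by (rule nn_integral_eq_integral) (auto simp: nn intR)
    finally show ?thesis
      by (subst (asm) ennreal_le_iff) (auto intro!: integral_nonneg_AE nn)
  qed
  from this[of 1] this[of "-1"] show ?thesis
    using integrable_bounded_mult_f_square[OF h bd, of n] intR
    by (simp add: distrib_right left_diff_distrib R.prob_space abs_le_iff)
qed

text \<open>The missing mass is o(1/n), so n times an expectation under R n may be computed as if (f
  n)^2 were the full density. The term \<open>b\<close> carries the centring -n of the cosine
  integral.\<close>

lemma tendsto_mult_integral_R:
  assumes h: "\<And>n. h n \<in> borel_measurable M" and bd: "\<And>n x. \<bar>h n x\<bar> \<le> 1"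
    and lim: "(\<lambda>n. real n * (LINT x|M. h n x * (f n x)^2) + b n) \<longlonglongrightarrow> l"
  shows "(\<lambda>n. real n * (LINT x|R n. h n x) + b n) \<longlonglongrightarrow> l"
proof -
  have "(\<lambda>n. real n * ((LINT x|R n. h n x) - (LINT x|M. h n x * (f n x)^2))) \<longlonglongrightarrow> 0"
  proof (rule Lim_null_comparison[OF _ f_mass], intro always_eventually allI)
    fix n
    show "norm (real n * ((LINT x|R n. h n x) - (LINT x|M. h n x * (f n x)^2)))
        \<le> real n * (1 - (LINT x|M. (f n x)^2))"
      unfolding real_norm_def abs_mult using integral_diff_le_mass[OF h bd]
      by (simp add: mult_left_mono)
  qed
  from tendsto_add[OF lim this] show ?thesis by (simp add: algebra_simps)
qed

lemma f_minus_one_conv: "L2_conv M (\<lambda>n x. f n x - 1) (\<lambda>x. 0)"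
  unfolding L2_conv_def
proof (intro conjI allI)
  show "(\<lambda>x. f n x - 1) \<in> L2 M" for n
    using L2_diff[OF f_L2 L2_const[OF prob_space_axioms]] .
  show "(\<lambda>x. 0) \<in> L2 M" by (simp add: L2_def)
  have "(\<lambda>n. 1 / (4 * real n)) \<longlonglongrightarrow> 0" by real_asymp
  from tendsto_mult[OF this L2_conv_norm[OF f_conv]]
  have "(\<lambda>n. 1 / (4 * real n) * (LINT x|M. (2 * sqrt (real n) * (f n x - 1))^2)) \<longlonglongrightarrow> 0" by simp
  then show "(\<lambda>n. LINT x|M. (f n x - 1 - 0)^2) \<longlonglongrightarrow> 0"
    by (rule Lim_transform_eventually)
       (use eventually_gt_at_top[of 0] in \<open>eventually_elim, simp add: power_mult_distrib\<close>)
qed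

lemma L2_conv_sqrt_mult_sin:
  assumes k: "k \<in> L2 M" and a: "(\<lambda>n. sqrt (real n) * a n) \<longlonglongrightarrow> a'"
  shows "L2_conv M (\<lambda>n x. sqrt (real n) * sin (a n * k x)) (\<lambda>x. a' * k x)"
proof -
  note [measurable] = L2_measurable[OF k]
  obtain C where C: "\<And>n. \<bar>sqrt (real n) * a n\<bar> \<le> C"
    using convergent_imp_Bseq[OF convergentI[OF a]] by (auto simp: Bseq_def)
  have a0: "a \<longlonglongrightarrow> 0" using a by (rule tendsto_zero_if_sqrt_mult)
  show ?thesis
  proof (rule L2_conv_dominated)
    show "(\<lambda>x. C * \<bar>k x\<bar>) \<in> L2 M"
      using L2_cmult[of "\<lambda>x. \<bar>k x\<bar>" M C] k by (auto simp: L2_def)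
    show "AE x in M. \<bar>sqrt (real n) * sin (a n * k x)\<bar> \<le> C * \<bar>k x\<bar>" for n
    proof (rule AE_I2)
      fix x
      have "\<bar>sqrt (real n) * sin (a n * k x)\<bar> \<le> sqrt (real n) * \<bar>a n * k x\<bar>"
        unfolding abs_mult[of "sqrt _"] by (simp add: abs_sin_x_le_abs_x mult_left_mono)
      also have "\<dots> = \<bar>sqrt (real n) * a n\<bar> * \<bar>k x\<bar>" by (simp add: abs_mult)
      also have "\<dots> \<le> C * \<bar>k x\<bar>" using C by (intro mult_right_mono) auto
      finally show "\<bar>sqrt (real n) * sin (a n * k x)\<bar> \<le> C * \<bar>k x\<bar>" .
    qed
    show "AE x in M. (\<lambda>n. sqrt (real n) * sin (a n * k x)) \<longlonglongrightarrow> a' * k x"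
    proof (rule AE_I2)
      fix x
      have "(\<lambda>n. a n * k x) \<longlonglongrightarrow> 0 * k x" by (intro tendsto_intros a0)
      \<comment> \<open>\<open>sinc\<close> is continuous at 0, which avoids a separate treatment of
        the points where a n * k x vanishes.\<close>
      then have "(\<lambda>n. sinc (a n * k x)) \<longlonglongrightarrow> sinc 0"
        by (intro isCont_tendsto_compose[OF isCont_sinc]) simp
      then have "(\<lambda>n. (sqrt (real n) * a n) * k x * sinc (a n * k x)) \<longlonglongrightarrow> a' * k x * sinc 0"
        by (intro tendsto_intros a)
      moreover have "(sqrt (real n) * a n) * k x * sinc (a n * k x) = sqrt (real n) * sin (a n * k x)" for n
      proof -
        have "y * sinc y = sin y" for y :: real by simp
        from this[of "a n * k x"] show ?thesis by (simp only: mult.assoc)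
      qed
      ultimately show "(\<lambda>n. sqrt (real n) * sin (a n * k x)) \<longlonglongrightarrow> a' * k x"
        by (simp only: mult_1_right if_True simp_thms)
    qed
  qed measurable
qed

text \<open>Since 1 - cos y = 2 sin (y/2)^2, the integral of n (cos (a k) - 1) f^2 is -2 times the
  squared norm of sqrt n sin (a k / 2) f. That function is \<open>?Y\<close>, written with f = 1 +
  (f - 1) so that its L2 limit a' k / 2 can be read off. The mass condition replaces n times the
  integral of f^2 by n.\<close>

lemma tendsto_cos_integral:
  assumes k: "k \<in> L2 M" and a: "(\<lambda>n. sqrt (real n) * a n) \<longlonglongrightarrow> a'"
  shows "(\<lambda>n. real n * (LINT x|R n. cos (a n * k x)) - real n) \<longlonglongrightarrow> - (a'^2 / 2 * (LINT x|M. (k x)^2))"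
proof -
  note [measurable] = L2_measurable[OF k]
  let ?Y = "\<lambda>n x. sqrt (real n) * sin (a n / 2 * k x) + sin (a n / 2 * k x) * (sqrt (real n) * (f n x - 1))"
  have a2: "(\<lambda>n. sqrt (real n) * (a n / 2)) \<longlonglongrightarrow> a' / 2"
    using tendsto_divide[OF a tendsto_const, of 2] by simp
  have a0: "(\<lambda>n. a n / 2) \<longlonglongrightarrow> 0" using tendsto_zero_if_sqrt_mult[OF a2] .
  have v: "L2_conv M (\<lambda>n x. sqrt (real n) * (f n x - 1)) (\<lambda>x. 1 / 2 * G x)"
    using L2_conv_cmult[OF f_conv, of "1/2"] by (simp add: mult.assoc)
  have "L2_conv M (\<lambda>n x. sin (a n / 2 * k x) * (sqrt (real n) * (f n x - 1))) (\<lambda>x. 0 * (1 / 2 * G x))"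
  proof (rule L2_conv_bounded_mult[OF v, where C=1])
    show "AE x in M. (\<lambda>n. sin (a n / 2 * k x)) \<longlonglongrightarrow> 0"
      using tendsto_sin[OF tendsto_mult[OF a0 tendsto_const]] by auto
  qed auto
  from L2_conv_add[OF L2_conv_sqrt_mult_sin[OF k a2] this]
  have "L2_conv M ?Y (\<lambda>x. a' / 2 * k x)" by simp
  from L2_conv_norm[OF this]
  have "(\<lambda>n. - 2 * (LINT x|M. (?Y n x)^2)) \<longlonglongrightarrow> - 2 * (LINT x|M. (a' / 2 * k x)^2)"
    by (intro tendsto_intros)
  also have "- 2 * (LINT x|M. (a' / 2 * k x)^2) = - (a'^2 / 2 * (LINT x|M. (k x)^2))"
    by (simp add: power_mult_distrib power_divide)
  finally have 1: "(\<lambda>n. - 2 * (LINT x|M. (?Y n x)^2)) \<longlonglongrightarrow> - (a'^2 / 2 * (LINT x|M. (k x)^2))" .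
  have eq: "- 2 * (LINT x|M. (?Y n x)^2) - real n * (1 - (LINT x|M. (f n x)^2))
      = real n * (LINT x|M. cos (a n * k x) * (f n x)^2) + (- real n)" for n
  proof -
    have "- 2 * (LINT x|M. (?Y n x)^2) = (LINT x|M. real n * (cos (a n * k x) * (f n x)^2) - real n * (f n x)^2)"
      unfolding Bochner_Integration.integral_mult_right_zero[symmetric]
    proof (rule Bochner_Integration.integral_cong[OF refl])
      fix x
      define y where "y = sin (a n / 2 * k x)"
      have "cos (a n * k x) = 1 - 2 * y^2"
        using cos_double_sin[of "a n / 2 * k x"] by (simp add: y_def)
      moreover have "?Y n x = sqrt (real n) * (y * f n x)"
        unfolding y_def[symmetric] by (simp add: algebra_simps)
      then have "(?Y n x)^2 = real n * (y^2 * (f n x)^2)"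
        by (simp add: power_mult_distrib)
      ultimately show "- 2 * (?Y n x)^2 = real n * (cos (a n * k x) * (f n x)^2) - real n * (f n x)^2"
        by (simp only:) (simp add: algebra_simps)
    qed
    also have "\<dots> = real n * (LINT x|M. cos (a n * k x) * (f n x)^2) - real n * (LINT x|M. (f n x)^2)"
      using integrable_bounded_mult_f_square[of "\<lambda>x. cos (a n * k x)" n] by simp
    finally show ?thesis by (simp add: algebra_simps)
  qed
  have "(\<lambda>n. real n * (LINT x|M. cos (a n * k x) * (f n x)^2) + (- real n))
      \<longlonglongrightarrow> - (a'^2 / 2 * (LINT x|M. (k x)^2)) - 0"
    unfolding eq[symmetric] by (intro tendsto_diff 1 f_mass)
  then have "(\<lambda>n. real n * (LINT x|R n. cos (a n * k x)) + (- real n)) \<longlonglongrightarrow> - (a'^2 / 2 * (LINT x|M. (k x)^2)) - 0"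
    by (rule tendsto_mult_integral_R[rotated 2]) simp_all
  then show ?thesis by simp
qed

text \<open>With v = 2 sqrt n (f - 1) one has n f^2 = n + sqrt n v + v^2 / 4. Integrated against sin
  (a k), the first term vanishes in the limit because k is centred, the last because the sine is
  bounded and tends to 0, and the middle one gives the inner product with G.\<close>

lemma tendsto_sin_integral:
  assumes k: "k \<in> L2 M" and k0: "(LINT x|M. k x) = 0" and a: "(\<lambda>n. sqrt (real n) * a n) \<longlonglongrightarrow> a'"
  shows "(\<lambda>n. real n * (LINT x|R n. sin (a n * k x))) \<longlonglongrightarrow> a' * (LINT x|M. k x * G x)"
proof -
  note [measurable] = L2_measurable[OF k]
  note k_int [simp] = L2_integrable[OF prob_space_axioms k]
  obtain C where C: "\<And>n. \<bar>sqrt (real n) * a n\<bar> \<le> C"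
    using convergent_imp_Bseq[OF convergentI[OF a]] by (auto simp: Bseq_def)
  have a0: "a \<longlonglongrightarrow> 0" using a by (rule tendsto_zero_if_sqrt_mult)
  let ?v = "\<lambda>n x. 2 * sqrt (real n) * (f n x - 1)"
  have [simp]: "integrable M (\<lambda>x. sin (a n * k x))" for n
    by (rule integrable_const_bound[where B=1]) auto
  have 1: "(\<lambda>n. real n * (LINT x|M. sin (a n * k x))) \<longlonglongrightarrow> 0"
  proof -
    have "(\<lambda>n. LINT x|M. real n * (sin (a n * k x) - a n * k x)) \<longlonglongrightarrow> (LINT x|M. 0)"
    proof (rule integral_dominated_convergence[where w="\<lambda>x. C^2 * (k x)^2"])
      show "integrable M (\<lambda>x. C^2 * (k x)^2)" using L2_square_integrable[OF k] by simp
      show "AE x in M. norm (real n * (sin (a n * k x) - a n * k x)) \<le> C^2 * (k x)^2" for n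
      proof (rule AE_I2)
        fix x
        have "norm (real n * (sin (a n * k x) - a n * k x)) \<le> real n * ((a n * k x)^2 / 2)"
          unfolding real_norm_def abs_mult[of "real n"] abs_of_nat by (rule mult_left_mono[OF abs_sin_minus_le_square]) simp
        also have "\<dots> \<le> (sqrt (real n) * a n)^2 * (k x)^2" by (simp add: power_mult_distrib)
        also have "\<dots> \<le> C^2 * (k x)^2"
          using power_mono[OF C abs_ge_zero, of n 2] by (intro mult_right_mono) auto
        finally show "norm (real n * (sin (a n * k x) - a n * k x)) \<le> C^2 * (k x)^2" .
      qed
      show "AE x in M. (\<lambda>n. real n * (sin (a n * k x) - a n * k x)) \<longlonglongrightarrow> 0"
      proof (rule AE_I2)
        fix x
        have "(\<lambda>n. (sqrt (real n) * a n)^2 * (k x)^2 * \<bar>a n * k x\<bar> / 6) \<longlonglongrightarrow> a'^2 * (k x)^2 * \<bar>0 * k x\<bar> / 6"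
          by (intro tendsto_intros a a0) simp
        then have lim: "(\<lambda>n. (sqrt (real n) * a n)^2 * (k x)^2 * \<bar>a n * k x\<bar> / 6) \<longlonglongrightarrow> 0" by simp
        show "(\<lambda>n. real n * (sin (a n * k x) - a n * k x)) \<longlonglongrightarrow> 0"
        proof (rule Lim_null_comparison[OF _ lim], intro always_eventually allI)
          fix n
          have "norm (real n * (sin (a n * k x) - a n * k x)) \<le> real n * (\<bar>a n * k x\<bar>^3 / 6)"
            unfolding real_norm_def abs_mult[of "real n"] abs_of_nat by (rule mult_left_mono[OF abs_sin_minus_le_cube]) simp
          also have "\<dots> = (sqrt (real n) * a n)^2 * (k x)^2 * \<bar>a n * k x\<bar> / 6"
            by (simp add: power_mult_distrib power3_eq_cube power2_eq_square abs_mult mult.assoc mult.left_commute)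
          finally show "norm (real n * (sin (a n * k x) - a n * k x))
              \<le> (sqrt (real n) * a n)^2 * (k x)^2 * \<bar>a n * k x\<bar> / 6" .
        qed
      qed
    qed measurable
    then show ?thesis using k0 by simp
  qed
  have 2: "(\<lambda>n. LINT x|M. sqrt (real n) * sin (a n * k x) * ?v n x) \<longlonglongrightarrow> (LINT x|M. a' * k x * G x)"
    by (rule L2_conv_inner[OF L2_conv_sqrt_mult_sin[OF k a] f_conv])
  have sv: "L2_conv M (\<lambda>n x. sin (a n * k x) * ?v n x) (\<lambda>x. 0 * G x)"
  proof (rule L2_conv_bounded_mult[OF f_conv, where C=1])
    show "AE x in M. (\<lambda>n. sin (a n * k x)) \<longlonglongrightarrow> 0"
      using tendsto_sin[OF tendsto_mult[OF a0 tendsto_const]] by auto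
  qed auto
  have 3: "(\<lambda>n. LINT x|M. sin (a n * k x) * ?v n x * ?v n x) \<longlonglongrightarrow> 0"
    using L2_conv_inner[OF sv f_conv] by simp
  have eq: "real n * (LINT x|M. sin (a n * k x) * (f n x)^2) = real n * (LINT x|M. sin (a n * k x))
      + (LINT x|M. sqrt (real n) * sin (a n * k x) * ?v n x) + 1 / 4 * (LINT x|M. sin (a n * k x) * ?v n x * ?v n x)" for n
  proof -
    have i2: "integrable M (\<lambda>x. sqrt (real n) * sin (a n * k x) * ?v n x)"
      by (intro L2_mult_integrable L2_convD(1)[OF L2_conv_sqrt_mult_sin[OF k a]] L2_convD(1)[OF f_conv])
    have i3: "integrable M (\<lambda>x. sin (a n * k x) * ?v n x * ?v n x)"
      by (intro L2_mult_integrable L2_convD(1)[OF sv] L2_convD(1)[OF f_conv])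
    have "real n * (LINT x|M. sin (a n * k x) * (f n x)^2) = (LINT x|M. real n * sin (a n * k x)
      + sqrt (real n) * sin (a n * k x) * ?v n x + 1 / 4 * (sin (a n * k x) * ?v n x * ?v n x))"
      unfolding Bochner_Integration.integral_mult_right_zero[symmetric]
    proof (rule Bochner_Integration.integral_cong[OF refl])
      fix x
      have "(r * r) * (s * y^2) = (r * r) * s + r * s * (2 * r * (y - 1))
          + 1 / 4 * (s * (2 * r * (y - 1)) * (2 * r * (y - 1)))" for r s y :: real
        by (simp add: algebra_simps power2_eq_square)
      from this[of "sqrt (real n)" "sin (a n * k x)" "f n x"]
      show "real n * (sin (a n * k x) * (f n x)^2) = real n * sin (a n * k x)
          + sqrt (real n) * sin (a n * k x) * ?v n x + 1 / 4 * (sin (a n * k x) * ?v n x * ?v n x)"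
        by simp
    qed
    also have "\<dots> = (LINT x|M. real n * sin (a n * k x) + sqrt (real n) * sin (a n * k x) * ?v n x)
        + (LINT x|M. 1 / 4 * (sin (a n * k x) * ?v n x * ?v n x))"
      by (intro Bochner_Integration.integral_add Bochner_Integration.integrable_add integrable_mult_right i2 i3) simp
    also have "\<dots> = (LINT x|M. real n * sin (a n * k x)) + (LINT x|M. sqrt (real n) * sin (a n * k x) * ?v n x)
        + (LINT x|M. 1 / 4 * (sin (a n * k x) * ?v n x * ?v n x))"
      by (subst Bochner_Integration.integral_add) (auto intro: i2)
    finally show ?thesis by simp
  qed
  have "(\<lambda>n. real n * (LINT x|M. sin (a n * k x) * (f n x)^2) + 0) \<longlonglongrightarrow> 0 + (LINT x|M. a' * k x * G x) + 1 / 4 * 0"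
    unfolding eq add_0_right by (intro tendsto_add tendsto_mult tendsto_const 1 2 3)
  then have "(\<lambda>n. real n * (LINT x|R n. sin (a n * k x)) + 0) \<longlonglongrightarrow> 0 + (LINT x|M. a' * k x * G x) + 1 / 4 * 0"
    by (rule tendsto_mult_integral_R[rotated 2]) simp_all
  then show ?thesis by (simp add: mult.assoc)
qed

lemma tendsto_char_statistic:
  assumes k: "k \<in> L2 M" and k0: "(LINT x|M. k x) = 0" and a: "(\<lambda>n. sqrt (real n) * a n) \<longlonglongrightarrow> a'"
  shows "(\<lambda>n. of_nat n * ((LINT x|R n. iexp (a n * k x)) - 1))
      \<longlonglongrightarrow> complex_of_real (- (a'^2 / 2 * (LINT x|M. (k x)^2))) + \<i> * complex_of_real (a' * (LINT x|M. k x * G x))"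
proof -
  have [measurable]: "k \<in> borel_measurable (R n)" for n
    using L2_measurable[OF k] measurable_cong_sets[OF R_sets refl] by blast
  have eq: "of_nat n * ((LINT x|R n. iexp (a n * k x)) - 1)
      = complex_of_real (real n * (LINT x|R n. cos (a n * k x)) - real n)
        + \<i> * complex_of_real (real n * (LINT x|R n. sin (a n * k x)))" for n
    by (subst prob_space.integral_iexp[OF R_prob]) (auto simp: right_diff_distrib distrib_left)
  show ?thesis
    unfolding eq
    by (intro tendsto_add tendsto_mult tendsto_const tendsto_of_real tendsto_cos_integral tendsto_sin_integral k k0 a)
qed

end

section \<open>The log-likelihood ratio under the hypothesis\<close>

context local_sequence begin

abbreviation v :: "nat \<Rightarrow> 'a \<Rightarrow> real" where "v n x \<equiv> 2 * sqrt (real n) * (f n x - 1)"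

text \<open>Up to the factor 4 this is n times the integral of \<rho> (f - 1) (f - 1)^2, the general
  form of a second-order Taylor remainder.\<close>

lemma tendsto_integral_multiplier_v_square:
  fixes \<rho> :: "real \<Rightarrow> real"
  assumes [measurable]: "\<rho> \<in> borel_measurable borel" and cont: "isCont \<rho> 0" and bd: "\<And>x. \<bar>\<rho> x\<bar> \<le> C"
  shows "(\<lambda>n. LINT x|M. \<rho> (f n x - 1) * v n x * v n x) \<longlonglongrightarrow> \<rho> 0 * (LINT x|M. (G x)^2)"
  using L2_conv_inner[OF L2_conv_multiplier[OF prob_space_axioms f_minus_one_conv f_conv assms(1) cont bd] f_conv]
  by (simp add: power2_eq_square mult.assoc)

text \<open>On the zeros of f the square (f - 1)^2 is 1, so the probability is a second-order
  remainder whose coefficient is the indicator of the point -1. This coefficient vanishes near 0,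
  hence so does the limit.\<close>

lemma tendsto_prob_f_zero: "(\<lambda>n. real n * prob {x \<in> space M. f n x = 0}) \<longlonglongrightarrow> 0"
proof -
  define \<zeta> :: "real \<Rightarrow> real" where "\<zeta> = (\<lambda>x. if x = -1 then 1 else 0)"
  have [measurable]: "\<zeta> \<in> borel_measurable borel" unfolding \<zeta>_def by measurable
  have "\<forall>\<^sub>F x in nhds 0. \<zeta> x = 0"
    using t1_space_nhds[of "0::real" "-1"] by (auto simp: \<zeta>_def elim!: eventually_mono)
  then have cont: "isCont \<zeta> 0"
    by (subst isCont_cong[where g="\<lambda>x. 0"]) auto
  have bd: "\<bar>\<zeta> x\<bar> \<le> 1" for x by (simp add: \<zeta>_def)
  have "(\<lambda>n. 1 / 4 * (LINT x|M. \<zeta> (f n x - 1) * v n x * v n x)) \<longlonglongrightarrow> 1 / 4 * (\<zeta> 0 * (LINT x|M. (G x)^2))"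
    by (intro tendsto_mult tendsto_const tendsto_integral_multiplier_v_square[OF _ cont bd]) measurable
  also have "1 / 4 * (\<zeta> 0 * (LINT x|M. (G x)^2)) = 0" by (simp add: \<zeta>_def)
  also have "(\<lambda>n. 1 / 4 * (LINT x|M. \<zeta> (f n x - 1) * v n x * v n x)) = (\<lambda>n. real n * prob {x \<in> space M. f n x = 0})"
  proof
    fix n
    have "1 / 4 * (LINT x|M. \<zeta> (f n x - 1) * v n x * v n x)
        = (LINT x|M. real n * indicator {x \<in> space M. f n x = 0} x)"
      unfolding Bochner_Integration.integral_mult_right_zero[symmetric]
      by (rule Bochner_Integration.integral_cong[OF refl]) (auto simp: \<zeta>_def indicator_def)
    then show "1 / 4 * (LINT x|M. \<zeta> (f n x - 1) * v n x * v n x) = real n * prob {x \<in> space M. f n x = 0}"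
      by simp
  qed
  finally show ?thesis .
qed

text \<open>Integrate 2 (f - 1) = (f^2 - 1) - (f - 1)^2: the first term is the negligible mass
  defect and the second equals v^2 / (4 n), whence the constant 1/8.\<close>

lemma tendsto_integral_f_minus_one:
  "(\<lambda>n. real n * (LINT x|M. f n x - 1)) \<longlonglongrightarrow> - ((LINT x|M. (G x)^2) / 8)"
proof -
  have "(\<lambda>n. - (real n * (1 - (LINT x|M. (f n x)^2))) / 2 - (LINT x|M. (v n x)^2) / 8)
      \<longlonglongrightarrow> - 0 / 2 - (LINT x|M. (G x)^2) / 8"
    by (intro tendsto_intros f_mass L2_conv_norm[OF f_conv]) auto
  moreover have "- (real n * (1 - (LINT x|M. (f n x)^2))) / 2 - (LINT x|M. (v n x)^2) / 8
      = real n * (LINT x|M. f n x - 1)" for n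
  proof -
    have [simp]: "integrable M (f n)" by (rule L2_integrable[OF prob_space_axioms f_L2])
    have "(LINT x|M. (v n x)^2) = (LINT x|M. 4 * real n * ((f n x)^2 - 2 * f n x + 1))"
      by (rule Bochner_Integration.integral_cong[OF refl]) (simp add: power_mult_distrib power2_diff)
    also have "\<dots> = 4 * real n * ((LINT x|M. (f n x)^2) - 2 * (LINT x|M. f n x) + 1)"
      by (simp add: prob_space)
    finally have eq: "(LINT x|M. (v n x)^2) = 4 * real n * ((LINT x|M. (f n x)^2) - 2 * (LINT x|M. f n x) + 1)" .
    have eq': "(LINT x|M. f n x - 1) = (LINT x|M. f n x) - 1" by (simp add: prob_space)
    show ?thesis unfolding eq eq' by (simp add: field_simps)
  qed
  ultimately show ?thesis by simp
qed

text \<open>The multipliers are chosen so that \<rho> (x) x = sin (u ln (1 + x)) and \<tau> (x) x^2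
  = sin (2 u ln (1 + x)) - 2 u x, identities that also hold at the default value of ln. The real
  part is then a squared norm by the half-angle formula. In the imaginary part ln (1 + x) = x - x^2
  / 2 + ... gives \<tau> (0) = -u; together with the linear term the limit is (-1/4 - 1/4) u
  |G|^2.\<close>

lemma tendsto_char_log_likelihood:
  "(\<lambda>n. of_nat n * ((LINT x|M. iexp (u * (2 * ln (f n x)))) - 1))
    \<longlonglongrightarrow> complex_of_real (- (u^2 / 2 * (LINT x|M. (G x)^2))) + \<i> * complex_of_real (- (u / 2 * (LINT x|M. (G x)^2)))"
proof -
  define \<rho> :: "real \<Rightarrow> real" where "\<rho> = (\<lambda>x. if x = 0 then u else sin (u * ln (1 + x)) / x)"
  define \<tau> :: "real \<Rightarrow> real" where "\<tau> = (\<lambda>x. if x = 0 then - u else (sin (2 * u * ln (1 + x)) - 2 * u * x) / x^2)"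
  have [measurable]: "\<rho> \<in> borel_measurable borel" "\<tau> \<in> borel_measurable borel"
    unfolding \<rho>_def \<tau>_def by measurable
  have "((\<lambda>x. sin (u * ln (1 + x)) / x) \<longlongrightarrow> u) (at 0)" by real_asymp
  then have \<rho>_cont: "isCont \<rho> 0"
    unfolding isCont_def by (rule Lim_cong_within[THEN iffD1, rotated -1]) (auto simp: \<rho>_def)
  have "((\<lambda>x. (sin (2 * u * ln (1 + x)) - 2 * u * x) / x^2) \<longlongrightarrow> - u) (at 0)" by real_asymp
  then have \<tau>_cont: "isCont \<tau> 0"
    unfolding isCont_def by (rule Lim_cong_within[THEN iffD1, rotated -1]) (auto simp: \<tau>_def)
  have "\<exists>C. \<forall>x. \<bar>\<rho> x\<bar> \<le> C"
    by (rule bounded_if_isCont_zero_and_decay[OF \<rho>_cont, of 0 1 0])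
       (auto simp: \<rho>_def abs_mult intro!: divide_right_mono)
  then obtain C where \<rho>_bd: "\<And>x. \<bar>\<rho> x\<bar> \<le> C" by blast
  have "\<exists>C. \<forall>x. \<bar>\<tau> x\<bar> \<le> C"
  proof (rule bounded_if_isCont_zero_and_decay[OF \<tau>_cont, of 0 "2 * \<bar>u\<bar>" 1])
    fix x :: real assume x: "x \<noteq> 0"
    have "\<bar>sin (2 * u * ln (1 + x)) - 2 * u * x\<bar> \<le> 1 + 2 * \<bar>u\<bar> * \<bar>x\<bar>"
    proof -
      have "\<bar>2 * u * x\<bar> = 2 * \<bar>u\<bar> * \<bar>x\<bar>" by (simp add: abs_mult)
      then show ?thesis
        using abs_sin_le_one[of "2 * u * ln (1 + x)"] abs_triangle_ineq4[of "sin (2 * u * ln (1 + x))" "2 * u * x"]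
        by linarith
    qed
    then have "\<bar>\<tau> x\<bar> \<le> (1 + 2 * \<bar>u\<bar> * \<bar>x\<bar>) / x^2"
      using x by (simp add: \<tau>_def divide_right_mono)
    also have "\<dots> = 0 + 2 * \<bar>u\<bar> / \<bar>x\<bar> + 1 / x^2"
    proof -
      define y where "y = \<bar>x\<bar>"
      have "x^2 = y * y" "y \<noteq> 0" using x by (simp_all add: y_def power2_eq_square)
      then show ?thesis unfolding y_def[symmetric] by (simp add: field_simps)
    qed
    finally show "\<bar>\<tau> x\<bar> \<le> 0 + 2 * \<bar>u\<bar> / \<bar>x\<bar> + 1 / x^2" .
  qed auto
  then obtain D where \<tau>_bd: "\<And>x. \<bar>\<tau> x\<bar> \<le> D" by blast

  have "(\<lambda>n. - (1 / 2) * (LINT x|M. (\<rho> (f n x - 1) * v n x)^2)) \<longlonglongrightarrow> - (1 / 2) * (LINT x|M. (\<rho> 0 * G x)^2)"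
    by (intro tendsto_mult tendsto_const L2_conv_norm
        L2_conv_multiplier[OF prob_space_axioms f_minus_one_conv f_conv _ \<rho>_cont \<rho>_bd]) measurable
  also have "- (1 / 2) * (LINT x|M. (\<rho> 0 * G x)^2) = - (u^2 / 2 * (LINT x|M. (G x)^2))"
    by (simp add: \<rho>_def power_mult_distrib)
  also have "(\<lambda>n. - (1 / 2) * (LINT x|M. (\<rho> (f n x - 1) * v n x)^2))
      = (\<lambda>n. real n * (LINT x|M. cos (u * (2 * ln (f n x)))) - real n)"
  proof
    fix n
    have "- (1 / 2) * (LINT x|M. (\<rho> (f n x - 1) * v n x)^2) = (LINT x|M. real n * cos (u * (2 * ln (f n x))) - real n)"
      unfolding Bochner_Integration.integral_mult_right_zero[symmetric]
    proof (rule Bochner_Integration.integral_cong[OF refl])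
      fix x
      define s where "s = sin (u * ln (f n x))"
      have "\<rho> (f n x - 1) * v n x = 2 * sqrt (real n) * s" by (auto simp: \<rho>_def s_def)
      then have 1: "(\<rho> (f n x - 1) * v n x)^2 = 4 * real n * s^2" by (simp only: power_mult_distrib) simp
      have "u * (2 * ln (f n x)) = 2 * (u * ln (f n x))" by simp
      then have 2: "cos (u * (2 * ln (f n x))) = 1 - 2 * s^2" unfolding s_def by (simp only: cos_double_sin)
      show "- (1 / 2) * (\<rho> (f n x - 1) * v n x)^2 = real n * cos (u * (2 * ln (f n x))) - real n"
        unfolding 1 2 by (simp add: algebra_simps)
    qed
    also have "\<dots> = real n * (LINT x|M. cos (u * (2 * ln (f n x)))) - real n"
      by (subst Bochner_Integration.integral_diff)
         (auto simp: prob_space intro!: integrable_mult_right integrable_const_bound[where B=1])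
    finally show "- (1 / 2) * (LINT x|M. (\<rho> (f n x - 1) * v n x)^2)
        = real n * (LINT x|M. cos (u * (2 * ln (f n x)))) - real n" .
  qed
  finally have re: "(\<lambda>n. real n * (LINT x|M. cos (u * (2 * ln (f n x)))) - real n) \<longlonglongrightarrow> - (u^2 / 2 * (LINT x|M. (G x)^2))" .

  have "(\<lambda>n. 2 * u * (real n * (LINT x|M. f n x - 1)) + 1 / 4 * (LINT x|M. \<tau> (f n x - 1) * v n x * v n x))
      \<longlonglongrightarrow> 2 * u * - ((LINT x|M. (G x)^2) / 8) + 1 / 4 * (\<tau> 0 * (LINT x|M. (G x)^2))"
    by (intro tendsto_add tendsto_mult tendsto_const tendsto_integral_f_minus_one
        tendsto_integral_multiplier_v_square[OF _ \<tau>_cont \<tau>_bd]) measurable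
  also have "2 * u * - ((LINT x|M. (G x)^2) / 8) + 1 / 4 * (\<tau> 0 * (LINT x|M. (G x)^2)) = - (u / 2 * (LINT x|M. (G x)^2))"
    by (simp add: \<tau>_def)
  also have "(\<lambda>n. 2 * u * (real n * (LINT x|M. f n x - 1)) + 1 / 4 * (LINT x|M. \<tau> (f n x - 1) * v n x * v n x))
      = (\<lambda>n. real n * (LINT x|M. sin (u * (2 * ln (f n x)))))"
  proof
    fix n
    have i1: "integrable M (\<lambda>x. f n x - 1)"
      by (rule L2_integrable[OF prob_space_axioms L2_convD(1)[OF f_minus_one_conv]])
    have i2: "integrable M (\<lambda>x. \<tau> (f n x - 1) * v n x * v n x)"
      by (intro L2_mult_integrable L2_bounded_mult[where C=D] L2_convD(1)[OF f_conv] \<tau>_bd) measurable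
    have "real n * (LINT x|M. sin (u * (2 * ln (f n x))))
        = (LINT x|M. 2 * u * (real n * (f n x - 1)) + 1 / 4 * (\<tau> (f n x - 1) * v n x * v n x))"
      unfolding Bochner_Integration.integral_mult_right_zero[symmetric]
    proof (rule Bochner_Integration.integral_cong[OF refl])
      fix x
      define y where "y = f n x - 1"
      have "\<tau> y * y^2 = sin (2 * u * ln (1 + y)) - 2 * u * y" by (auto simp: \<tau>_def)
      then have 1: "sin (u * (2 * ln (f n x))) = 2 * u * y + \<tau> y * y^2"
        by (simp add: y_def mult.assoc mult.left_commute)
      have 2: "\<tau> (f n x - 1) * v n x * v n x = 4 * (real n * (\<tau> y * y^2))"
        unfolding y_def[symmetric] by (simp add: power2_eq_square)
      show "real n * sin (u * (2 * ln (f n x)))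
          = 2 * u * (real n * (f n x - 1)) + 1 / 4 * (\<tau> (f n x - 1) * v n x * v n x)"
        unfolding 1 2 unfolding y_def[symmetric] by (simp add: distrib_left mult.left_commute)
    qed
    also have "\<dots> = 2 * u * (real n * (LINT x|M. f n x - 1)) + 1 / 4 * (LINT x|M. \<tau> (f n x - 1) * v n x * v n x)"
      unfolding Bochner_Integration.integral_mult_right_zero[symmetric]
      by (rule Bochner_Integration.integral_add) (intro integrable_mult_right i1 i2)+
    finally show "2 * u * (real n * (LINT x|M. f n x - 1)) + 1 / 4 * (LINT x|M. \<tau> (f n x - 1) * v n x * v n x)
        = real n * (LINT x|M. sin (u * (2 * ln (f n x))))" ..
  qed
  finally have im: "(\<lambda>n. real n * (LINT x|M. sin (u * (2 * ln (f n x))))) \<longlonglongrightarrow> - (u / 2 * (LINT x|M. (G x)^2))" .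

  have eq: "of_nat n * ((LINT x|M. iexp (u * (2 * ln (f n x)))) - 1)
      = complex_of_real (real n * (LINT x|M. cos (u * (2 * ln (f n x)))) - real n)
        + \<i> * complex_of_real (real n * (LINT x|M. sin (u * (2 * ln (f n x)))))" for n
    by (subst integral_iexp) (auto simp: right_diff_distrib distrib_left)
  show ?thesis
    unfolding eq by (intro tendsto_add tendsto_mult tendsto_const tendsto_of_real re im)
qed

end

section \<open>The two-sample central limit theorem\<close>

text \<open>The power is exp (m Ln (1 + z)), and Ln (1 + z) = z L (z) with L the continuous
  extension of Ln (1 + y) / y, so that z n = 0 is covered. The exponent is a separate sequence
  because it will be n1 or n2 while the index is n.\<close>

lemma tendsto_one_plus_power_exp:
  fixes z :: "nat \<Rightarrow> complex"
  assumes z: "z \<longlonglongrightarrow> 0" and mz: "(\<lambda>n. of_nat (m n) * z n) \<longlonglongrightarrow> w"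
  shows "(\<lambda>n. (1 + z n) ^ m n) \<longlonglongrightarrow> exp w"
proof -
  define L :: "complex \<Rightarrow> complex" where "L = (\<lambda>y. if y = 0 then 1 else Ln (1 + y) / y)"
  have "(Ln has_field_derivative 1) (at 1)"
    using has_field_derivative_Ln[of 1] by simp
  then have "((\<lambda>y. Ln (1 + y) / y) \<longlongrightarrow> 1) (at 0)"
    by (simp add: DERIV_def)
  then have "isCont L 0"
    unfolding isCont_def by (rule Lim_cong_within[THEN iffD1, rotated -1]) (auto simp: L_def)
  then have "(\<lambda>n. L (z n)) \<longlonglongrightarrow> L 0"
    using z by (rule isCont_tendsto_compose)
  then have "(\<lambda>n. of_nat (m n) * z n * L (z n)) \<longlonglongrightarrow> w * 1"
    by (intro tendsto_mult mz) (simp add: L_def)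
  then have "(\<lambda>n. exp (of_nat (m n) * z n * L (z n))) \<longlonglongrightarrow> exp w"
    by (intro tendsto_exp) simp
  moreover have "\<forall>\<^sub>F n in sequentially. exp (of_nat (m n) * z n * L (z n)) = (1 + z n) ^ m n"
  proof -
    have "\<forall>\<^sub>F n in sequentially. dist (z n) 0 < 1"
      using z by (rule tendstoD) simp
    then show ?thesis
    proof eventually_elim
      case (elim n)
      then have "1 + z n \<noteq> 0"
        by (metis add_eq_0_iff dist_0_norm dist_commute less_irrefl norm_minus_cancel norm_one)
      moreover have "z n * L (z n) = Ln (1 + z n)" by (simp add: L_def)
      ultimately show ?case
        by (simp add: mult.assoc exp_of_nat_mult)
    qed
  qed
  ultimately show ?thesis by (rule Lim_transform_eventually)
qed

lemma distr_pair_snd: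
  assumes "prob_space M1" "prob_space M2"
  shows "distr (M1 \<Otimes>\<^sub>M M2) M2 snd = M2"
proof (rule measure_eqI)
  interpret M1: prob_space M1 by fact
  interpret M2: prob_space M2 by fact
  fix B assume "B \<in> sets (distr (M1 \<Otimes>\<^sub>M M2) M2 snd)"
  then have B: "B \<in> sets M2" by simp
  have "snd -` B \<inter> space (M1 \<Otimes>\<^sub>M M2) = space M1 \<times> B"
    using sets.sets_into_space[OF B] by (auto simp: space_pair_measure)
  then show "emeasure (distr (M1 \<Otimes>\<^sub>M M2) M2 snd) B = emeasure M2 B"
    using B by (simp add: emeasure_distr M2.emeasure_pair_measure_Times M1.emeasure_space_1)
qed simp

lemma tendsto_first_fraction:
  assumes sizes: "\<And>n. n1 n + n2 n = n" and d: "(\<lambda>n. real (n2 n) / real n) \<longlonglongrightarrow> d"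
  shows "(\<lambda>n. real (n1 n) / real n) \<longlonglongrightarrow> 1 - d"
proof -
  have "(\<lambda>n. 1 - real (n2 n) / real n) \<longlonglongrightarrow> 1 - d" by (intro tendsto_intros d)
  then show ?thesis
  proof (rule Lim_transform_eventually)
    show "\<forall>\<^sub>F n in sequentially. 1 - real (n2 n) / real n = real (n1 n) / real n"
      using eventually_gt_at_top[of 0]
    proof eventually_elim
      case (elim n)
      have "real (n1 n) + real (n2 n) = real n" using sizes[of n] by linarith
      then show ?case using elim by (simp add: field_simps)
    qed
  qed
qed

lemma prob_space_two_sample:
  assumes "prob_space P" "prob_space Q"
  shows "prob_space (two_sample m1 m2 P Q)"
  unfolding two_sample_def using assms
  by (intro prob_space_pair prob_space_PiM)

lemma sets_two_sample_cong:
  assumes "sets P = sets P'" "sets Q = sets Q'"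
  shows "sets (two_sample m1 m2 P Q) = sets (two_sample m1 m2 P' Q')"
  unfolding two_sample_def using assms by (intro sets_pair_measure_cong sets_PiM_cong) auto

lemma measurable_two_sample_fst:
  assumes "h \<in> measurable P N" "i < m1"
  shows "(\<lambda>\<omega>. h (fst \<omega> i)) \<in> measurable (two_sample m1 m2 P Q) N"
  unfolding two_sample_def
  by (rule measurable_compose[OF _ assms(1)], rule measurable_compose[OF measurable_fst])
     (use assms(2) in auto)

lemma measurable_two_sample_snd:
  assumes "h \<in> measurable Q N" "j < m2"
  shows "(\<lambda>\<omega>. h (snd \<omega> j)) \<in> measurable (two_sample m1 m2 P Q) N"
  unfolding two_sample_def
  by (rule measurable_compose[OF _ assms(1)], rule measurable_compose[OF measurable_snd])
     (use assms(2) in auto)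

lemma integral_two_sample_prod:
  fixes F :: "'a \<Rightarrow> complex" and H :: "'b \<Rightarrow> complex"
  assumes P: "prob_space P" and Q: "prob_space Q"
    and F: "F \<in> borel_measurable P" "\<And>x. norm (F x) \<le> 1"
    and H: "H \<in> borel_measurable Q" "\<And>x. norm (H x) \<le> 1"
  shows "(LINT \<omega>|two_sample m1 m2 P Q. (\<Prod>i<m1. F (fst \<omega> i)) * (\<Prod>j<m2. H (snd \<omega> j)))
      = (LINT x|P. F x) ^ m1 * (LINT y|Q. H y) ^ m2"
proof -
  interpret P: prob_space P by fact
  interpret Q: prob_space Q by fact
  interpret PP: prob_space "Pi\<^sub>M {..<m1} (\<lambda>_. P)" using P by (intro prob_space_PiM)
  interpret QQ: prob_space "Pi\<^sub>M {..<m2} (\<lambda>_. Q)" using Q by (intro prob_space_PiM)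
  interpret PQ: pair_prob_space "Pi\<^sub>M {..<m1} (\<lambda>_. P)" "Pi\<^sub>M {..<m2} (\<lambda>_. Q)" ..
  interpret prP: product_sigma_finite "\<lambda>_::nat. P" by standard
  interpret prQ: product_sigma_finite "\<lambda>_::nat. Q" by standard
  have 1: "(LINT \<omega>|Pi\<^sub>M {..<m1} (\<lambda>_. P). (\<Prod>i<m1. F (\<omega> i))) = (LINT x|P. F x) ^ m1"
    by (subst prP.product_integral_prod) (auto intro!: P.integrable_const_bound[where B=1] F)
  have 2: "(LINT \<omega>|Pi\<^sub>M {..<m2} (\<lambda>_. Q). (\<Prod>j<m2. H (\<omega> j))) = (LINT y|Q. H y) ^ m2"
    by (subst prQ.product_integral_prod) (auto intro!: Q.integrable_const_bound[where B=1] H)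
  have bd: "norm (\<Prod>i\<in>A. g i) \<le> 1" if "\<And>i. norm (g i) \<le> 1" for A :: "nat set" and g :: "nat \<Rightarrow> complex"
    using that by (simp add: prod_norm[symmetric] prod_le_1)
  have "integrable (Pi\<^sub>M {..<m1} (\<lambda>_. P) \<Otimes>\<^sub>M Pi\<^sub>M {..<m2} (\<lambda>_. Q))
      (\<lambda>\<omega>. (\<Prod>i<m1. F (fst \<omega> i)) * (\<Prod>j<m2. H (snd \<omega> j)))"
  proof (rule PQ.integrable_const_bound[where B=1])
    show "AE \<omega> in Pi\<^sub>M {..<m1} (\<lambda>_. P) \<Otimes>\<^sub>M Pi\<^sub>M {..<m2} (\<lambda>_. Q).
        norm ((\<Prod>i<m1. F (fst \<omega> i)) * (\<Prod>j<m2. H (snd \<omega> j))) \<le> 1"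
      using bd F(2) H(2) by (intro AE_I2) (simp add: norm_mult mult_le_one)
    show "(\<lambda>\<omega>. (\<Prod>i<m1. F (fst \<omega> i)) * (\<Prod>j<m2. H (snd \<omega> j)))
        \<in> borel_measurable (Pi\<^sub>M {..<m1} (\<lambda>_. P) \<Otimes>\<^sub>M Pi\<^sub>M {..<m2} (\<lambda>_. Q))"
      unfolding two_sample_def[symmetric]
      by (intro borel_measurable_times borel_measurable_prod measurable_two_sample_fst measurable_two_sample_snd F H) auto
  qed
  from PQ.integral_fst'[OF this] show ?thesis
    by (simp add: two_sample_def 1 2)
qed

text \<open>The characteristic function is a product of two powers, so the limits z1 and z2 enter
  with the sample fractions 1 - d and d as weights. The laws of the summands change with n. The
  lemma serves twice: for the test statistic under alternatives and for the log-likelihood ratio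
  under the hypothesis.\<close>

lemma weak_conv_two_sample_statistic:
  fixes a :: "nat \<Rightarrow> 'a \<Rightarrow> real" and b :: "nat \<Rightarrow> 'b \<Rightarrow> real"
  assumes P: "\<And>n. prob_space (P n)" and Q: "\<And>n. prob_space (Q n)"
    and a [measurable]: "\<And>n. a n \<in> borel_measurable (P n)"
    and b [measurable]: "\<And>n. b n \<in> borel_measurable (Q n)"
    and sizes: "\<And>n. n1 n + n2 n = n" and d: "(\<lambda>n. real (n2 n) / real n) \<longlonglongrightarrow> d"
    and z1: "\<And>u. (\<lambda>n. of_nat n * ((LINT x|P n. iexp (u * a n x)) - 1)) \<longlonglongrightarrow> z1 u"
    and z2: "\<And>u. (\<lambda>n. of_nat n * ((LINT y|Q n. iexp (u * b n y)) - 1)) \<longlonglongrightarrow> z2 u"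
    and z: "\<And>u. complex_of_real (1 - d) * z1 u + complex_of_real d * z2 u
        = complex_of_real (- (\<sigma>^2 * u^2 / 2)) + \<i> * complex_of_real (m * u)"
    and \<sigma>: "\<sigma> > 0"
  shows "weak_conv_m (\<lambda>n. distr (two_sample (n1 n) (n2 n) (P n) (Q n)) borel
      (\<lambda>\<omega>. ((\<Sum>i<n1 n. a n (fst \<omega> i)) + (\<Sum>j<n2 n. b n (snd \<omega> j)) - m) / \<sigma>)) std_normal_distribution"
proof (rule levy_continuity)
  let ?N = "\<lambda>n. two_sample (n1 n) (n2 n) (P n) (Q n)"
  let ?X = "\<lambda>n \<omega>. ((\<Sum>i<n1 n. a n (fst \<omega> i)) + (\<Sum>j<n2 n. b n (snd \<omega> j)) - m) / \<sigma>"
  have X [measurable]: "?X n \<in> borel_measurable (?N n)" for n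
    by (intro borel_measurable_divide borel_measurable_diff borel_measurable_add borel_measurable_sum
        borel_measurable_const measurable_two_sample_fst measurable_two_sample_snd a b) auto
  show "real_distribution (distr (?N n) borel (?X n))" for n
    by (intro prob_space.real_distribution_distr prob_space_two_sample P Q X)
  show "real_distribution std_normal_distribution" by (rule real_dist_normal_dist)
  fix t :: real
  define u where "u = t / \<sigma>"
  define y1 where "y1 n = (LINT x|P n. iexp (u * a n x)) - 1" for n
  define y2 where "y2 n = (LINT y|Q n. iexp (u * b n y)) - 1" for n
  have char: "char (distr (?N n) borel (?X n)) t = iexp (- (u * m)) * ((1 + y1 n) ^ n1 n * (1 + y2 n) ^ n2 n)" for n
  proof -
    have "char (distr (?N n) borel (?X n)) t = (LINT \<omega>|?N n. iexp (t * ?X n \<omega>))"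
      unfolding char_def by (subst integral_distr) auto
    also have "\<dots> = (LINT \<omega>|?N n. iexp (- (u * m)) *
        ((\<Prod>i<n1 n. iexp (u * a n (fst \<omega> i))) * (\<Prod>j<n2 n. iexp (u * b n (snd \<omega> j)))))"
    proof (rule Bochner_Integration.integral_cong[OF refl])
      fix \<omega> :: "(nat \<Rightarrow> 'a) \<times> (nat \<Rightarrow> 'b)"
      have "t * ?X n \<omega> = - (u * m) + ((\<Sum>i<n1 n. u * a n (fst \<omega> i)) + (\<Sum>j<n2 n. u * b n (snd \<omega> j)))"
        unfolding sum_distrib_left[symmetric] u_def by (simp add: add_divide_distrib diff_divide_distrib algebra_simps)
      then show "iexp (t * ?X n \<omega>) = iexp (- (u * m)) *
          ((\<Prod>i<n1 n. iexp (u * a n (fst \<omega> i))) * (\<Prod>j<n2 n. iexp (u * b n (snd \<omega> j))))"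
        by (simp only: of_real_add of_real_sum distrib_left exp_add sum_distrib_left exp_sum finite_lessThan)
    qed
    also have "\<dots> = iexp (- (u * m)) * ((LINT x|P n. iexp (u * a n x)) ^ n1 n * (LINT y|Q n. iexp (u * b n y)) ^ n2 n)"
      unfolding Bochner_Integration.integral_mult_right_zero
      by (subst integral_two_sample_prod[OF P Q]) (auto simp: norm_exp_i_times)
    finally show ?thesis by (simp add: y1_def y2_def)
  qed
  note d' = tendsto_first_fraction[OF sizes d]
  \<comment> \<open>The hypotheses are normalised by n but the powers are n1 n and n2 n; the
    limiting sample fraction enters as the factor q.\<close>
  have scale: "y \<longlonglongrightarrow> 0 \<and> (\<lambda>n. of_nat (k n) * y n) \<longlonglongrightarrow> complex_of_real q * w"
    if y: "(\<lambda>n. of_nat n * y n) \<longlonglongrightarrow> w" and k: "(\<lambda>n. real (k n) / real n) \<longlonglongrightarrow> q" and kn: "\<And>n. k n \<le> n"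
    for y :: "nat \<Rightarrow> complex" and k q w
  proof
    have "(\<lambda>n. complex_of_real (1 / real n)) \<longlonglongrightarrow> complex_of_real 0"
      by (intro tendsto_of_real lim_1_over_n)
    from tendsto_mult[OF this y] have "(\<lambda>n. complex_of_real (1 / real n) * (of_nat n * y n)) \<longlonglongrightarrow> 0" by simp
    then show "y \<longlonglongrightarrow> 0"
      by (rule Lim_transform_eventually) (use eventually_gt_at_top[of 0] in \<open>eventually_elim, simp\<close>)
    have "(\<lambda>n. complex_of_real (real (k n) / real n) * (of_nat n * y n)) \<longlonglongrightarrow> complex_of_real q * w"
      by (intro tendsto_mult tendsto_of_real k y)
    then show "(\<lambda>n. of_nat (k n) * y n) \<longlonglongrightarrow> complex_of_real q * w"
      by (rule Lim_transform_eventually) (use eventually_gt_at_top[of 0] in \<open>eventually_elim, simp\<close>)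
  qed
  have n1: "n1 n \<le> n" and n2: "n2 n \<le> n" for n using sizes[of n] by linarith+
  have "(\<lambda>n. iexp (- (u * m)) * ((1 + y1 n) ^ n1 n * (1 + y2 n) ^ n2 n))
      \<longlonglongrightarrow> iexp (- (u * m)) * (exp (complex_of_real (1 - d) * z1 u) * exp (complex_of_real d * z2 u))"
    using scale[OF z1[of u, folded y1_def] d' n1] scale[OF z2[of u, folded y2_def] d n2]
    by (elim conjE)
       (rule tendsto_mult[OF tendsto_const tendsto_mult[OF tendsto_one_plus_power_exp tendsto_one_plus_power_exp]])
  also have "iexp (- (u * m)) * (exp (complex_of_real (1 - d) * z1 u) * exp (complex_of_real d * z2 u))
      = exp (complex_of_real (- (\<sigma>^2 * u^2 / 2)))"
    unfolding exp_add[symmetric] z by (simp add: algebra_simps)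
  also have "\<dots> = char std_normal_distribution t"
  proof -
    have "\<sigma>^2 * u^2 / 2 = t^2 / 2" using \<sigma> by (simp add: u_def power_divide)
    then show ?thesis unfolding exp_of_real char_std_normal_distribution by simp
  qed
  finally show "(\<lambda>n. char (distr (?N n) borel (?X n)) t) \<longlonglongrightarrow> char std_normal_distribution t"
    unfolding char .
qed

section \<open>The standard normal distribution\<close>

abbreviation \<Phi> :: "real \<Rightarrow> real" where
  "\<Phi> \<equiv> cdf std_normal_distribution"

lemma isCont_cdf_std_normal: "isCont (\<Phi>) x"
proof -
  interpret real_distribution std_normal_distribution by (rule real_dist_normal_dist)
  have "emeasure std_normal_distribution {x} = 0"
    by (subst emeasure_density)
       (auto simp: nn_integral_indicator_singleton)
  then show ?thesis by (simp add: isCont_cdf measure_def)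
qed

text \<open>\<open>inv\<close> picks some preimage, and one exists by the intermediate value theorem
  between the limits 0 and 1.\<close>

lemma cdf_std_normal_inv:
  assumes "0 < y" "y < 1"
  shows "\<Phi> (inv (\<Phi>) y) = y"
proof -
  interpret real_distribution std_normal_distribution by (rule real_dist_normal_dist)
  let ?F = "\<Phi>"
  have "\<forall>\<^sub>F x in at_top. y < ?F x"
    using cdf_lim_at_top_prob assms(2) by (rule order_tendstoD(1))
  then obtain b where b: "y < ?F b" by (metis eventually_at_top_linorder order_refl)
  have "\<forall>\<^sub>F x in at_bot. ?F x < y"
    using cdf_lim_at_bot assms(1) by (rule order_tendstoD(2))
  then obtain a where a: "?F a < y" by (metis eventually_at_bot_linorder order_refl)
  have "a \<le> b"
    using a b cdf_nondecreasing[of b a] by (cases "a \<le> b") auto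
  then have "\<exists>x. a \<le> x \<and> x \<le> b \<and> ?F x = y"
    using a b isCont_cdf_std_normal by (intro IVT) auto
  then show ?thesis by (metis f_inv_into_f rangeI)
qed

text \<open>The exponential is the density of N(\<sigma>, 1) with respect to N(0, 1), and \<kappa>
  is its value at u. Below u the minimum is this density, which contributes the N(\<sigma>, 1) mass
  of the half-line; above u it is the constant \<kappa>.\<close>

lemma integral_min_exp_std_normal:
  fixes \<sigma> u :: real
  defines "\<kappa> \<equiv> exp (\<sigma> * u - \<sigma>^2 / 2)"
  assumes \<sigma>: "\<sigma> > 0"
  shows "(LINT x|std_normal_distribution. min (exp (\<sigma> * x - \<sigma>^2 / 2)) \<kappa>) \<ge>
    \<Phi> (u - \<sigma>) + \<kappa> * (1 - \<Phi> u)"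
proof -
  interpret real_distribution std_normal_distribution by (rule real_dist_normal_dist)
  have std: "std_normal_density x * exp (\<sigma> * x - \<sigma>^2 / 2) = std_normal_density (x - \<sigma>)" for x
    unfolding std_normal_density_def by (simp add: exp_add[symmetric] power2_eq_square field_simps)
  have min: "min (exp (\<sigma> * x - \<sigma>^2 / 2)) \<kappa> = indicator {..u} x * exp (\<sigma> * x - \<sigma>^2 / 2) + \<kappa> * indicator {u<..} x" for x
    using \<sigma> by (auto simp: \<kappa>_def indicator_def min_def)
  have int1: "integrable std_normal_distribution (\<lambda>x. indicator {..u} x * exp (\<sigma> * x - \<sigma>^2 / 2))"
    by (rule integrable_const_bound[where B=\<kappa>]) (auto simp: \<kappa>_def indicator_def \<sigma>)
  have int2: "integrable std_normal_distribution (\<lambda>x. \<kappa> * indicator {u<..} x)"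
    by (rule integrable_const_bound[where B=\<kappa>]) (auto simp: \<kappa>_def indicator_def)
  have "(LINT x|std_normal_distribution. min (exp (\<sigma> * x - \<sigma>^2 / 2)) \<kappa>)
      = (LINT x|std_normal_distribution. indicator {..u} x * exp (\<sigma> * x - \<sigma>^2 / 2)) + \<kappa> * prob {u<..}"
    unfolding min using int1 int2 by simp
  moreover have "prob {u<..} = 1 - \<Phi> u"
  proof -
    have "{u<..} = space std_normal_distribution - {..u}" by auto
    then show ?thesis unfolding cdf_def by (subst prob_compl[symmetric]) auto
  qed
  moreover have "(LINT x|std_normal_distribution. indicator {..u} x * exp (\<sigma> * x - \<sigma>^2 / 2))
      = \<Phi> (u - \<sigma>)"
  proof -
    have "(LINT x|std_normal_distribution. indicator {..u} x * exp (\<sigma> * x - \<sigma>^2 / 2))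
        = (LINT x|lborel. std_normal_density x *\<^sub>R (indicator {..u} x * exp (\<sigma> * x - \<sigma>^2 / 2)))"
      by (rule integral_density) auto
    also have "\<dots> = (LINT x|lborel. indicator {..u} x * std_normal_density (x - \<sigma>))"
      by (rule Bochner_Integration.integral_cong) (auto simp: std[symmetric])
    also have "\<dots> = (LINT x|lborel. indicator {..u - \<sigma>} x * std_normal_density x)"
      by (subst lborel_integral_real_affine[where c=1 and t=\<sigma>])
         (auto intro!: Bochner_Integration.integral_cong simp: indicator_def)
    also have "\<dots> = (LINT x|lborel. std_normal_density x *\<^sub>R indicator {..u - \<sigma>} x)"
      by (simp add: mult.commute)
    also have "\<dots> = (LINT x|std_normal_distribution. indicator {..u - \<sigma>} x)"
      by (rule integral_density[symmetric]) auto
    finally show ?thesis by (simp add: cdf_def)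
  qed
  ultimately show ?thesis by simp
qed

section \<open>The Neyman--Pearson bound\<close>

text \<open>One-sided domination tensorises: the new coordinate is replaced with the others held
  fixed, then the induction hypothesis is applied to the inner integral under N. Hence h must be
  arbitrary in the induction. An inequality is all one has, since F may be the density of only a
  part of N.\<close>

lemma nn_integral_PiM_prod_le:
  fixes F :: "'a \<Rightarrow> ennreal" and I :: "'i set"
  assumes "prob_space M" "prob_space N" and sets: "sets N = sets M"
    and F [measurable]: "F \<in> borel_measurable M"
    and le: "\<And>h. h \<in> borel_measurable M \<Longrightarrow> (\<integral>\<^sup>+x. h x * F x \<partial>M) \<le> (\<integral>\<^sup>+x. h x \<partial>N)"
    and "finite I" and h: "h \<in> borel_measurable (Pi\<^sub>M I (\<lambda>_. M))"
  shows "(\<integral>\<^sup>+\<omega>. h \<omega> * (\<Prod>i\<in>I. F (\<omega> i)) \<partial>Pi\<^sub>M I (\<lambda>_. M)) \<le> (\<integral>\<^sup>+\<omega>. h \<omega> \<partial>Pi\<^sub>M I (\<lambda>_. N))"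
  using \<open>finite I\<close> h
proof (induction I arbitrary: h rule: finite_induct)
  case empty
  then show ?case by (simp add: PiM_empty nn_integral_count_space_finite)
next
  case (insert i I)
  interpret M: prob_space M by fact
  interpret N: prob_space N by fact
  interpret prM: product_sigma_finite "\<lambda>_::'i. M" by standard
  interpret prN: product_sigma_finite "\<lambda>_::'i. N" by standard
  note [measurable_cong] = sets
  note hm [measurable] = insert.prems
  have hN: "h \<in> borel_measurable (Pi\<^sub>M (insert i I) (\<lambda>_. N))"
    using hm measurable_cong_sets[OF sets_PiM_cong[OF refl sets] refl] by blast
  have upd [measurable]: "(\<lambda>(\<omega>, y). h (fun_upd \<omega> i y)) \<in> borel_measurable (Pi\<^sub>M I (\<lambda>_. M) \<Otimes>\<^sub>M M)"
    by measurable
  have upd': "(\<lambda>(\<omega>, y). h (fun_upd \<omega> i y)) \<in> borel_measurable (Pi\<^sub>M I (\<lambda>_. M) \<Otimes>\<^sub>M N)"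
    using upd measurable_cong_sets[OF sets_pair_measure_cong[OF refl sets] refl] by blast
  have h': "(\<lambda>\<omega>. \<integral>\<^sup>+y. h (fun_upd \<omega> i y) \<partial>N) \<in> borel_measurable (Pi\<^sub>M I (\<lambda>_. M))"
    using N.borel_measurable_nn_integral[OF upd'] .
  have "(\<integral>\<^sup>+\<omega>. h \<omega> * (\<Prod>i\<in>insert i I. F (\<omega> i)) \<partial>Pi\<^sub>M (insert i I) (\<lambda>_. M))
      = (\<integral>\<^sup>+\<omega>. \<integral>\<^sup>+y. h (fun_upd \<omega> i y) * (\<Prod>j\<in>insert i I. F (fun_upd \<omega> i y j)) \<partial>M \<partial>Pi\<^sub>M I (\<lambda>_. M))"
    by (rule prM.product_nn_integral_insert[OF insert.hyps]) measurable
  also have "\<dots> = (\<integral>\<^sup>+\<omega>. (\<integral>\<^sup>+y. h (fun_upd \<omega> i y) * F y \<partial>M) * (\<Prod>j\<in>I. F (\<omega> j)) \<partial>Pi\<^sub>M I (\<lambda>_. M))"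
  proof (rule nn_integral_cong)
    fix \<omega> assume \<omega>: "\<omega> \<in> space (Pi\<^sub>M I (\<lambda>_. M))"
    have "(\<Prod>j\<in>insert i I. F (fun_upd \<omega> i y j)) = F y * (\<Prod>j\<in>I. F (\<omega> j))" for y
    proof -
      have "(\<Prod>j\<in>I. F (fun_upd \<omega> i y j)) = (\<Prod>j\<in>I. F (\<omega> j))"
        using insert.hyps by (intro prod.cong) auto
      then show ?thesis using insert.hyps by simp
    qed
    then have "(\<integral>\<^sup>+y. h (fun_upd \<omega> i y) * (\<Prod>j\<in>insert i I. F (fun_upd \<omega> i y j)) \<partial>M)
        = (\<integral>\<^sup>+y. (h (fun_upd \<omega> i y) * F y) * (\<Prod>j\<in>I. F (\<omega> j)) \<partial>M)"
      by (simp add: mult.assoc)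
    also have "\<dots> = (\<integral>\<^sup>+y. h (fun_upd \<omega> i y) * F y \<partial>M) * (\<Prod>j\<in>I. F (\<omega> j))"
      by (rule nn_integral_multc) (use measurable_compose[OF measurable_Pair1'[OF \<omega>] upd] in simp)
    finally show "(\<integral>\<^sup>+y. h (fun_upd \<omega> i y) * (\<Prod>j\<in>insert i I. F (fun_upd \<omega> i y j)) \<partial>M)
        = (\<integral>\<^sup>+y. h (fun_upd \<omega> i y) * F y \<partial>M) * (\<Prod>j\<in>I. F (\<omega> j))" .
  qed
  also have "\<dots> \<le> (\<integral>\<^sup>+\<omega>. (\<integral>\<^sup>+y. h (fun_upd \<omega> i y) \<partial>N) * (\<Prod>j\<in>I. F (\<omega> j)) \<partial>Pi\<^sub>M I (\<lambda>_. M))"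
    by (intro nn_integral_mono mult_right_mono le)
       (use measurable_compose[OF measurable_Pair1' upd] in auto)
  also have "\<dots> \<le> (\<integral>\<^sup>+\<omega>. (\<integral>\<^sup>+y. h (fun_upd \<omega> i y) \<partial>N) \<partial>Pi\<^sub>M I (\<lambda>_. N))"
    by (rule insert.IH[OF h'])
  also have "\<dots> = (\<integral>\<^sup>+\<omega>. h \<omega> \<partial>Pi\<^sub>M (insert i I) (\<lambda>_. N))"
    by (rule prN.product_nn_integral_insert[OF insert.hyps hN, symmetric])
  finally show ?case .
qed

lemma nn_integral_pair_mult_le:
  fixes F :: "'a \<Rightarrow> ennreal" and H :: "'b \<Rightarrow> ennreal"
  assumes "prob_space M1" "prob_space M2" "prob_space N1" "prob_space N2"
    and sets: "sets N1 = sets M1" "sets N2 = sets M2"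
    and F [measurable]: "F \<in> borel_measurable M1" and H [measurable]: "H \<in> borel_measurable M2"
    and le1: "\<And>h. h \<in> borel_measurable M1 \<Longrightarrow> (\<integral>\<^sup>+x. h x * F x \<partial>M1) \<le> (\<integral>\<^sup>+x. h x \<partial>N1)"
    and le2: "\<And>h. h \<in> borel_measurable M2 \<Longrightarrow> (\<integral>\<^sup>+x. h x * H x \<partial>M2) \<le> (\<integral>\<^sup>+x. h x \<partial>N2)"
    and h [measurable]: "h \<in> borel_measurable (M1 \<Otimes>\<^sub>M M2)"
  shows "(\<integral>\<^sup>+\<omega>. h \<omega> * (F (fst \<omega>) * H (snd \<omega>)) \<partial>(M1 \<Otimes>\<^sub>M M2)) \<le> (\<integral>\<^sup>+\<omega>. h \<omega> \<partial>(N1 \<Otimes>\<^sub>M N2))"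
proof -
  interpret M1: prob_space M1 by fact
  interpret M2: prob_space M2 by fact
  interpret N1: prob_space N1 by fact
  interpret N2: prob_space N2 by fact
  have hN: "h \<in> borel_measurable (M1 \<Otimes>\<^sub>M N2)"
    using h measurable_cong_sets[OF sets_pair_measure_cong[OF refl sets(2)] refl] by blast
  have hNN: "h \<in> borel_measurable (N1 \<Otimes>\<^sub>M N2)"
    using h measurable_cong_sets[OF sets_pair_measure_cong[OF sets] refl] by blast
  have "(\<integral>\<^sup>+\<omega>. h \<omega> * (F (fst \<omega>) * H (snd \<omega>)) \<partial>(M1 \<Otimes>\<^sub>M M2))
      = (\<integral>\<^sup>+x. \<integral>\<^sup>+y. h (x, y) * (F x * H y) \<partial>M2 \<partial>M1)"
    by (subst M2.nn_integral_fst[symmetric]) auto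
  also have "\<dots> = (\<integral>\<^sup>+x. (\<integral>\<^sup>+y. h (x, y) * H y \<partial>M2) * F x \<partial>M1)"
    by (intro nn_integral_cong) (subst nn_integral_multc[symmetric], measurable, simp add: ac_simps)
  also have "\<dots> \<le> (\<integral>\<^sup>+x. (\<integral>\<^sup>+y. h (x, y) \<partial>N2) * F x \<partial>M1)"
    by (intro nn_integral_mono mult_right_mono le2) auto
  also have "\<dots> \<le> (\<integral>\<^sup>+x. \<integral>\<^sup>+y. h (x, y) \<partial>N2 \<partial>N1)"
    by (intro le1 N2.borel_measurable_nn_integral_fst hN)
  also have "\<dots> = (\<integral>\<^sup>+\<omega>. h \<omega> \<partial>(N1 \<Otimes>\<^sub>M N2))"
    by (rule N2.nn_integral_fst[OF hNN])
  finally show ?thesis .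
qed

text \<open>Neyman-Pearson without an optimal test: (1 - \<phi>) min \<Lambda> \<kappa> is at most
  (1 - \<phi>) \<Lambda> and at least min \<Lambda> \<kappa> - \<kappa> \<phi>. The right side
  contains only expectations under M, and the truncation at \<kappa> turns the likelihood ratio into
  a bounded quantity to which weak convergence applies.\<close>

lemma integral_test_le:
  fixes \<Lambda> :: "'a \<Rightarrow> real"
  assumes M: "prob_space M" and N: "prob_space N" and sets: "sets N = sets M"
    and \<Lambda> [measurable]: "\<Lambda> \<in> borel_measurable M" and \<Lambda>_nn: "\<And>x. 0 \<le> \<Lambda> x"
    and le: "\<And>h. h \<in> borel_measurable M \<Longrightarrow> (\<integral>\<^sup>+x. h x * ennreal (\<Lambda> x) \<partial>M) \<le> (\<integral>\<^sup>+x. h x \<partial>N)"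
    and \<phi>: "is_test M \<phi>" and \<kappa>: "0 \<le> \<kappa>"
  shows "(LINT x|N. \<phi> x) \<le> 1 - (LINT x|M. min (\<Lambda> x) \<kappa>) + \<kappa> * (LINT x|M. \<phi> x)"
proof -
  interpret M: prob_space M by fact
  interpret N: prob_space N by fact
  have [measurable]: "\<phi> \<in> borel_measurable M" and bd: "\<And>x. x \<in> space M \<Longrightarrow> 0 \<le> \<phi> x \<and> \<phi> x \<le> 1"
    using \<phi> by (auto simp: is_test_def)
  have spN: "space N = space M" using sets by (rule sets_eq_imp_space_eq)
  have \<phi>N [measurable]: "\<phi> \<in> borel_measurable N"
    using \<open>\<phi> \<in> borel_measurable M\<close> measurable_cong_sets[OF sets refl] by blast
  have intM: "integrable M \<phi>" by (rule M.integrable_const_bound[where B=1]) (use bd in auto)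
  have intN: "integrable N \<phi>" by (rule N.integrable_const_bound[where B=1]) (use bd spN in auto)
  have minb: "0 \<le> min (\<Lambda> x) \<kappa> \<and> min (\<Lambda> x) \<kappa> \<le> \<kappa>" for x using \<Lambda>_nn[of x] \<kappa> by simp
  have int_min: "integrable M (\<lambda>x. min (\<Lambda> x) \<kappa>)"
    by (rule M.integrable_const_bound[where B=\<kappa>]) (use minb in auto)
  have int1: "integrable M (\<lambda>x. (1 - \<phi> x) * min (\<Lambda> x) \<kappa>)"
  proof (rule M.integrable_const_bound[where B="1 * \<kappa>"])
    show "AE x in M. norm ((1 - \<phi> x) * min (\<Lambda> x) \<kappa>) \<le> 1 * \<kappa>"
    proof (rule AE_I2)
      fix x assume "x \<in> space M"
      then have "\<bar>1 - \<phi> x\<bar> \<le> 1" "\<bar>min (\<Lambda> x) \<kappa>\<bar> \<le> \<kappa>" using bd[of x] minb[of x] by auto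
      then show "norm ((1 - \<phi> x) * min (\<Lambda> x) \<kappa>) \<le> 1 * \<kappa>"
        unfolding real_norm_def abs_mult by (intro mult_mono) auto
    qed
  qed measurable
  have "ennreal (LINT x|M. (1 - \<phi> x) * min (\<Lambda> x) \<kappa>) = (\<integral>\<^sup>+x. ennreal ((1 - \<phi> x) * min (\<Lambda> x) \<kappa>) \<partial>M)"
    by (rule nn_integral_eq_integral[OF int1, symmetric]) (use bd minb in \<open>auto intro!: AE_I2 mult_nonneg_nonneg\<close>)
  also have "\<dots> \<le> (\<integral>\<^sup>+x. ennreal (1 - \<phi> x) * ennreal (\<Lambda> x) \<partial>M)"
    using bd \<Lambda>_nn by (intro nn_integral_mono) (auto simp: ennreal_mult[symmetric] intro!: ennreal_leI mult_left_mono)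
  also have "\<dots> \<le> (\<integral>\<^sup>+x. ennreal (1 - \<phi> x) \<partial>N)"
    by (rule le) measurable
  also have "\<dots> = ennreal (LINT x|N. 1 - \<phi> x)"
    by (rule nn_integral_eq_integral) (use intN bd spN in auto)
  finally have "(LINT x|M. (1 - \<phi> x) * min (\<Lambda> x) \<kappa>) \<le> (LINT x|N. 1 - \<phi> x)"
    by (subst (asm) ennreal_le_iff) (use bd spN in \<open>auto intro!: integral_nonneg_AE AE_I2\<close>)
  moreover have "(LINT x|M. min (\<Lambda> x) \<kappa>) - \<kappa> * (LINT x|M. \<phi> x) \<le> (LINT x|M. (1 - \<phi> x) * min (\<Lambda> x) \<kappa>)"
  proof -
    have "(LINT x|M. min (\<Lambda> x) \<kappa> - \<kappa> * \<phi> x) \<le> (LINT x|M. (1 - \<phi> x) * min (\<Lambda> x) \<kappa>)"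
    proof (rule integral_mono)
      fix x assume "x \<in> space M"
      then have "\<phi> x * min (\<Lambda> x) \<kappa> \<le> \<phi> x * \<kappa>" using bd minb by (intro mult_left_mono) auto
      then show "min (\<Lambda> x) \<kappa> - \<kappa> * \<phi> x \<le> (1 - \<phi> x) * min (\<Lambda> x) \<kappa>"
        unfolding left_diff_distrib mult_1 by (subst mult.commute[of \<kappa>]) linarith
    qed (use int_min intM int1 in auto)
    then show ?thesis using int_min intM by simp
  qed
  ultimately show ?thesis using intN by (simp add: N.prob_space)
qed

section \<open>Asymptotic power along local sequences\<close>

lemma tendsto_inverse_fraction:
  assumes "(\<lambda>n. real (m n) / real n) \<longlonglongrightarrow> q" "q \<noteq> 0"
  shows "(\<lambda>n. sqrt (real n) * (u * (sqrt (real n) / real (m n)))) \<longlonglongrightarrow> u / q"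
proof -
  have "sqrt (real n) * (u * (sqrt (real n) / real (m n))) = u / (real (m n) / real n)" for n
    by simp
  then show ?thesis
    by (simp only:) (intro tendsto_divide tendsto_const assms)
qed

text \<open>After multiplication by sqrt n the coefficients tend to 1 / (1 - d) and 1 / d, while the
  samples have weights 1 - d and d. The weights cancel in the mean, which is the sum of the two
  inner products, and leave first powers of the inverses in V.\<close>

lemma tendsto_power_two_sample_test:
  assumes P: "local_sequence P0 P f1 G1" and Q: "local_sequence Q0 Q f2 G2"
    and k1: "k1 \<in> L2_centered P0" and k2: "k2 \<in> L2_centered Q0"
    and sizes: "\<And>n. n1 n + n2 n = n" and d: "(\<lambda>n. real (n2 n) / real n) \<longlonglongrightarrow> d" "0 < d" "d < 1"
    and V: "V = 1 / (1 - d) * (LINT x|P0. (k1 x)^2) + 1 / d * (LINT y|Q0. (k2 y)^2)" "V > 0"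
    and T: "\<And>n \<omega>. T n \<omega> = sqrt (real n) / real (n1 n) * (\<Sum>i<n1 n. k1 (fst \<omega> i))
        + sqrt (real n) / real (n2 n) * (\<Sum>j<n2 n. k2 (snd \<omega> j))"
  shows "(\<lambda>n. LINT \<omega>|two_sample (n1 n) (n2 n) (P n) (Q n). (if T n \<omega> > u * sqrt V then 1 else 0 :: real))
    \<longlonglongrightarrow> 1 - \<Phi> (u - ((LINT x|P0. k1 x * G1 x) + (LINT y|Q0. k2 y * G2 y)) / sqrt V)"
proof -
  interpret P: local_sequence P0 P f1 G1 by fact
  interpret Q: local_sequence Q0 Q f2 G2 by fact
  let ?N = "\<lambda>n. two_sample (n1 n) (n2 n) (P n) (Q n)"
  let ?\<mu>1 = "LINT x|P0. k1 x * G1 x" and ?\<mu>2 = "LINT y|Q0. k2 y * G2 y"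
  let ?S1 = "LINT x|P0. (k1 x)^2" and ?S2 = "LINT y|Q0. (k2 y)^2"
  define X where "X n \<omega> = (T n \<omega> - (?\<mu>1 + ?\<mu>2)) / sqrt V" for n and \<omega> :: "(nat \<Rightarrow> 'a) \<times> (nat \<Rightarrow> 'b)"
  have kL2: "k1 \<in> L2 P0" "k2 \<in> L2 Q0" and k0: "(LINT x|P0. k1 x) = 0" "(LINT y|Q0. k2 y) = 0"
    using k1 k2 by (auto simp: L2_centered_def)
  have km: "k1 \<in> borel_measurable (P n)" "k2 \<in> borel_measurable (Q n)" for n
    using L2_measurable[OF kL2(1)] L2_measurable[OF kL2(2)]
      measurable_cong_sets[OF P.R_sets refl] measurable_cong_sets[OF Q.R_sets refl] by blast+
  have sT: "T n \<omega> = (\<Sum>i<n1 n. sqrt (real n) / real (n1 n) * k1 (fst \<omega> i))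
      + (\<Sum>j<n2 n. sqrt (real n) / real (n2 n) * k2 (snd \<omega> j))" for n \<omega>
    unfolding T sum_distrib_left ..
  have Tm: "T n \<in> borel_measurable (?N n)" for n
    unfolding sT[abs_def]
    by (intro borel_measurable_add borel_measurable_sum borel_measurable_times borel_measurable_const
        measurable_two_sample_fst measurable_two_sample_snd km) auto
  have Xm [measurable]: "X n \<in> borel_measurable (?N n)" for n
    unfolding X_def[abs_def] using Tm[of n] by measurable
  have lim1: "(\<lambda>n. of_nat n * ((LINT x|P n. iexp (u * (sqrt (real n) / real (n1 n) * k1 x))) - 1))
      \<longlonglongrightarrow> complex_of_real (- ((u / (1 - d))^2 / 2 * ?S1)) + \<i> * complex_of_real (u / (1 - d) * ?\<mu>1)" for u
    using P.tendsto_char_statistic[OF kL2(1) k0(1) tendsto_inverse_fraction[OF tendsto_first_fraction[OF sizes d(1)]], of u] d(3)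
    by (simp add: mult.assoc)
  have lim2: "(\<lambda>n. of_nat n * ((LINT y|Q n. iexp (u * (sqrt (real n) / real (n2 n) * k2 y))) - 1))
      \<longlonglongrightarrow> complex_of_real (- ((u / d)^2 / 2 * ?S2)) + \<i> * complex_of_real (u / d * ?\<mu>2)" for u
    using Q.tendsto_char_statistic[OF kL2(2) k0(2) tendsto_inverse_fraction[OF d(1)], of u] d(2)
    by (simp add: mult.assoc)
  have "weak_conv_m (\<lambda>n. distr (?N n) borel (\<lambda>\<omega>. ((\<Sum>i<n1 n. sqrt (real n) / real (n1 n) * k1 (fst \<omega> i))
      + (\<Sum>j<n2 n. sqrt (real n) / real (n2 n) * k2 (snd \<omega> j)) - (?\<mu>1 + ?\<mu>2)) / sqrt V)) std_normal_distribution"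
  proof (rule weak_conv_two_sample_statistic[OF P.R_prob Q.R_prob _ _ sizes d(1) lim1 lim2])
    fix u
    have "(1 - d) * - ((u / (1 - d))^2 / 2 * ?S1) + d * - ((u / d)^2 / 2 * ?S2) = - ((sqrt V)^2 * u^2 / 2)"
    proof -
      define e where "e = 1 - d"
      have "e \<noteq> 0" "d \<noteq> 0" using d by (auto simp: e_def)
      then have "e * - ((u / e)^2 / 2 * ?S1) + d * - ((u / d)^2 / 2 * ?S2) = - ((1 / e * ?S1 + 1 / d * ?S2) * u^2 / 2)"
        by (simp add: power_divide power2_eq_square) (simp add: field_simps)
      then show ?thesis using V by (simp add: e_def)
    qed
    moreover have "(1 - d) * (u / (1 - d) * ?\<mu>1) + d * (u / d * ?\<mu>2) = (?\<mu>1 + ?\<mu>2) * u"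
    proof -
      have "e * (u / e * m) = m * u" if "e \<noteq> 0" for e m using that by simp
      from this[of "1 - d"] this[of d] show ?thesis using d by (simp only: distrib_right)
    qed
    moreover have "complex_of_real a * (complex_of_real x + \<i> * complex_of_real y)
        + complex_of_real b * (complex_of_real x' + \<i> * complex_of_real y')
        = complex_of_real (a * x + b * x') + \<i> * complex_of_real (a * y + b * y')" for a b x y x' y'
      by (simp add: algebra_simps)
    ultimately show "complex_of_real (1 - d) *
          (complex_of_real (- ((u / (1 - d))^2 / 2 * ?S1)) + \<i> * complex_of_real (u / (1 - d) * ?\<mu>1))
        + complex_of_real d * (complex_of_real (- ((u / d)^2 / 2 * ?S2)) + \<i> * complex_of_real (u / d * ?\<mu>2))
        = complex_of_real (- ((sqrt V)^2 * u^2 / 2)) + \<i> * complex_of_real ((?\<mu>1 + ?\<mu>2) * u)"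
      by (simp only:)
  qed (use V km in auto)
  then have conv: "weak_conv_m (\<lambda>n. distr (?N n) borel (X n)) std_normal_distribution"
    unfolding X_def[abs_def] sT .
  let ?x = "u - (?\<mu>1 + ?\<mu>2) / sqrt V"
  have "(\<lambda>n. cdf (distr (?N n) borel (X n)) ?x) \<longlonglongrightarrow> \<Phi> ?x"
    using conv isCont_cdf_std_normal by (auto simp: weak_conv_m_def weak_conv_def)
  moreover have "(LINT \<omega>|?N n. (if T n \<omega> > u * sqrt V then 1 else 0 :: real)) = 1 - cdf (distr (?N n) borel (X n)) ?x" for n
  proof -
    interpret N: prob_space "?N n" by (rule prob_space_two_sample[OF P.R_prob Q.R_prob])
    have iff: "X n \<omega> \<le> ?x \<longleftrightarrow> T n \<omega> \<le> u * sqrt V" for \<omega>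
      using V(2) by (simp add: X_def field_simps)
    have "cdf (distr (?N n) borel (X n)) ?x = N.prob {\<omega> \<in> space (?N n). X n \<omega> \<le> ?x}"
      unfolding cdf_def by (subst measure_distr) (auto intro!: arg_cong[where f=N.prob])
    also have "1 - \<dots> = N.prob {\<omega> \<in> space (?N n). \<not> X n \<omega> \<le> ?x}"
      by (rule N.prob_neg[symmetric]) measurable
    also have "\<dots> = (LINT \<omega>|?N n. indicator {\<omega> \<in> space (?N n). \<not> X n \<omega> \<le> ?x} \<omega>)"
      by simp
    also have "\<dots> = (LINT \<omega>|?N n. (if T n \<omega> > u * sqrt V then 1 else 0 :: real))"
      by (rule Bochner_Integration.integral_cong) (auto simp: iff indicator_def)
    finally show ?thesis ..
  qed
  ultimately show ?thesis by (simp add: tendsto_diff)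
qed

lemma integral_two_sample_fst:
  fixes h :: "'a \<Rightarrow> real"
  assumes P: "prob_space P" and Q: "prob_space Q" and h: "h \<in> borel_measurable P" and i: "i < m1"
  shows "(LINT \<omega>|two_sample m1 m2 P Q. h (fst \<omega> i)) = (LINT x|P. h x)"
proof -
  let ?P = "Pi\<^sub>M {..<m1} (\<lambda>_. P)" and ?Q = "Pi\<^sub>M {..<m2} (\<lambda>_. Q)"
  have PP: "prob_space ?P" and QQ: "prob_space ?Q" using P Q by (auto intro: prob_space_PiM)
  have hi: "(\<lambda>\<omega>. h (\<omega> i)) \<in> borel_measurable ?P"
    by (rule measurable_compose[OF _ h]) (use i in simp)
  have "(LINT x|P. h x) = (LINT x|distr ?P P (\<lambda>\<omega>. \<omega> i). h x)"
    using P Q i by (subst distr_PiM_component) auto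
  also have "\<dots> = (LINT \<omega>|?P. h (\<omega> i))"
    using i h by (subst integral_distr) auto
  also have "\<dots> = (LINT \<omega>|distr (?P \<Otimes>\<^sub>M ?Q) ?P fst. h (\<omega> i))"
    unfolding prob_space.distr_pair_fst[OF QQ] ..
  also have "\<dots> = (LINT \<omega>|two_sample m1 m2 P Q. h (fst \<omega> i))"
    unfolding two_sample_def by (rule integral_distr[OF measurable_fst hi])
  finally show ?thesis ..
qed

lemma integral_two_sample_snd:
  fixes h :: "'b \<Rightarrow> real"
  assumes P: "prob_space P" and Q: "prob_space Q" and h: "h \<in> borel_measurable Q" and j: "j < m2"
  shows "(LINT \<omega>|two_sample m1 m2 P Q. h (snd \<omega> j)) = (LINT x|Q. h x)"
proof -
  let ?P = "Pi\<^sub>M {..<m1} (\<lambda>_. P)" and ?Q = "Pi\<^sub>M {..<m2} (\<lambda>_. Q)"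
  have PP: "prob_space ?P" and QQ: "prob_space ?Q" using P Q by (auto intro: prob_space_PiM)
  have hi: "(\<lambda>\<omega>. h (\<omega> j)) \<in> borel_measurable ?Q"
    by (rule measurable_compose[OF _ h]) (use j in simp)
  have "(LINT x|Q. h x) = (LINT x|distr ?Q Q (\<lambda>\<omega>. \<omega> j). h x)"
    using P Q j by (subst distr_PiM_component) auto
  also have "\<dots> = (LINT \<omega>|?Q. h (\<omega> j))"
    using j h by (subst integral_distr) auto
  also have "\<dots> = (LINT \<omega>|distr (?P \<Otimes>\<^sub>M ?Q) ?Q snd. h (\<omega> j))"
    unfolding distr_pair_snd[OF PP QQ] ..
  also have "\<dots> = (LINT \<omega>|two_sample m1 m2 P Q. h (snd \<omega> j))"
    unfolding two_sample_def by (rule integral_distr[OF measurable_snd hi])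
  finally show ?thesis ..
qed

text \<open>The test inequality is passed to the limit: the truncated likelihood ratio converges by
  the central limit theorem under the hypothesis, and the level of \<phi> tends to \<alpha> by
  similarity.\<close>

lemma limsup_power_le:
  assumes P: "local_sequence P0 P f1 G1" and Q: "local_sequence Q0 Q f2 G2"
    and sizes: "\<And>n. n1 n + n2 n = n" and d: "(\<lambda>n. real (n2 n) / real n) \<longlonglongrightarrow> d"
    and \<sigma>: "\<sigma>^2 = (1 - d) * (LINT x|P0. (G1 x)^2) + d * (LINT y|Q0. (G2 y)^2)" "\<sigma> > 0"
    and \<phi>: "\<phi> \<in> similar_tests n1 n2 P0 Q0 \<alpha>" and u: "\<Phi> u = 1 - \<alpha>"
  shows "limsup (\<lambda>n. ereal (LINT \<omega>|two_sample (n1 n) (n2 n) (P n) (Q n). \<phi> n \<omega>))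
    \<le> ereal (1 - \<Phi> (u - \<sigma>))"
proof -
  interpret P: local_sequence P0 P f1 G1 by fact
  interpret Q: local_sequence Q0 Q f2 G2 by fact
  interpret std: real_distribution std_normal_distribution by (rule real_dist_normal_dist)
  let ?N = "\<lambda>n. two_sample (n1 n) (n2 n) P0 Q0"
  let ?A = "\<lambda>n. two_sample (n1 n) (n2 n) (P n) (Q n)"
  let ?I1 = "LINT x|P0. (G1 x)^2" and ?I2 = "LINT y|Q0. (G2 y)^2"
  \<comment> \<open>The Neyman-Pearson threshold of the limit experiment N(0, 1) against N(\<sigma>,
    1) at level \<alpha>, that is, the likelihood ratio at u.\<close>
  define \<kappa> where "\<kappa> = exp (\<sigma> * u - \<sigma>^2 / 2)"
  have \<kappa>: "0 < \<kappa>" by (simp add: \<kappa>_def)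
  define W where "W n \<omega> = (\<Sum>i<n1 n. 2 * ln (f1 n (fst \<omega> i))) + (\<Sum>j<n2 n. 2 * ln (f2 n (snd \<omega> j)))"
    for n and \<omega> :: "(nat \<Rightarrow> 'a) \<times> (nat \<Rightarrow> 'b)"
  define \<Lambda> where "\<Lambda> n \<omega> = (\<Prod>i<n1 n. (f1 n (fst \<omega> i))^2) * (\<Prod>j<n2 n. (f2 n (snd \<omega> j))^2)"
    for n and \<omega> :: "(nat \<Rightarrow> 'a) \<times> (nat \<Rightarrow> 'b)"
  define p1 where "p1 n = P.prob {x \<in> space P0. f1 n x = 0}" for n
  define p2 where "p2 n = Q.prob {y \<in> space Q0. f2 n y = 0}" for n
  have N: "prob_space (?N n)" and A: "prob_space (?A n)" for n
    by (intro prob_space_two_sample P.prob_space_axioms Q.prob_space_axioms P.R_prob Q.R_prob)+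
  have \<Lambda>_nn: "0 \<le> \<Lambda> n \<omega>" for n \<omega> unfolding \<Lambda>_def by (intro mult_nonneg_nonneg prod_nonneg) auto
  have Wm [measurable]: "W n \<in> borel_measurable (?N n)" for n
    unfolding W_def[abs_def]
    by (intro borel_measurable_add borel_measurable_sum
        measurable_two_sample_fst[of "\<lambda>x. 2 * ln (f1 n x)"] measurable_two_sample_snd[of "\<lambda>x. 2 * ln (f2 n x)"]) auto
  have \<Lambda>m [measurable]: "\<Lambda> n \<in> borel_measurable (?N n)" for n
    unfolding \<Lambda>_def[abs_def]
    by (intro borel_measurable_times borel_measurable_prod
        measurable_two_sample_fst[of "\<lambda>x. (f1 n x)^2"] measurable_two_sample_snd[of "\<lambda>x. (f2 n x)^2"]) auto

  have le: "(\<integral>\<^sup>+\<omega>. h \<omega> * ennreal (\<Lambda> n \<omega>) \<partial>?N n) \<le> (\<integral>\<^sup>+\<omega>. h \<omega> \<partial>?A n)"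
    if h: "h \<in> borel_measurable (?N n)" for n h
  proof -
    have "ennreal (\<Lambda> n \<omega>) = (\<Prod>i<n1 n. ennreal ((f1 n (fst \<omega> i))^2)) * (\<Prod>j<n2 n. ennreal ((f2 n (snd \<omega> j))^2))" for \<omega>
      by (simp add: \<Lambda>_def ennreal_mult prod_nonneg prod_ennreal)
    then show ?thesis
      unfolding two_sample_def
      by (simp only:)
         (intro nn_integral_pair_mult_le[where F="\<lambda>x. \<Prod>i<n1 n. ennreal ((f1 n (x i))^2)"
             and H="\<lambda>y. \<Prod>j<n2 n. ennreal ((f2 n (y j))^2)"]
           nn_integral_PiM_prod_le[where F="\<lambda>x. ennreal ((f1 n x)^2)"]
           nn_integral_PiM_prod_le[where F="\<lambda>x. ennreal ((f2 n x)^2)"]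
           prob_space_PiM P.prob_space_axioms Q.prob_space_axioms P.R_prob Q.R_prob
           sets_PiM_cong P.R_sets Q.R_sets P.f_le Q.f_le h[unfolded two_sample_def] refl finite_lessThan; measurable)
  qed
  have bound: "(LINT \<omega>|?A n. \<phi> n \<omega>) \<le> 1 - (LINT \<omega>|?N n. min (\<Lambda> n \<omega>) \<kappa>) + \<kappa> * (LINT \<omega>|?N n. \<phi> n \<omega>)" for n
    using \<phi> \<kappa> by (intro integral_test_le[OF N A] le \<Lambda>_nn \<Lambda>m sets_two_sample_cong P.R_sets Q.R_sets)
      (auto simp: similar_tests_def)

  \<comment> \<open>exp W agrees with \<Lambda> only if no factor vanishes. Otherwise the difference
    of the truncated values is at most \<kappa>, hence at most \<kappa> times the number
    \<open>?E\<close> of vanishing factors; its expectation is computed exactly.\<close>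
  have zero: "(LINT \<omega>|?N n. min (exp (W n \<omega>)) \<kappa>) - \<kappa> * (real (n1 n) * p1 n + real (n2 n) * p2 n)
      \<le> (LINT \<omega>|?N n. min (\<Lambda> n \<omega>) \<kappa>)" for n
  proof -
    interpret N: prob_space "?N n" by (rule N)
    define e1 where "e1 x = (indicator {x \<in> space P0. f1 n x = 0} x :: real)" for x
    define e2 where "e2 y = (indicator {y \<in> space Q0. f2 n y = 0} y :: real)" for y
    have e1m: "e1 \<in> borel_measurable P0" and e2m: "e2 \<in> borel_measurable Q0"
      unfolding e1_def[abs_def] e2_def[abs_def] by measurable
    have e_bd: "\<bar>e1 x\<bar> \<le> 1" "\<bar>e2 y\<bar> \<le> 1" for x y by (auto simp: e1_def e2_def indicator_def)
    let ?E = "\<lambda>\<omega>. (\<Sum>i<n1 n. e1 (fst \<omega> i)) + (\<Sum>j<n2 n. e2 (snd \<omega> j))"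
    have i1: "integrable (?N n) (\<lambda>\<omega>. e1 (fst \<omega> i))" if "i < n1 n" for i
      by (rule N.integrable_const_bound[where B=1]) (use measurable_two_sample_fst[OF e1m that] e_bd in auto)
    have i2: "integrable (?N n) (\<lambda>\<omega>. e2 (snd \<omega> j))" if "j < n2 n" for j
      by (rule N.integrable_const_bound[where B=1]) (use measurable_two_sample_snd[OF e2m that] e_bd in auto)
    have s1: "integrable (?N n) (\<lambda>\<omega>. \<Sum>i<n1 n. e1 (fst \<omega> i))" and s2: "integrable (?N n) (\<lambda>\<omega>. \<Sum>j<n2 n. e2 (snd \<omega> j))"
      using i1 i2 by (auto intro!: Bochner_Integration.integrable_sum)
    have "(LINT \<omega>|?N n. ?E \<omega>) = (\<Sum>i<n1 n. LINT \<omega>|?N n. e1 (fst \<omega> i)) + (\<Sum>j<n2 n. LINT \<omega>|?N n. e2 (snd \<omega> j))"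
      using s1 s2 i1 i2 by (simp add: Bochner_Integration.integral_sum)
    also have "\<dots> = (\<Sum>i<n1 n. LINT x|P0. e1 x) + (\<Sum>j<n2 n. LINT y|Q0. e2 y)"
      by (intro arg_cong2[where f="(+)"] sum.cong integral_two_sample_fst integral_two_sample_snd
          P.prob_space_axioms Q.prob_space_axioms e1m e2m) auto
    also have "\<dots> = real (n1 n) * p1 n + real (n2 n) * p2 n"
      by (simp add: e1_def e2_def p1_def p2_def)
    finally have E: "(LINT \<omega>|?N n. ?E \<omega>) = real (n1 n) * p1 n + real (n2 n) * p2 n" .
    have int: "integrable (?N n) (\<lambda>\<omega>. min (exp (W n \<omega>)) \<kappa>)" "integrable (?N n) (\<lambda>\<omega>. min (\<Lambda> n \<omega>) \<kappa>)"
      using \<kappa> \<Lambda>_nn by (auto intro!: N.integrable_const_bound[where B=\<kappa>])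
    have "(LINT \<omega>|?N n. min (exp (W n \<omega>)) \<kappa>) \<le> (LINT \<omega>|?N n. min (\<Lambda> n \<omega>) \<kappa> + \<kappa> * ?E \<omega>)"
    proof (rule integral_mono)
      fix \<omega> assume \<omega>: "\<omega> \<in> space (?N n)"
      have E_nn: "0 \<le> ?E \<omega>" by (intro add_nonneg_nonneg sum_nonneg) (auto simp: e1_def e2_def)
      show "min (exp (W n \<omega>)) \<kappa> \<le> min (\<Lambda> n \<omega>) \<kappa> + \<kappa> * ?E \<omega>"
      proof (cases "(\<exists>i<n1 n. f1 n (fst \<omega> i) = 0) \<or> (\<exists>j<n2 n. f2 n (snd \<omega> j) = 0)")
        case True
        have in1: "fst \<omega> i \<in> space P0" if "i < n1 n" for i
          using \<omega> that by (auto simp: two_sample_def space_pair_measure space_PiM)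
        have in2: "snd \<omega> j \<in> space Q0" if "j < n2 n" for j
          using \<omega> that by (auto simp: two_sample_def space_pair_measure space_PiM)
        have "1 \<le> ?E \<omega>"
          using True
        proof
          assume "\<exists>i<n1 n. f1 n (fst \<omega> i) = 0"
          then obtain i where i: "i < n1 n" "e1 (fst \<omega> i) = 1" using in1 by (auto simp: e1_def)
          have "e1 (fst \<omega> i) \<le> (\<Sum>i<n1 n. e1 (fst \<omega> i))"
            by (rule member_le_sum) (auto simp: e1_def i)
          moreover have "0 \<le> (\<Sum>j<n2 n. e2 (snd \<omega> j))" by (rule sum_nonneg) (simp add: e2_def)
          ultimately show ?thesis using i by linarith
        next
          assume "\<exists>j<n2 n. f2 n (snd \<omega> j) = 0"
          then obtain j where j: "j < n2 n" "e2 (snd \<omega> j) = 1" using in2 by (auto simp: e2_def)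
          have "e2 (snd \<omega> j) \<le> (\<Sum>j<n2 n. e2 (snd \<omega> j))"
            by (rule member_le_sum) (auto simp: e2_def j)
          moreover have "0 \<le> (\<Sum>i<n1 n. e1 (fst \<omega> i))" by (rule sum_nonneg) (simp add: e1_def)
          ultimately show ?thesis using j by linarith
        qed
        then have "\<kappa> * 1 \<le> \<kappa> * ?E \<omega>" using \<kappa> by (intro mult_left_mono) auto
        then have "\<kappa> \<le> \<kappa> * ?E \<omega>" by (simp only: mult_1_right)
        moreover have "0 \<le> min (\<Lambda> n \<omega>) \<kappa>" using \<Lambda>_nn[of n \<omega>] \<kappa> by simp
        ultimately have "0 + \<kappa> \<le> min (\<Lambda> n \<omega>) \<kappa> + \<kappa> * ?E \<omega>" by (intro add_mono)
        then show ?thesis by (intro order_trans[OF min.cobounded2]) (simp only: add_0)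
      next
        case False
        then have pos: "\<And>i. i < n1 n \<Longrightarrow> 0 < f1 n (fst \<omega> i)" "\<And>j. j < n2 n \<Longrightarrow> 0 < f2 n (snd \<omega> j)"
          using P.f_nonneg Q.f_nonneg by (auto simp: less_le)
        have "exp (W n \<omega>) = (\<Prod>i<n1 n. exp (2 * ln (f1 n (fst \<omega> i)))) * (\<Prod>j<n2 n. exp (2 * ln (f2 n (snd \<omega> j))))"
          by (simp only: W_def exp_add exp_sum finite_lessThan)
        also have "\<dots> = \<Lambda> n \<omega>"
          unfolding \<Lambda>_def using pos
          by (intro arg_cong2[where f="(*)"] prod.cong) (auto simp: exp_double exp_ln)
        finally have "exp (W n \<omega>) = \<Lambda> n \<omega>" .
        then show ?thesis using E_nn \<kappa> by simp
      qed
    qed (use int s1 s2 in auto)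
    also have "\<dots> = (LINT \<omega>|?N n. min (\<Lambda> n \<omega>) \<kappa>) + \<kappa> * (LINT \<omega>|?N n. ?E \<omega>)"
      using int s1 s2 by (subst Bochner_Integration.integral_add) auto
    finally show ?thesis unfolding E by linarith
  qed

  have z: "complex_of_real (1 - d) * (complex_of_real (- (v^2 / 2 * ?I1)) + \<i> * complex_of_real (- (v / 2 * ?I1)))
      + complex_of_real d * (complex_of_real (- (v^2 / 2 * ?I2)) + \<i> * complex_of_real (- (v / 2 * ?I2)))
      = complex_of_real (- (\<sigma>^2 * v^2 / 2)) + \<i> * complex_of_real (- (\<sigma>^2 / 2) * v)" for v
  proof -
    have "(1 - d) * - (v^2 / 2 * ?I1) + d * - (v^2 / 2 * ?I2) = - (\<sigma>^2 * v^2 / 2)"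
      and "(1 - d) * - (v / 2 * ?I1) + d * - (v / 2 * ?I2) = - (\<sigma>^2 / 2) * v"
      unfolding \<sigma>(1) by (simp_all add: algebra_simps add_divide_distrib diff_divide_distrib)
    moreover have "complex_of_real a * (complex_of_real x + \<i> * complex_of_real y)
        + complex_of_real b * (complex_of_real x' + \<i> * complex_of_real y')
        = complex_of_real (a * x + b * x') + \<i> * complex_of_real (a * y + b * y')" for a b x y x' y'
      by (simp add: algebra_simps)
    ultimately show ?thesis by (simp only:)
  qed
  \<comment> \<open>Since \<sigma> X - \<sigma>^2 / 2 = W, the truncated exponential of W is one
    fixed bounded continuous function of X, the same for every n.\<close>
  define X where "X n \<omega> = (W n \<omega> - - (\<sigma>^2 / 2)) / \<sigma>" for n \<omega>
  have Xm [measurable]: "X n \<in> borel_measurable (?N n)" for n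
    unfolding X_def[abs_def] using Wm[of n] by measurable
  have "weak_conv_m (\<lambda>n. distr (?N n) borel (X n)) std_normal_distribution"
    unfolding X_def[abs_def] W_def
    by (rule weak_conv_two_sample_statistic[OF P.prob_space_axioms Q.prob_space_axioms _ _ sizes d
          P.tendsto_char_log_likelihood Q.tendsto_char_log_likelihood z \<sigma>(2)]) measurable
  then have "(\<lambda>n. LINT x|distr (?N n) borel (X n). min (exp (\<sigma> * x - \<sigma>^2 / 2)) \<kappa>)
      \<longlonglongrightarrow> (LINT x|std_normal_distribution. min (exp (\<sigma> * x - \<sigma>^2 / 2)) \<kappa>)"
    using \<kappa>
    by (intro weak_conv_imp_integral_bdd_continuous_conv[where B=\<kappa>] prob_space.real_distribution_distr N Xm
        real_dist_normal_dist continuous_intros) auto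
  moreover have "(LINT x|distr (?N n) borel (X n). min (exp (\<sigma> * x - \<sigma>^2 / 2)) \<kappa>) = (LINT \<omega>|?N n. min (exp (W n \<omega>)) \<kappa>)" for n
    using \<sigma>(2) by (subst integral_distr) (auto simp: X_def)
  ultimately have lim: "(\<lambda>n. LINT \<omega>|?N n. min (exp (W n \<omega>)) \<kappa>)
      \<longlonglongrightarrow> (LINT x|std_normal_distribution. min (exp (\<sigma> * x - \<sigma>^2 / 2)) \<kappa>)" (is "_ \<longlonglongrightarrow> ?L")
    by simp
  have null: "(\<lambda>n. real (n1 n) * p1 n + real (n2 n) * p2 n) \<longlonglongrightarrow> 0"
  proof (rule tendsto_sandwich[OF _ _ tendsto_const]; (intro always_eventually allI)?)
    show "(\<lambda>n. real n * p1 n + real n * p2 n) \<longlonglongrightarrow> 0"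
      using tendsto_add[OF P.tendsto_prob_f_zero Q.tendsto_prob_f_zero] by (simp add: p1_def p2_def)
    fix n
    have "n1 n \<le> n" "n2 n \<le> n" using sizes[of n] by linarith+
    then show "real (n1 n) * p1 n + real (n2 n) * p2 n \<le> real n * p1 n + real n * p2 n"
      by (intro add_mono mult_right_mono) (auto simp: p1_def p2_def)
    show "0 \<le> real (n1 n) * p1 n + real (n2 n) * p2 n" by (simp add: p1_def p2_def)
  qed
  have "(\<lambda>n. 1 - ((LINT \<omega>|?N n. min (exp (W n \<omega>)) \<kappa>) - \<kappa> * (real (n1 n) * p1 n + real (n2 n) * p2 n))
      + \<kappa> * (LINT \<omega>|?N n. \<phi> n \<omega>)) \<longlonglongrightarrow> 1 - (?L - \<kappa> * 0) + \<kappa> * \<alpha>"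
    using \<phi> by (intro tendsto_intros lim null) (simp add: similar_tests_def)
  then have limB: "limsup (\<lambda>n. ereal (1 - ((LINT \<omega>|?N n. min (exp (W n \<omega>)) \<kappa>) - \<kappa> * (real (n1 n) * p1 n + real (n2 n) * p2 n))
      + \<kappa> * (LINT \<omega>|?N n. \<phi> n \<omega>))) = ereal (1 - (?L - \<kappa> * 0) + \<kappa> * \<alpha>)"
    by (intro lim_imp_Limsup) auto
  have "limsup (\<lambda>n. ereal (LINT \<omega>|?A n. \<phi> n \<omega>))
      \<le> limsup (\<lambda>n. ereal (1 - ((LINT \<omega>|?N n. min (exp (W n \<omega>)) \<kappa>) - \<kappa> * (real (n1 n) * p1 n + real (n2 n) * p2 n))
      + \<kappa> * (LINT \<omega>|?N n. \<phi> n \<omega>)))"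
  proof (rule Limsup_mono, intro always_eventually allI)
    fix n
    show "ereal (LINT \<omega>|?A n. \<phi> n \<omega>) \<le> ereal (1 - ((LINT \<omega>|?N n. min (exp (W n \<omega>)) \<kappa>)
        - \<kappa> * (real (n1 n) * p1 n + real (n2 n) * p2 n)) + \<kappa> * (LINT \<omega>|?N n. \<phi> n \<omega>))"
      using bound[of n] zero[of n] by simp
  qed
  also note limB
  \<comment> \<open>With \<Phi> u = 1 - \<alpha> the lower bound for \<open>?L\<close> contains
    \<kappa> \<alpha>, which cancels the level term.\<close>
  also have "ereal (1 - (?L - \<kappa> * 0) + \<kappa> * \<alpha>) \<le> ereal (1 - \<Phi> (u - \<sigma>))"
    using integral_min_exp_std_normal[OF \<sigma>(2), of u] u by (simp add: \<kappa>_def)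
  finally show ?thesis .
qed

section \<open>Density quotients\<close>

text \<open>An identity between measures can be composed with further densities and products, which
  the setwise equation with its singular summand does not allow directly.\<close>

lemma density_quotient_iff:
  assumes sets: "sets P = sets Q"
  shows "density_quotient P Q L \<longleftrightarrow> L \<in> borel_measurable Q \<and> (AE x in Q. L x < \<infinity>) \<and>
    density P (indicator {x \<in> space Q. L x \<noteq> \<infinity>}) = density Q L"
proof (cases "L \<in> borel_measurable Q \<and> (AE x in Q. L x < \<infinity>)")
  case True
  then have L [measurable]: "L \<in> borel_measurable Q" and fin: "AE x in Q. L x < \<infinity>" by auto
  note [measurable_cong] = sets
  let ?F = "{x \<in> space Q. L x \<noteq> \<infinity>}"
  have sp: "space P = space Q" using sets by (rule sets_eq_imp_space_eq)
  have [measurable]: "?F \<in> sets P" "?F \<in> sets Q" unfolding sets by measurable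
  have dP: "emeasure (density P (indicator ?F)) A = emeasure P (A \<inter> ?F)" if "A \<in> sets Q" for A
  proof -
    have "emeasure (density P (indicator ?F)) A = (\<integral>\<^sup>+x. indicator ?F x * indicator A x \<partial>P)"
      using that by (subst emeasure_density) (auto simp: sets)
    also have "\<dots> = (\<integral>\<^sup>+x. indicator (A \<inter> ?F) x \<partial>P)"
      by (rule nn_integral_cong) (auto simp: indicator_def)
    finally show ?thesis using that by (simp add: sets)
  qed
  have dQ: "emeasure (density Q L) A = (\<integral>\<^sup>+x\<in>A. L x \<partial>Q)" if "A \<in> sets Q" for A
    using that by (subst emeasure_density) auto
  have split: "emeasure P A = emeasure P (A \<inter> ?F) + emeasure P (A \<inter> {x. L x = \<infinity>})" if "A \<in> sets Q" for A
  proof -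
    have "A \<inter> {x. L x = \<infinity>} = A \<inter> {x \<in> space Q. L x = \<infinity>}" using sets.sets_into_space[OF that] by auto
    then have "A \<inter> {x. L x = \<infinity>} \<in> sets P" using that by (simp add: sets)
    moreover have "A = (A \<inter> ?F) \<union> (A \<inter> {x. L x = \<infinity>})" using sets.sets_into_space[OF that] by auto
    ultimately show ?thesis
      using that by (subst plus_emeasure) (auto simp: sets intro!: arg_cong[where f="emeasure P"])
  qed
  have "(\<forall>A\<in>sets Q. emeasure P A = (\<integral>\<^sup>+x\<in>A. L x \<partial>Q) + emeasure P (A \<inter> {x. L x = \<infinity>}))
      \<longleftrightarrow> density P (indicator ?F) = density Q L" (is "?l \<longleftrightarrow> ?r")
  proof
    assume l: ?l
    show ?r
    proof (rule measure_eqI)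
      show "sets (density P (indicator ?F)) = sets (density Q L)" by (simp add: sets)
      fix A assume "A \<in> sets (density P (indicator ?F))"
      then have A [measurable]: "A \<in> sets Q" by (simp add: sets)
      \<comment> \<open>On \<open>A \<inter> ?F\<close> the singular summand is empty, and the set
        where L is infinite is Q-null.\<close>
      have "emeasure P (A \<inter> ?F) = (\<integral>\<^sup>+x\<in>A \<inter> ?F. L x \<partial>Q) + emeasure P ((A \<inter> ?F) \<inter> {x. L x = \<infinity>})"
        using l by (rule bspec) measurable
      also have "(A \<inter> ?F) \<inter> {x. L x = \<infinity>} = {}" by auto
      also have "(\<integral>\<^sup>+x\<in>A \<inter> ?F. L x \<partial>Q) = (\<integral>\<^sup>+x\<in>A. L x \<partial>Q)"
        by (rule nn_integral_cong_AE) (use fin in \<open>auto simp: indicator_def elim!: eventually_mono\<close>)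
      finally show "emeasure (density P (indicator ?F)) A = emeasure (density Q L) A"
        by (simp only: dP[OF A] dQ[OF A] emeasure_empty add_0_right)
    qed
  next
    assume r: ?r
    show ?l
    proof
      fix A assume A: "A \<in> sets Q"
      show "emeasure P A = (\<integral>\<^sup>+x\<in>A. L x \<partial>Q) + emeasure P (A \<inter> {x. L x = \<infinity>})"
        using split[OF A] dP[OF A] dQ[OF A] r by simp
    qed
  qed
  then show ?thesis using True by (simp add: density_quotient_def)
qed (auto simp: density_quotient_def)

text \<open>Restricting further to the other set of full Q-measure changes neither density with
  respect to Q; after that both sides are P restricted to the intersection of A and A'.\<close>

lemma density_unique_up_to_null:
  assumes Q: "prob_space Q" and sets: "sets P = sets Q"
    and [measurable]: "L \<in> borel_measurable Q" "L' \<in> borel_measurable Q" "A \<in> sets Q" "A' \<in> sets Q"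
    and A: "AE x in Q. x \<in> A" and A': "AE x in Q. x \<in> A'"
    and L: "density P (indicator A) = density Q L" and L': "density P (indicator A') = density Q L'"
  shows "AE x in Q. L x = L' x"
proof -
  interpret Q: prob_space Q by fact
  have [measurable]: "A \<in> sets P" "A' \<in> sets P" using sets by auto
  have "density Q L = density (density Q L) (indicator A')"
    unfolding density_density_eq[OF \<open>L \<in> _\<close> borel_measurable_indicator[OF \<open>A' \<in> sets Q\<close>]]
    by (rule density_cong) (use A' in \<open>auto elim!: eventually_mono\<close>)
  also have "\<dots> = density P (\<lambda>x. indicator A x * indicator A' x)"
    unfolding L[symmetric] by (rule density_density_eq) auto
  also have "\<dots> = density P (\<lambda>x. indicator A' x * indicator A x)"
    by (simp add: mult.commute)
  also have "\<dots> = density (density Q L') (indicator A)"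
    unfolding L'[symmetric] by (rule density_density_eq[symmetric]) auto
  also have "\<dots> = density Q L'"
    unfolding density_density_eq[OF \<open>L' \<in> _\<close> borel_measurable_indicator[OF \<open>A \<in> sets Q\<close>]]
    by (rule density_cong) (use A in \<open>auto elim!: eventually_mono\<close>)
  finally show ?thesis by (subst (asm) Q.density_unique_iff) auto
qed

lemma finite_measure_density_indicator:
  assumes P: "prob_space P" and A: "A \<in> sets P"
  shows "finite_measure (density P (indicator A))"
proof (rule finite_measureI)
  have "emeasure (density P (indicator A)) (space P) \<le> (\<integral>\<^sup>+y. 1 \<partial>P)"
    by (subst emeasure_density[OF borel_measurable_indicator[OF A] sets.top])
       (rule nn_integral_mono, simp add: indicator_def)
  then show "emeasure (density P (indicator A)) (space (density P (indicator A))) \<noteq> \<infinity>"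
    using P by (auto simp: prob_space.emeasure_space_1 top_unique)
qed

text \<open>
  Lebesgue decomposition: off a \<open>Q\<close>-null set \<open>N\<close> of maximal \<open>P\<close>-mass, \<open>P\<close> is absolutely continuous.
\<close>

lemma density_quotient_exists:
  assumes P: "prob_space P" and Q: "prob_space Q" and sets: "sets P = sets Q"
  shows "\<exists>L. density_quotient P Q L"
proof -
  interpret P: prob_space P by fact
  interpret Q: prob_space Q by fact
  have sp: "space P = space Q" using sets by (rule sets_eq_imp_space_eq)
  define s where "s = (SUP A\<in>null_sets Q. P.prob A)"
  have bdd: "bdd_above (P.prob ` null_sets Q)" by (auto intro!: bdd_aboveI[of _ 1])
  have "\<exists>A\<in>null_sets Q. s - 1 / Suc n < P.prob A" for n
    using less_cSUP_iff[OF _ bdd, of "s - 1 / Suc n"] by (auto simp: s_def)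
  then obtain A where A: "\<And>n. A n \<in> null_sets Q" "\<And>n. s - 1 / Suc n < P.prob (A n)" by metis
  define N where "N = (\<Union>n. A n)"
  have N: "N \<in> null_sets Q" unfolding N_def using A(1) by auto
  then have Ns [measurable]: "N \<in> sets Q" "N \<in> sets P" using sets by auto
  have s: "P.prob B \<le> s" if "B \<in> null_sets Q" for B
    unfolding s_def using that bdd by (rule cSUP_upper)
  have "s \<le> P.prob N"
  proof (rule LIMSEQ_le_const2)
    show "(\<lambda>n. s - 1 / real (Suc n)) \<longlonglongrightarrow> s"
      using tendsto_diff[OF tendsto_const LIMSEQ_Suc[OF lim_1_over_n], of s] by simp
    show "\<exists>m. \<forall>n\<ge>m. s - 1 / real (Suc n) \<le> P.prob N"
    proof (intro exI allI impI)
      fix n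
      have "P.prob (A n) \<le> P.prob N"
        by (rule P.finite_measure_mono) (auto simp: N_def Ns[unfolded N_def])
      then show "s - 1 / real (Suc n) \<le> P.prob N" using A(2)[of n] by simp
    qed
  qed
  have ac: "absolutely_continuous Q (density P (indicator (space Q - N)))"
    unfolding absolutely_continuous_def
  proof
    fix B assume B: "B \<in> null_sets Q"
    then have [measurable]: "B \<in> sets Q" "B \<in> sets P" using sets by auto
    \<comment> \<open>A Q-null set B with mass outside N would push the union of N and B above the
      supremum s.\<close>
    have "P.prob N + P.prob (B - N) = P.prob (N \<union> (B - N))"
      by (rule P.finite_measure_Union[symmetric]) auto
    also have "\<dots> \<le> s" by (rule s) (use N B in auto)
    finally have "P.prob (B - N) = 0"
      using \<open>s \<le> P.prob N\<close> measure_nonneg[of P "B - N"] by linarith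
    moreover have "emeasure (density P (indicator (space Q - N))) B = emeasure P (B - N)"
    proof -
      have "space Q - N \<in> sets P" unfolding sp[symmetric] by measurable
      then have "emeasure (density P (indicator (space Q - N))) B
          = (\<integral>\<^sup>+x. indicator (space Q - N) x * indicator B x \<partial>P)"
        by (intro emeasure_density) auto
      also
      have "(\<integral>\<^sup>+x. indicator (space Q - N) x * indicator B x \<partial>P) = (\<integral>\<^sup>+x. indicator (B - N) x \<partial>P)"
        by (rule nn_integral_cong) (auto simp: indicator_def sp)
      finally show ?thesis by simp
    qed
    ultimately show "B \<in> null_sets (density P (indicator (space Q - N)))"
      by (simp add: null_sets_def P.emeasure_eq_measure)
  qed
  have setsD: "sets (density P (indicator (space Q - N))) = sets Q" using sets by simp
  have finD: "finite_measure (density P (indicator (space Q - N)))"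
    by (rule finite_measure_density_indicator[OF P]) (unfold sp[symmetric], measurable)
  obtain D where D [measurable]: "D \<in> borel_measurable Q"
    and eq: "density Q D = density P (indicator (space Q - N))"
    using Q.Radon_Nikodym[OF ac setsD] by auto
  have Dfin: "AE x in Q. D x \<noteq> \<infinity>"
  proof -
    interpret D: finite_measure "density P (indicator (space Q - N))" by (rule finD)
    have "(\<integral>\<^sup>+x. D x \<partial>Q) = emeasure (density Q D) (space Q)" by (simp add: emeasure_density cong: nn_integral_cong)
    also have "\<dots> < \<infinity>" unfolding eq infinity_ennreal_def less_top[symmetric] by (rule D.emeasure_finite)
    finally show ?thesis by (intro nn_integral_PInf_AE) auto
  qed
  \<comment> \<open>The value infinity on N records the singular part. \<open>enn2real\<close> makes
    L finite off N, so N is exactly the infinite set; it alters D only on a Q-null set.\<close>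
  define L where "L x = (if x \<in> N then \<infinity> else ennreal (enn2real (D x)))" for x
  have Lm [measurable]: "L \<in> borel_measurable Q" unfolding L_def[abs_def] by measurable
  have notN: "AE x in Q. x \<notin> N" using N by (rule AE_not_in)
  have "density Q L = density Q D"
    by (rule density_cong) (use Dfin notN in \<open>auto simp: L_def less_top elim!: eventually_elim2\<close>)
  moreover have "{x \<in> space Q. L x \<noteq> \<infinity>} = space Q - N" by (auto simp: L_def)
  moreover have "AE x in Q. L x < \<infinity>" using notN by eventually_elim (simp add: L_def)
  ultimately have "density_quotient P Q L"
    unfolding density_quotient_iff[OF sets] using eq by simp
  then show "\<exists>L. density_quotient P Q L" by (intro exI[of _ L])
qed

section \<open>Density quotients of product measures and their square roots\<close>

lemma AE_pair_fst:
  assumes "prob_space M2" "AE x in M1. Pr x"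
  shows "AE z in M1 \<Otimes>\<^sub>M M2. Pr (fst z)"
proof (rule AE_distrD[OF measurable_fst])
  show "AE x in distr (M1 \<Otimes>\<^sub>M M2) M1 fst. Pr x"
    unfolding prob_space.distr_pair_fst[OF assms(1)] by (rule assms(2))
qed

lemma AE_pair_snd:
  assumes "prob_space M1" "prob_space M2" "AE y in M2. Pr y"
  shows "AE z in M1 \<Otimes>\<^sub>M M2. Pr (snd z)"
proof (rule AE_distrD[OF measurable_snd])
  show "AE y in distr (M1 \<Otimes>\<^sub>M M2) M2 snd. Pr y"
    unfolding distr_pair_snd[OF assms(1,2)] by (rule assms(3))
qed

context
  fixes P P0 :: "'a measure" and Q Q0 :: "'b measure" and L1 L2
  assumes prob: "prob_space P" "prob_space P0" "prob_space Q" "prob_space Q0"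
    and sets: "sets P = sets P0" "sets Q = sets Q0"
    and dq: "density_quotient P P0 L1" "density_quotient Q Q0 L2"
begin

interpretation P: prob_space P by (rule prob)
interpretation P0: prob_space P0 by (rule prob)
interpretation Q: prob_space Q by (rule prob)
interpretation Q0: prob_space Q0 by (rule prob)

text \<open>The restricting set asks both factors to be finite, not their product: in
  \<open>ennreal\<close> the product of infinity and 0 is 0.\<close>

lemma density_pair_quotient:
  "density (P \<Otimes>\<^sub>M Q) (indicator {z \<in> space (P0 \<Otimes>\<^sub>M Q0). L1 (fst z) \<noteq> \<infinity> \<and> L2 (snd z) \<noteq> \<infinity>})
    = density (P0 \<Otimes>\<^sub>M Q0) (\<lambda>z. L1 (fst z) * L2 (snd z))"
proof -
  let ?A = "{x \<in> space P0. L1 x \<noteq> \<infinity>}" and ?B = "{y \<in> space Q0. L2 y \<noteq> \<infinity>}"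
  note dq' = dq[unfolded density_quotient_iff[OF sets(1)] density_quotient_iff[OF sets(2)]]
  have L [measurable]: "L1 \<in> borel_measurable P0" "L2 \<in> borel_measurable Q0" using dq' by auto
  have A [measurable]: "?A \<in> sets P" "?B \<in> sets Q" unfolding sets by measurable
  have sf: "sigma_finite_measure (density Q (indicator ?B))"
    by (rule finite_measure.axioms(1)[OF finite_measure_density_indicator[OF prob(3) A(2)]])
  have "density (P \<Otimes>\<^sub>M Q) (\<lambda>(x, y). indicator ?A x * indicator ?B y) = density P (indicator ?A) \<Otimes>\<^sub>M density Q (indicator ?B)"
    by (rule pair_measure_density[OF borel_measurable_indicator[OF A(1)] borel_measurable_indicator[OF A(2)]
          Q.sigma_finite_measure_axioms sf, symmetric])
  also have "\<dots> = density P0 L1 \<Otimes>\<^sub>M density Q0 L2"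
    using dq' by simp
  also have "\<dots> = density (P0 \<Otimes>\<^sub>M Q0) (\<lambda>(x, y). L1 x * L2 y)"
    using sf dq' by (intro pair_measure_density) (auto intro: Q0.sigma_finite_measure_axioms)
  also have "(\<lambda>(x, y). L1 x * L2 y) = (\<lambda>z. L1 (fst z) * L2 (snd z))" by auto
  also have "(\<lambda>(x, y). indicator ?A x * indicator ?B y :: ennreal)
      = indicator {z \<in> space (P0 \<Otimes>\<^sub>M Q0). L1 (fst z) \<noteq> \<infinity> \<and> L2 (snd z) \<noteq> \<infinity>}"
    by (auto simp: fun_eq_iff indicator_def space_pair_measure)
  finally show ?thesis .
qed

text \<open>A differentiable product curve comes with some version L of its quotient; uniqueness
  identifies it with the product of quotients of the factors.\<close>

lemma density_quotient_pair_AE: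
  assumes L: "density_quotient (P \<Otimes>\<^sub>M Q) (P0 \<Otimes>\<^sub>M Q0) L"
  shows "AE z in P0 \<Otimes>\<^sub>M Q0. L z = L1 (fst z) * L2 (snd z)"
proof -
  have setsR: "sets (P \<Otimes>\<^sub>M Q) = sets (P0 \<Otimes>\<^sub>M Q0)" using sets by (rule sets_pair_measure_cong)
  note L' = L[unfolded density_quotient_iff[OF setsR]]
  note dq' = dq[unfolded density_quotient_def]
  have [measurable]: "L1 \<in> borel_measurable P0" "L2 \<in> borel_measurable Q0" "L \<in> borel_measurable (P0 \<Otimes>\<^sub>M Q0)"
    using dq' L' by auto
  show ?thesis
  proof (rule density_unique_up_to_null[OF prob_space_pair setsR _ _ _ _ _ _ _ density_pair_quotient])
    show "density (P \<Otimes>\<^sub>M Q) (indicator {z \<in> space (P0 \<Otimes>\<^sub>M Q0). L z \<noteq> \<infinity>}) = density (P0 \<Otimes>\<^sub>M Q0) L"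
      using L' by simp
    have "AE z in P0 \<Otimes>\<^sub>M Q0. L z < \<infinity>" using L' by simp
    then show "AE z in P0 \<Otimes>\<^sub>M Q0. z \<in> {z \<in> space (P0 \<Otimes>\<^sub>M Q0). L z \<noteq> \<infinity>}"
      using AE_space by eventually_elim auto
    have "AE z in P0 \<Otimes>\<^sub>M Q0. L1 (fst z) < \<infinity>"
      using dq' by (intro AE_pair_fst[OF prob(4)]) blast
    moreover have "AE z in P0 \<Otimes>\<^sub>M Q0. L2 (snd z) < \<infinity>"
      using dq' by (intro AE_pair_snd[OF prob(2,4)]) blast
    ultimately show "AE z in P0 \<Otimes>\<^sub>M Q0. z \<in> {z \<in> space (P0 \<Otimes>\<^sub>M Q0). L1 (fst z) \<noteq> \<infinity> \<and> L2 (snd z) \<noteq> \<infinity>}"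
      using AE_space by eventually_elim auto
  qed (use prob in \<open>auto simp del: infinity_ennreal_def\<close>)
qed

end

lemma density_quotient_refl: "density_quotient Q Q (\<lambda>_. 1)"
  by (simp add: density_quotient_def)

text \<open>With the other quotient equal to 1, the set where both factors are finite is the set
  where the product is, so here the product is itself a density quotient.\<close>

lemma density_quotient_fst:
  assumes prob: "prob_space P" "prob_space P0" "prob_space Q0" and sets: "sets P = sets P0"
    and dq: "density_quotient P P0 L"
  shows "density_quotient (P \<Otimes>\<^sub>M Q0) (P0 \<Otimes>\<^sub>M Q0) (\<lambda>z. L (fst z))"
proof -
  have setsR: "sets (P \<Otimes>\<^sub>M Q0) = sets (P0 \<Otimes>\<^sub>M Q0)" using sets refl by (rule sets_pair_measure_cong)
  have [measurable]: "L \<in> borel_measurable P0" using dq by (simp add: density_quotient_def)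
  have "AE z in P0 \<Otimes>\<^sub>M Q0. L (fst z) < \<infinity>"
    using dq unfolding density_quotient_def by (intro AE_pair_fst[OF prob(3)]) blast
  moreover have "(\<lambda>z. L (fst z)) \<in> borel_measurable (P0 \<Otimes>\<^sub>M Q0)" by measurable
  ultimately show ?thesis
    unfolding density_quotient_iff[OF setsR]
    using density_pair_quotient[OF prob(1,2,3,3) sets refl dq density_quotient_refl] by simp
qed

lemma density_quotient_snd:
  assumes prob: "prob_space P0" "prob_space Q" "prob_space Q0" and sets: "sets Q = sets Q0"
    and dq: "density_quotient Q Q0 L"
  shows "density_quotient (P0 \<Otimes>\<^sub>M Q) (P0 \<Otimes>\<^sub>M Q0) (\<lambda>z. L (snd z))"
proof -
  have setsR: "sets (P0 \<Otimes>\<^sub>M Q) = sets (P0 \<Otimes>\<^sub>M Q0)" using refl sets by (rule sets_pair_measure_cong)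
  have [measurable]: "L \<in> borel_measurable Q0" using dq by (simp add: density_quotient_def)
  have "AE z in P0 \<Otimes>\<^sub>M Q0. L (snd z) < \<infinity>"
    using dq unfolding density_quotient_def by (intro AE_pair_snd[OF prob(1,3)]) blast
  moreover have "(\<lambda>z. L (snd z)) \<in> borel_measurable (P0 \<Otimes>\<^sub>M Q0)" by measurable
  ultimately show ?thesis
    unfolding density_quotient_iff[OF setsR]
    using density_pair_quotient[OF prob(1,1,2,3) refl sets density_quotient_refl dq] by simp
qed

text \<open>These are the properties demanded by \<open>local_sequence\<close>. The last one is an
  inequality because P may charge the set where L is infinite.\<close>

lemma density_quotient_sqrt:
  assumes P: "prob_space P" and Q: "prob_space Q" and sets: "sets P = sets Q" and dq: "density_quotient P Q L"
  defines "f \<equiv> \<lambda>x. sqrt (enn2real (L x))"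
  shows "f \<in> L2 Q" and "(LINT x|Q. (f x)^2) = 1 - measure P {x \<in> space P. L x = \<infinity>}"
    and "h \<in> borel_measurable Q \<Longrightarrow> (\<integral>\<^sup>+x. h x * ennreal ((f x)^2) \<partial>Q) \<le> (\<integral>\<^sup>+x. h x \<partial>P)"
proof -
  interpret P: prob_space P by fact
  interpret Q: prob_space Q by fact
  note dq' = dq[unfolded density_quotient_iff[OF sets]]
  have Lm [measurable]: "L \<in> borel_measurable Q" and fin: "AE x in Q. L x < \<infinity>"
    and eq: "density P (indicator {x \<in> space Q. L x \<noteq> \<infinity>}) = density Q L"
    using dq' by auto
  note [measurable_cong] = sets
  have sp: "space P = space Q" using sets by (rule sets_eq_imp_space_eq)
  let ?F = "{x \<in> space Q. L x \<noteq> \<infinity>}"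
  have [measurable]: "?F \<in> sets P" "?F \<in> sets Q" unfolding sets by measurable
  have f2: "(f x)^2 = enn2real (L x)" for x by (simp add: f_def)
  have fm [measurable]: "f \<in> borel_measurable Q" unfolding f_def by measurable
  have int: "(\<integral>\<^sup>+x. h x * ennreal ((f x)^2) \<partial>Q) = (\<integral>\<^sup>+x. indicator ?F x * h x \<partial>P)"
    if [measurable]: "h \<in> borel_measurable Q" for h
  proof -
    have [measurable]: "h \<in> borel_measurable P" using that by measurable
    have "(\<integral>\<^sup>+x. h x * ennreal ((f x)^2) \<partial>Q) = (\<integral>\<^sup>+x. L x * h x \<partial>Q)"
      by (rule nn_integral_cong_AE) (use fin in \<open>auto simp: f2 mult.commute elim!: eventually_mono\<close>)
    also have "\<dots> = (\<integral>\<^sup>+x. h x \<partial>density Q L)" by (rule nn_integral_density[symmetric]) measurable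
    also have "\<dots> = (\<integral>\<^sup>+x. indicator ?F x * h x \<partial>P)"
      unfolding eq[symmetric] by (rule nn_integral_density) measurable
    finally show ?thesis .
  qed
  show "(\<integral>\<^sup>+x. h x * ennreal ((f x)^2) \<partial>Q) \<le> (\<integral>\<^sup>+x. h x \<partial>P)" if "h \<in> borel_measurable Q"
    unfolding int[OF that] by (intro nn_integral_mono) (auto simp: indicator_def)
  have "(\<integral>\<^sup>+x. ennreal ((f x)^2) \<partial>Q) = (\<integral>\<^sup>+x. indicator ?F x \<partial>P)"
    using int[of "\<lambda>_. 1"] by simp
  also have "\<dots> = ennreal (P.prob ?F)" by (simp add: P.emeasure_eq_measure)
  finally have nn: "(\<integral>\<^sup>+x. ennreal ((f x)^2) \<partial>Q) = ennreal (P.prob ?F)" .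
  have f2i: "integrable Q (\<lambda>x. (f x)^2)"
    by (rule integrableI_nonneg) (auto simp: nn)
  then show "f \<in> L2 Q" by (simp add: L2_def)
  have "(LINT x|Q. (f x)^2) = P.prob ?F"
    by (rule integral_eq_nn_integral[THEN trans]) (auto simp: nn)
  also have "?F = {x \<in> space P. \<not> L x = \<infinity>}" by (auto simp: sp)
  also have "P.prob \<dots> = 1 - P.prob {x \<in> space P. L x = \<infinity>}"
    by (rule P.prob_neg) (simp add: sp sets)
  finally show "(LINT x|Q. (f x)^2) = 1 - measure P {x \<in> space P. L x = \<infinity>}" .
qed

section \<open>Differentiable curves and the tangent cone\<close>

text \<open>Squaring removes the root of the norm, so that both conditions become limits of
  quotients by t^2.\<close>

lemma L2_differentiable_iff:
  "L2_differentiable \<epsilon> R g \<longleftrightarrow> g \<in> L2 (R 0) \<and>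
    (\<exists>L :: real \<Rightarrow> 'a \<Rightarrow> ennreal. (\<forall>t. \<bar>t\<bar> < \<epsilon> \<longrightarrow> density_quotient (R t) (R 0) (L t)) \<and>
      ((\<lambda>t. (LINT x|R 0. (2 * (sqrt (enn2real (L t x)) - 1) - t * g x)^2) / t^2) \<longlongrightarrow> 0) (at 0) \<and>
      ((\<lambda>t. measure (R t) {x \<in> space (R t). L t x = \<infinity>} / t^2) \<longlongrightarrow> 0) (at 0))"
proof -
  have nz: "\<forall>\<^sub>F t :: real in at 0. t \<noteq> 0"
    by (simp add: eventually_at_filter)
  have 1: "(\<lambda>t. L2_norm (R 0) (D t)) \<in> o[at 0](\<lambda>t. \<bar>t\<bar>)
      \<longleftrightarrow> ((\<lambda>t. (LINT x|R 0. (D t x)^2) / t^2) \<longlongrightarrow> 0) (at 0)" for D :: "real \<Rightarrow> 'a \<Rightarrow> real"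
  proof
    assume "(\<lambda>t. L2_norm (R 0) (D t)) \<in> o[at 0](\<lambda>t. \<bar>t\<bar>)"
    from smalloD_tendsto[OF this]
    have "((\<lambda>t. (L2_norm (R 0) (D t) / \<bar>t\<bar>)^2) \<longlongrightarrow> 0^2) (at 0)" by (intro tendsto_intros)
    then show "((\<lambda>t. (LINT x|R 0. (D t x)^2) / t^2) \<longlongrightarrow> 0) (at 0)"
      by (simp add: power_divide L2_norm_def)
  next
    assume "((\<lambda>t. (LINT x|R 0. (D t x)^2) / t^2) \<longlongrightarrow> 0) (at 0)"
    from tendsto_real_sqrt[OF this]
    have "((\<lambda>t. L2_norm (R 0) (D t) / \<bar>t\<bar>) \<longlongrightarrow> 0) (at 0)"
      by (simp add: real_sqrt_divide L2_norm_def)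
    then show "(\<lambda>t. L2_norm (R 0) (D t)) \<in> o[at 0](\<lambda>t. \<bar>t\<bar>)"
      using nz by (intro smalloI_tendsto) (auto elim: eventually_mono)
  qed
  have 2: "m \<in> o[at 0](\<lambda>t. t^2) \<longleftrightarrow> ((\<lambda>t. m t / t^2) \<longlongrightarrow> 0) (at 0)" for m :: "real \<Rightarrow> real"
    using nz by (auto intro!: smalloI_tendsto elim: eventually_mono dest: smalloD_tendsto)
  show ?thesis
    unfolding L2_differentiable_def 1 2 by blast
qed

text \<open>As n (t n)^2 tends to s^2, every o(t^2) along the curve becomes o(1/n). Because s is
  nonzero, t n is eventually nonzero and the punctured limits at 0 may be composed with t.\<close>

lemma local_sequence_of_curve:
  assumes prob: "\<And>t. \<bar>t\<bar> < \<epsilon> \<Longrightarrow> prob_space (R t) \<and> sets (R t) = sets (R 0)"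
    and R: "L2_differentiable \<epsilon> R g"
    and t: "\<And>n. \<bar>t n\<bar> < \<epsilon>" "t \<longlonglongrightarrow> 0" "(\<lambda>n. t n * sqrt (real n)) \<longlonglongrightarrow> s" "s \<noteq> 0"
  shows "\<exists>f. local_sequence (R 0) (\<lambda>n. R (t n)) f (\<lambda>x. s * g x)"
proof -
  obtain L where g: "g \<in> L2 (R 0)" and dq: "\<And>t. \<bar>t\<bar> < \<epsilon> \<Longrightarrow> density_quotient (R t) (R 0) (L t)"
    and lim: "((\<lambda>t. (LINT x|R 0. (2 * (sqrt (enn2real (L t x)) - 1) - t * g x)^2) / t^2) \<longlongrightarrow> 0) (at 0)"
    and mass: "((\<lambda>t. measure (R t) {x \<in> space (R t). L t x = \<infinity>} / t^2) \<longlongrightarrow> 0) (at 0)"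
    using R unfolding L2_differentiable_iff by blast
  have \<epsilon>: "0 < \<epsilon>" using t(1)[of 0] by linarith
  have p0: "prob_space (R 0)" using prob[of 0] \<epsilon> by simp
  have p: "prob_space (R (t n))" and se: "sets (R (t n)) = sets (R 0)" for n using prob[OF t(1)] by auto
  define f where "f n x = sqrt (enn2real (L (t n) x))" for n x
  have nz: "\<forall>\<^sub>F n in sequentially. t n \<noteq> 0"
    using tendsto_imp_eventually_ne[OF t(3,4)] by eventually_elim auto
  then have at0: "filterlim t (at 0) sequentially"
    using t(2) by (simp add: filterlim_at)
  have sq: "(\<lambda>n. real n * (t n)^2) \<longlonglongrightarrow> s^2"
    using tendsto_power[OF t(3), of 2] by (simp add: power_mult_distrib mult.commute)
  have scale: "(\<lambda>n. real n * m n) \<longlonglongrightarrow> 0" if "(\<lambda>n. m n / (t n)^2) \<longlonglongrightarrow> 0" for m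
  proof -
    have "(\<lambda>n. real n * (t n)^2 * (m n / (t n)^2)) \<longlonglongrightarrow> s^2 * 0"
      by (intro tendsto_mult sq that)
    then show ?thesis
      unfolding mult_zero_right
      by (rule Lim_transform_eventually) (use nz in \<open>eventually_elim, simp\<close>)
  qed
  have "local_sequence (R 0) (\<lambda>n. R (t n)) f (\<lambda>x. s * g x)"
  proof (intro local_sequence.intro local_sequence_axioms.intro p0 p se)
    show fL2: "f n \<in> L2 (R 0)" for n
      using density_quotient_sqrt(1)[OF p p0 se dq[OF t(1)]] by (simp add: f_def[abs_def])
    show "0 \<le> f n x" for n x by (simp add: f_def)
    show "(\<integral>\<^sup>+x. h x * ennreal ((f n x)^2) \<partial>R 0) \<le> (\<integral>\<^sup>+x. h x \<partial>R (t n))" if "h \<in> borel_measurable (R 0)" for n h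
      using density_quotient_sqrt(3)[OF p p0 se dq[OF t(1)] that] by (simp add: f_def)
    have "1 - (LINT x|R 0. (f n x)^2) = measure (R (t n)) {x \<in> space (R (t n)). L (t n) x = \<infinity>}" for n
      using density_quotient_sqrt(2)[OF p p0 se dq[OF t(1)], of n] by (simp add: f_def)
    then show "(\<lambda>n. real n * (1 - (LINT x|R 0. (f n x)^2))) \<longlonglongrightarrow> 0"
      using scale[OF filterlim_compose[OF mass at0]] by simp
    have D: "(\<lambda>x. 2 * (f n x - 1) - t n * g x) \<in> L2 (R 0)" for n
      by (intro L2_diff L2_cmult fL2 L2_const p0 g)
    have 1: "L2_conv (R 0) (\<lambda>n x. sqrt (real n) * (2 * (f n x - 1) - t n * g x)) (\<lambda>x. 0)"
      unfolding L2_conv_def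
    proof (intro conjI allI L2_cmult D)
      show "(\<lambda>x. 0) \<in> L2 (R 0)" by (simp add: L2_def)
      show "(\<lambda>n. LINT x|R 0. (sqrt (real n) * (2 * (f n x - 1) - t n * g x) - 0)^2) \<longlonglongrightarrow> 0"
        using scale[OF filterlim_compose[OF lim at0]] by (simp add: power_mult_distrib f_def)
    qed
    have 2: "L2_conv (R 0) (\<lambda>n x. t n * sqrt (real n) * g x) (\<lambda>x. s * g x)"
      unfolding L2_conv_def
    proof (intro conjI allI L2_cmult g)
      have "(\<lambda>n. (t n * sqrt (real n) - s)^2 * (LINT x|R 0. (g x)^2)) \<longlonglongrightarrow> (s - s)^2 * (LINT x|R 0. (g x)^2)"
        by (intro tendsto_intros t(3))
      then show "(\<lambda>n. LINT x|R 0. (t n * sqrt (real n) * g x - s * g x)^2) \<longlonglongrightarrow> 0"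
        by (simp add: left_diff_distrib[symmetric] power_mult_distrib)
    qed
    show "L2_conv (R 0) (\<lambda>n x. 2 * sqrt (real n) * (f n x - 1)) (\<lambda>x. s * g x)"
      using L2_conv_add[OF 1 2] by (simp add: algebra_simps)
  qed
  then show ?thesis by blast
qed

section \<open>Marginals of square-integrable functions and of differentiable curves\<close>

lemma integral_pair_mult:
  fixes F :: "'a \<Rightarrow> real" and H :: "'b \<Rightarrow> real"
  assumes "prob_space M1" "prob_space M2" and F: "integrable M1 F" and H: "integrable M2 H"
  shows "integrable (M1 \<Otimes>\<^sub>M M2) (\<lambda>z. F (fst z) * H (snd z))"
    and "(LINT z|(M1 \<Otimes>\<^sub>M M2). F (fst z) * H (snd z)) = (LINT x|M1. F x) * (LINT y|M2. H y)"
proof -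
  interpret M1: prob_space M1 by fact
  interpret M2: prob_space M2 by fact
  interpret pair_prob_space M1 M2 ..
  have [measurable]: "F \<in> borel_measurable M1" "H \<in> borel_measurable M2" using F H by auto
  show int: "integrable (M1 \<Otimes>\<^sub>M M2) (\<lambda>z. F (fst z) * H (snd z))"
    by (rule Fubini_integrable) (use F H in \<open>auto simp: abs_mult\<close>)
  show "(LINT z|(M1 \<Otimes>\<^sub>M M2). F (fst z) * H (snd z)) = (LINT x|M1. F x) * (LINT y|M2. H y)"
    unfolding integral_fst'[OF int, symmetric] by simp
qed

lemma L2_fst:
  assumes "prob_space M1" "prob_space M2" "F \<in> L2 M1"
  shows "(\<lambda>z. F (fst z)) \<in> L2 (M1 \<Otimes>\<^sub>M M2)"
  using integral_pair_mult(1)[OF assms(1,2) L2_square_integrable[OF assms(3)], of "\<lambda>_. 1"]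
    prob_space.finite_measure[OF assms(2)] L2_measurable[OF assms(3)]
  by (simp add: L2_def finite_measure.integrable_const)

text \<open>Integrating out a variable is a contraction of L2: apply Cauchy-Schwarz against the
  constant 1 on almost every section.\<close>

lemma L2_marginal:
  assumes M1: "prob_space M1" and M2: "prob_space M2" and D: "D \<in> L2 (M1 \<Otimes>\<^sub>M M2)"
  shows "AE x in M1. integrable M2 (\<lambda>y. D (x, y))"
    and "(\<lambda>x. LINT y|M2. D (x, y)) \<in> L2 M1"
    and "(LINT x|M1. (LINT y|M2. D (x, y))^2) \<le> (LINT z|(M1 \<Otimes>\<^sub>M M2). (D z)^2)"
proof -
  interpret M1: prob_space M1 by fact
  interpret M2: prob_space M2 by fact
  interpret pair_prob_space M1 M2 ..
  note [measurable] = L2_measurable[OF D]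
  have sq: "integrable (M1 \<Otimes>\<^sub>M M2) (\<lambda>z. (D z)^2)" using D by (rule L2_square_integrable)
  have ae: "AE x in M1. integrable M2 (\<lambda>y. (D (x, y))^2)" using AE_integrable_fst'[OF sq] .
  have L2x: "(\<lambda>y. D (x, y)) \<in> L2 M2" if "x \<in> space M1" "integrable M2 (\<lambda>y. (D (x, y))^2)" for x
    using that by (simp add: L2_def)
  show "AE x in M1. integrable M2 (\<lambda>y. D (x, y))"
    using ae AE_space by eventually_elim (rule L2_integrable[OF M2 L2x])
  have cs: "AE x in M1. (LINT y|M2. D (x, y))^2 \<le> (LINT y|M2. (D (x, y))^2)"
    using ae AE_space
  proof eventually_elim
    case (elim x)
    show ?case
      using L2_Cauchy_Schwarz[OF L2x[OF elim(2,1)] L2_const[OF M2, of 1]] by (simp add: M2.prob_space)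
  qed
  have i2: "integrable M1 (\<lambda>x. LINT y|M2. (D (x, y))^2)" using integrable_fst'[OF sq] .
  have i1: "integrable M1 (\<lambda>x. (LINT y|M2. D (x, y))^2)"
  proof (rule Bochner_Integration.integrable_bound[OF i2])
    show "AE x in M1. norm ((LINT y|M2. D (x, y))^2) \<le> norm (LINT y|M2. (D (x, y))^2)"
      using cs by eventually_elim simp
  qed measurable
  then show "(\<lambda>x. LINT y|M2. D (x, y)) \<in> L2 M1" by (simp add: L2_def)
  have "(LINT x|M1. (LINT y|M2. D (x, y))^2) \<le> (LINT x|M1. LINT y|M2. (D (x, y))^2)"
    by (rule integral_mono_AE[OF i1 i2 cs])
  then show "(LINT x|M1. (LINT y|M2. D (x, y))^2) \<le> (LINT z|(M1 \<Otimes>\<^sub>M M2). (D z)^2)"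
    unfolding integral_fst'[OF sq] .
qed

lemma integral_fst_mult_marginal:
  assumes M1: "prob_space M1" and M2: "prob_space M2" and D: "D \<in> L2 (M1 \<Otimes>\<^sub>M M2)" and k: "k \<in> L2 M1"
  shows "(LINT z|(M1 \<Otimes>\<^sub>M M2). k (fst z) * D z) = (LINT x|M1. k x * (LINT y|M2. D (x, y)))"
proof -
  interpret M1: prob_space M1 by fact
  interpret M2: prob_space M2 by fact
  interpret pair_prob_space M1 M2 ..
  have "integrable (M1 \<Otimes>\<^sub>M M2) (\<lambda>z. k (fst z) * D z)"
    by (intro L2_mult_integrable L2_fst assms)
  from integral_fst'[OF this] show ?thesis by simp
qed

lemma L2_swap:
  assumes "prob_space P" "prob_space Q" "g \<in> L2 (P \<Otimes>\<^sub>M Q)"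
  shows "(\<lambda>(y, x). g (x, y)) \<in> L2 (Q \<Otimes>\<^sub>M P)"
proof -
  interpret P: prob_space P by fact
  interpret Q: prob_space Q by fact
  interpret pair_sigma_finite P Q ..
  have "(\<lambda>(y, x). (g (x, y))^2) = (\<lambda>z. ((case z of (y, x) \<Rightarrow> g (x, y)))^2)" by auto
  then have "integrable (Q \<Otimes>\<^sub>M P) (\<lambda>z. ((case z of (y, x) \<Rightarrow> g (x, y)))^2)"
    using integrable_product_swap[OF L2_square_integrable[OF assms(3)]] by simp
  moreover have "(\<lambda>(y, x). g (x, y)) \<in> borel_measurable (Q \<Otimes>\<^sub>M P)"
    using measurable_compose[OF measurable_pair_swap' L2_measurable[OF assms(3)]] by (simp add: case_prod_beta')
  ultimately show ?thesis by (simp add: L2_def)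
qed

lemma L2_snd:
  assumes "prob_space M1" "prob_space M2" "F \<in> L2 M2"
  shows "(\<lambda>z. F (snd z)) \<in> L2 (M1 \<Otimes>\<^sub>M M2)"
  using L2_swap[OF assms(2,1) L2_fst[OF assms(2,1,3)]] by (simp add: case_prod_beta')

lemma integral_swap:
  fixes h :: "'a \<times> 'b \<Rightarrow> real"
  assumes "prob_space P" "prob_space Q" "h \<in> borel_measurable (P \<Otimes>\<^sub>M Q)"
  shows "(LINT (y, x)|(Q \<Otimes>\<^sub>M P). h (x, y)) = (LINT z|(P \<Otimes>\<^sub>M Q). h z)"
proof -
  interpret P: prob_space P by fact
  interpret Q: prob_space Q by fact
  interpret pair_sigma_finite P Q ..
  show ?thesis using integral_product_swap[OF assms(3)] .
qed

lemma integral_snd_mult_marginal: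
  assumes M1: "prob_space M1" and M2: "prob_space M2" and D: "D \<in> L2 (M1 \<Otimes>\<^sub>M M2)" and k: "k \<in> L2 M2"
  shows "(LINT z|(M1 \<Otimes>\<^sub>M M2). k (snd z) * D z) = (LINT y|M2. k y * (LINT x|M1. D (x, y)))"
proof -
  have "(LINT z|(M1 \<Otimes>\<^sub>M M2). k (snd z) * D z) = (LINT (y, x)|(M2 \<Otimes>\<^sub>M M1). k (snd (x, y)) * D (x, y))"
    by (rule integral_swap[OF M1 M2, symmetric])
       (intro borel_measurable_times L2_measurable L2_snd assms)
  also have "\<dots> = (LINT z|(M2 \<Otimes>\<^sub>M M1). k (fst z) * (case z of (y, x) \<Rightarrow> D (x, y)))"
    by (simp add: case_prod_beta')
  also have "\<dots> = (LINT y|M2. k y * (LINT x|M1. D (x, y)))"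
    using integral_fst_mult_marginal[OF M2 M1 L2_swap[OF M1 M2 D] k] by simp
  finally show ?thesis .
qed

text \<open>The pointwise identity is 1 - f = (1 - f^2) / 2 + (f - 1)^2 / 2. For f the root of a
  density, the integral of f is the Hellinger affinity, so its defect from 1 is of second
  order.\<close>

lemma one_minus_le_half:
  assumes M: "prob_space M" and f: "f \<in> L2 M" and nn: "\<And>x. 0 \<le> f x" and le: "(LINT x|M. (f x)^2) \<le> 1"
  shows "0 \<le> (LINT x|M. f x)" "(LINT x|M. f x) \<le> 1"
    "1 - (LINT x|M. f x) = (1 - (LINT x|M. (f x)^2)) / 2 + (LINT x|M. (f x - 1)^2) / 2"
proof -
  interpret prob_space M by fact
  have [simp]: "integrable M f" "integrable M (\<lambda>x. (f x)^2)"
    using L2_integrable[OF M f] L2_square_integrable[OF f] by auto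
  show "0 \<le> (LINT x|M. f x)" by (rule integral_nonneg_AE) (simp add: nn)
  have "(LINT x|M. (f x - 1)^2) = (LINT x|M. (f x)^2 - 2 * f x + 1)"
    by (rule Bochner_Integration.integral_cong) (auto simp: power2_eq_square algebra_simps)
  then have *: "(LINT x|M. (f x - 1)^2) = (LINT x|M. (f x)^2) - 2 * (LINT x|M. f x) + 1"
    by (simp add: prob_space)
  have nn2: "0 \<le> (LINT x|M. (f x - 1)^2)" by simp
  show "(LINT x|M. f x) \<le> 1"
    "1 - (LINT x|M. f x) = (1 - (LINT x|M. (f x)^2)) / 2 + (LINT x|M. (f x - 1)^2) / 2"
    subgoal using nn2 * le by linarith
    subgoal unfolding * by (simp add: field_simps)
    done
qed

text \<open>Let D = 2 (f1 f2 - 1) - t g and let c2 be the integral of f2. Integrating D over the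
  second variable leaves the remainder of the first factor up to the error 2 (1 - c2) f1. The
  marginal of D is controlled by contraction; 1 - c2 is O(t^2) once s and N are, so its square is of
  order t^4. The constants 2 and 8 come from (a + b)^2 \<le> 2 a^2 + 2 b^2 with b = 2 (1 - c2)
  f1.\<close>

lemma marginal_bound:
  fixes t :: real and f1 :: "'a \<Rightarrow> real" and f2 :: "'b \<Rightarrow> real"
  assumes M: "prob_space M1" "prob_space M2"
    and f_L2: "f1 \<in> L2 M1" "f2 \<in> L2 M2" and f_nn: "\<And>x. 0 \<le> f1 x" "\<And>y. 0 \<le> f2 y"
    and f_le: "(LINT x|M1. (f1 x)^2) \<le> 1" "(LINT y|M2. (f2 y)^2) \<le> 1"
    and g: "g \<in> L2 (M1 \<Otimes>\<^sub>M M2)"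
  defines "s \<equiv> 1 - (LINT x|M1. (f1 x)^2) * (LINT y|M2. (f2 y)^2)"
    and "N \<equiv> LINT z|(M1 \<Otimes>\<^sub>M M2). (2 * (f1 (fst z) * f2 (snd z) - 1) - t * g z)^2"
  shows "1 - (LINT x|M1. (f1 x)^2) \<le> s"
    and "(LINT x|M1. (2 * (f1 x - 1) - t * (LINT y|M2. g (x, y)))^2)
      \<le> 2 * N + 8 * (s / 2 + N / 4 + t^2 * (LINT z|(M1 \<Otimes>\<^sub>M M2). (g z)^2) / 4)^2"
proof -
  interpret M1: prob_space M1 by fact
  interpret M2: prob_space M2 by fact
  let ?R = "M1 \<Otimes>\<^sub>M M2"
  have R: "prob_space ?R" using M by (rule prob_space_pair)
  define f where "f z = f1 (fst z) * f2 (snd z)" for z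
  define D where "D z = 2 * (f z - 1) - t * g z" for z
  define g1 where "g1 x = (LINT y|M2. g (x, y))" for x
  define c1 where "c1 = (LINT x|M1. f1 x)"
  define c2 where "c2 = (LINT y|M2. f2 y)"
  have N: "N = (LINT z|?R. (D z)^2)" by (simp add: N_def D_def f_def)
  have int1: "integrable M1 f1" "integrable M2 f2" "integrable M1 (\<lambda>x. (f1 x)^2)" "integrable M2 (\<lambda>y. (f2 y)^2)"
    using f_L2 M by (auto intro: L2_integrable L2_square_integrable)
  have c: "0 \<le> c1" "c1 \<le> 1" "0 \<le> c2" "c2 \<le> 1"
    unfolding c1_def c2_def
    by (rule one_minus_le_half(1,2)[OF M(1) f_L2(1) f_nn(1) f_le(1)]
        one_minus_le_half(1,2)[OF M(2) f_L2(2) f_nn(2) f_le(2)])+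
  note [measurable] = f_L2[THEN L2_measurable] L2_measurable[OF g]
  have f: "f \<in> L2 ?R"
    using integral_pair_mult(1)[OF M int1(3,4)] by (simp add: L2_def f_def[abs_def] power_mult_distrib)
  have fs: "(LINT z|?R. (f z)^2) = 1 - s"
    unfolding f_def power_mult_distrib s_def by (simp add: integral_pair_mult(2)[OF M int1(3,4)])
  have fc: "(LINT z|?R. f z) = c1 * c2"
    unfolding f_def c1_def c2_def by (rule integral_pair_mult(2)[OF M int1(1,2)])
  have D: "D \<in> L2 ?R"
    unfolding D_def[abs_def] by (intro L2_diff L2_cmult f L2_const R g)
  have sq_nn: "0 \<le> (LINT x|M1. (f1 x)^2)" "0 \<le> (LINT y|M2. (f2 y)^2)" by simp_all
  have "(LINT x|M1. (f1 x)^2) * (LINT y|M2. (f2 y)^2) \<le> (LINT x|M1. (f1 x)^2) * 1"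
    using f_le(2) sq_nn(1) by (rule mult_left_mono)
  then show s1: "1 - (LINT x|M1. (f1 x)^2) \<le> s" by (simp add: s_def)
  have s0: "0 \<le> s" using s1 f_le(1) by linarith
  have "(LINT z|?R. (f z - 1)^2) \<le> (LINT z|?R. 1 / 2 * (D z)^2 + t^2 / 2 * (g z)^2)"
  proof (rule integral_mono)
    fix z
    have "a^2 \<le> 1 / 2 * (2 * a - b)^2 + b^2 / 2" for a b :: real
    proof -
      have "1 / 2 * (2 * a - b)^2 + b^2 / 2 - a^2 = (a - b)^2"
        by (simp add: power2_eq_square field_simps)
      then show ?thesis using zero_le_power2[of "a - b"] by linarith
    qed
    from this[of "f z - 1" "t * g z"]
    show "(f z - 1)^2 \<le> 1 / 2 * (D z)^2 + t^2 / 2 * (g z)^2"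
      by (simp add: D_def power_mult_distrib)
  qed (intro Bochner_Integration.integrable_add integrable_mult_right L2_square_integrable[OF D]
      L2_square_integrable[OF g] L2_square_integrable[OF L2_diff[OF f L2_const[OF R]]])+
  also have "\<dots> = N / 2 + t^2 / 2 * (LINT z|?R. (g z)^2)"
    unfolding N using L2_square_integrable[OF D] L2_square_integrable[OF g] by simp
  finally have f_one: "(LINT z|?R. (f z - 1)^2) \<le> N / 2 + t^2 / 2 * (LINT z|?R. (g z)^2)" .
  have "1 - c1 * c2 = s / 2 + (LINT z|?R. (f z - 1)^2) / 2"
    using one_minus_le_half(3)[OF R f, unfolded fs fc] f_nn s0 by (simp add: f_def)
  \<comment> \<open>Both affinities are at most 1, so the defect of c2 alone is bounded by that of
    the product, which the joint curve controls.\<close>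
  moreover have "c1 * c2 \<le> c2" using c by (simp add: mult_left_le_one_le)
  ultimately have c2: "1 - c2 \<le> s / 2 + N / 4 + t^2 * (LINT z|?R. (g z)^2) / 4"
    using f_one by (simp add: field_simps)
  note D1 = L2_marginal[OF M D]
  have eq: "AE x in M1. 2 * (f1 x - 1) - t * g1 x = (LINT y|M2. D (x, y)) + 2 * (1 - c2) * f1 x"
    using L2_marginal(1)[OF M g]
  proof eventually_elim
    case (elim x)
    have "(LINT y|M2. D (x, y)) = 2 * (f1 x * c2 - 1) - t * g1 x"
      using elim int1(2) by (simp add: D_def f_def c2_def g1_def M2.prob_space)
    then show ?case by (simp add: algebra_simps)
  qed
  have "(LINT x|M1. (2 * (f1 x - 1) - t * g1 x)^2)
      \<le> (LINT x|M1. 2 * (LINT y|M2. D (x, y))^2 + 8 * (1 - c2)^2 * (f1 x)^2)"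
  proof (rule integral_mono_AE)
    show "integrable M1 (\<lambda>x. (2 * (f1 x - 1) - t * g1 x)^2)"
      unfolding g1_def by (intro L2_square_integrable L2_diff L2_cmult f_L2 L2_const M L2_marginal(2) g)
    show "integrable M1 (\<lambda>x. 2 * (LINT y|M2. D (x, y))^2 + 8 * (1 - c2)^2 * (f1 x)^2)"
      using L2_square_integrable[OF D1(2)] int1(3) by simp
    show "AE x in M1. (2 * (f1 x - 1) - t * g1 x)^2 \<le> 2 * (LINT y|M2. D (x, y))^2 + 8 * (1 - c2)^2 * (f1 x)^2"
      using eq
    proof eventually_elim
      case (elim x)
      have "(a + 2 * b * e)^2 \<le> 2 * a^2 + 8 * b^2 * e^2" for a b e :: real
      proof -
        have "2 * a^2 + 8 * b^2 * e^2 - (a + 2 * b * e)^2 = (a - 2 * b * e)^2"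
          by (simp add: power2_eq_square algebra_simps)
        then show ?thesis using zero_le_power2[of "a - 2 * b * e"] by linarith
      qed
      then show ?case unfolding elim .
    qed
  qed
  also have "\<dots> = 2 * (LINT x|M1. (LINT y|M2. D (x, y))^2) + 8 * (1 - c2)^2 * (LINT x|M1. (f1 x)^2)"
    using L2_square_integrable[OF D1(2)] int1(3) by simp
  also have "\<dots> \<le> 2 * N + 8 * (s / 2 + N / 4 + t^2 * (LINT z|?R. (g z)^2) / 4)^2 * 1"
    using D1(3) c c2 f_le unfolding N by (intro add_mono mult_mono power_mono) auto
  finally show "(LINT x|M1. (2 * (f1 x - 1) - t * (LINT y|M2. g (x, y)))^2)
      \<le> 2 * N + 8 * (s / 2 + N / 4 + t^2 * (LINT z|?R. (g z)^2) / 4)^2"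
    by (simp add: g1_def)
qed

text \<open>If s and N are o(t^2), the bracket is O(t^2), so its square divided by t^2 is again
  O(t^2). Stated with abstract s and N because both factors share those of the product
  curve.\<close>

lemma L2_differentiable_if_bounds:
  fixes s N :: "real \<Rightarrow> real"
  assumes \<epsilon>: "\<epsilon> > 0" and g: "g \<in> L2 (P 0)"
    and dq: "\<And>t. \<bar>t\<bar> < \<epsilon> \<Longrightarrow> density_quotient (P t) (P 0) (L t)"
    and mass: "\<And>t. \<bar>t\<bar> < \<epsilon> \<Longrightarrow> measure (P t) {x \<in> space (P t). L t x = \<infinity>} \<le> s t"
    and bound: "\<And>t. \<bar>t\<bar> < \<epsilon> \<Longrightarrow> (LINT x|P 0. (2 * (sqrt (enn2real (L t x)) - 1) - t * g x)^2)
      \<le> 2 * N t + 8 * (s t / 2 + N t / 4 + t^2 * C / 4)^2"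
    and lim_s: "((\<lambda>t. s t / t^2) \<longlongrightarrow> 0) (at 0)" and lim_N: "((\<lambda>t. N t / t^2) \<longlongrightarrow> 0) (at 0)"
  shows "L2_differentiable \<epsilon> P g"
proof -
  have ev: "\<forall>\<^sub>F t in at 0. \<bar>t\<bar> < \<epsilon> \<and> t \<noteq> 0"
    unfolding eventually_at using \<epsilon> by (auto simp: dist_real_def)
  have "((\<lambda>t. 2 * (N t / t^2) + 8 * t^2 * (s t / t^2 / 2 + N t / t^2 / 4 + C / 4)^2) \<longlongrightarrow>
      2 * 0 + 8 * 0^2 * (0 / 2 + 0 / 4 + C / 4)^2) (at 0)"
    by (intro tendsto_intros lim_s lim_N) auto
  then have lim0: "((\<lambda>t. 2 * (N t / t^2) + 8 * t^2 * (s t / t^2 / 2 + N t / t^2 / 4 + C / 4)^2) \<longlongrightarrow> 0) (at 0)"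
    by simp
  show ?thesis
    unfolding L2_differentiable_iff
  proof (intro conjI exI allI impI g)
    show "density_quotient (P t) (P 0) (L t)" if "\<bar>t\<bar> < \<epsilon>" for t using dq[OF that] .
    show "((\<lambda>t. (LINT x|P 0. (2 * (sqrt (enn2real (L t x)) - 1) - t * g x)^2) / t^2) \<longlongrightarrow> 0) (at 0)"
    proof (rule tendsto_sandwich[OF _ _ tendsto_const lim0])
      show "\<forall>\<^sub>F t in at 0. (LINT x|P 0. (2 * (sqrt (enn2real (L t x)) - 1) - t * g x)^2) / t^2
          \<le> 2 * (N t / t^2) + 8 * t^2 * (s t / t^2 / 2 + N t / t^2 / 4 + C / 4)^2"
        using ev
      proof eventually_elim
        case (elim t)
        have t: "t^2 > 0" using elim by simp
        have "8 * t^2 * (s t / t^2 / 2 + N t / t^2 / 4 + C / 4)^2 = 8 * (t^2 * (s t / t^2 / 2 + N t / t^2 / 4 + C / 4))^2 / t^2"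
          using t by (simp add: power2_eq_square)
        also have "t^2 * (s t / t^2 / 2 + N t / t^2 / 4 + C / 4) = s t / 2 + N t / 4 + t^2 * C / 4"
          using t by (simp add: distrib_left)
        finally have "2 * (N t / t^2) + 8 * t^2 * (s t / t^2 / 2 + N t / t^2 / 4 + C / 4)^2
            = (2 * N t + 8 * (s t / 2 + N t / 4 + t^2 * C / 4)^2) / t^2"
          by (simp add: add_divide_distrib)
        then show ?case using bound[of t] elim t by (simp add: divide_right_mono)
      qed
    qed (auto intro!: always_eventually)
    show "((\<lambda>t. measure (P t) {x \<in> space (P t). L t x = \<infinity>} / t^2) \<longlongrightarrow> 0) (at 0)"
    proof (rule tendsto_sandwich[OF _ _ tendsto_const lim_s])
      show "\<forall>\<^sub>F t in at 0. measure (P t) {x \<in> space (P t). L t x = \<infinity>} / t^2 \<le> s t / t^2"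
        using ev by eventually_elim (intro divide_right_mono mass; simp)
    qed (auto intro!: always_eventually)
  qed
qed

text \<open>The quotients of the factors exist by Lebesgue decomposition, and their product agrees
  almost everywhere with the given L. Hence N and s, defined from L, are the quantities of the
  marginal bound; the second factor follows by swapping coordinates.\<close>

lemma L2_differentiable_marginals:
  assumes \<epsilon>: "\<epsilon> > 0"
    and P: "\<And>t. \<bar>t\<bar> < \<epsilon> \<Longrightarrow> prob_space (P t) \<and> sets (P t) = sets (P 0)"
    and Q: "\<And>t. \<bar>t\<bar> < \<epsilon> \<Longrightarrow> prob_space (Q t) \<and> sets (Q t) = sets (Q 0)"
    and diff: "L2_differentiable \<epsilon> (\<lambda>t. P t \<Otimes>\<^sub>M Q t) g"
  shows "L2_differentiable \<epsilon> P (\<lambda>x. LINT y|Q 0. g (x, y))"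
    and "L2_differentiable \<epsilon> Q (\<lambda>y. LINT x|P 0. g (x, y))"
proof -
  let ?R = "\<lambda>t. P t \<Otimes>\<^sub>M Q t"
  obtain L where g: "g \<in> L2 (?R 0)" and dq: "\<And>t. \<bar>t\<bar> < \<epsilon> \<Longrightarrow> density_quotient (?R t) (?R 0) (L t)"
    and lim: "((\<lambda>t. (LINT x|?R 0. (2 * (sqrt (enn2real (L t x)) - 1) - t * g x)^2) / t^2) \<longlongrightarrow> 0) (at 0)"
    and mass: "((\<lambda>t. measure (?R t) {x \<in> space (?R t). L t x = \<infinity>} / t^2) \<longlongrightarrow> 0) (at 0)"
    using diff unfolding L2_differentiable_iff by blast
  have P0: "prob_space (P 0)" and Q0: "prob_space (Q 0)" using P[of 0] Q[of 0] \<epsilon> by auto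
  have "\<exists>L1. \<bar>t\<bar> < \<epsilon> \<longrightarrow> density_quotient (P t) (P 0) L1" "\<exists>L2'. \<bar>t\<bar> < \<epsilon> \<longrightarrow> density_quotient (Q t) (Q 0) L2'" for t
    using density_quotient_exists[OF _ P0, of "P t"] density_quotient_exists[OF _ Q0, of "Q t"] P[of t] Q[of t] by blast+
  then obtain L1 L2' where dq1: "\<And>t. \<bar>t\<bar> < \<epsilon> \<Longrightarrow> density_quotient (P t) (P 0) (L1 t)"
    and dq2: "\<And>t. \<bar>t\<bar> < \<epsilon> \<Longrightarrow> density_quotient (Q t) (Q 0) (L2' t)"
    by metis
  define s where "s t = measure (?R t) {x \<in> space (?R t). L t x = \<infinity>}" for t
  define N where "N t = (LINT x|?R 0. (2 * (sqrt (enn2real (L t x)) - 1) - t * g x)^2)" for t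
  define f1 where "f1 t x = sqrt (enn2real (L1 t x))" for t x
  define f2 where "f2 t y = sqrt (enn2real (L2' t y))" for t y
  note lims = mass[folded s_def] lim[folded N_def]
  have bounds: "measure (P t) {x \<in> space (P t). L1 t x = \<infinity>} \<le> s t"
      "(LINT x|P 0. (2 * (f1 t x - 1) - t * (LINT y|Q 0. g (x, y)))^2)
        \<le> 2 * N t + 8 * (s t / 2 + N t / 4 + t^2 * (LINT z|?R 0. (g z)^2) / 4)^2"
      "measure (Q t) {y \<in> space (Q t). L2' t y = \<infinity>} \<le> s t"
      "(LINT y|Q 0. (2 * (f2 t y - 1) - t * (LINT x|P 0. g (x, y)))^2)
        \<le> 2 * N t + 8 * (s t / 2 + N t / 4 + t^2 * (LINT z|?R 0. (g z)^2) / 4)^2"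
    if t: "\<bar>t\<bar> < \<epsilon>" for t
  proof -
    have pt: "prob_space (P t)" "prob_space (Q t)" "sets (P t) = sets (P 0)" "sets (Q t) = sets (Q 0)"
      using P[OF t] Q[OF t] by auto
    have rt: "prob_space (?R t)" "prob_space (?R 0)" "sets (?R t) = sets (?R 0)"
      using pt P0 Q0 by (auto intro: prob_space_pair sets_pair_measure_cong)
    note q1 = density_quotient_sqrt[OF pt(1) P0 pt(3) dq1[OF t], folded f1_def]
      and q2 = density_quotient_sqrt[OF pt(2) Q0 pt(4) dq2[OF t], folded f2_def]
      and q = density_quotient_sqrt[OF rt dq[OF t]]
    have fL2: "f1 t \<in> L2 (P 0)" "f2 t \<in> L2 (Q 0)" using q1(1) q2(1) by simp_all
    have nn: "0 \<le> f1 t x" "0 \<le> f2 t y" for x y by (simp_all add: f1_def f2_def)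
    have le: "(LINT x|P 0. (f1 t x)^2) \<le> 1" "(LINT y|Q 0. (f2 t y)^2) \<le> 1"
      unfolding q1(2) q2(2) by simp_all
    note [measurable] = fL2[THEN L2_measurable] L2_measurable[OF g] L2_measurable[OF q(1)]
    have fprod: "AE z in ?R 0. sqrt (enn2real (L t z)) = f1 t (fst z) * f2 t (snd z)"
      using density_quotient_pair_AE[OF pt(1) P0 pt(2) Q0 pt(3,4) dq1[OF t] dq2[OF t] dq[OF t]]
      by eventually_elim (simp add: f1_def f2_def enn2real_mult real_sqrt_mult)
    have N: "(LINT z|?R 0. (2 * (f1 t (fst z) * f2 t (snd z) - 1) - t * g z)^2) = N t"
      unfolding N_def by (rule integral_cong_AE) (use fprod in \<open>auto elim!: eventually_mono\<close>)
    have "(LINT z|?R 0. (sqrt (enn2real (L t z)))^2) = (LINT z|?R 0. (f1 t (fst z))^2 * (f2 t (snd z))^2)"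
    proof (rule integral_cong_AE)
      show "AE z in ?R 0. (sqrt (enn2real (L t z)))^2 = (f1 t (fst z))^2 * (f2 t (snd z))^2"
        using fprod by eventually_elim (simp only: power_mult_distrib)
    qed (rule borel_measurable_power[OF L2_measurable[OF q(1)]], measurable)
    also have "\<dots> = (LINT x|P 0. (f1 t x)^2) * (LINT y|Q 0. (f2 t y)^2)"
      by (intro integral_pair_mult(2) P0 Q0 L2_square_integrable fL2)
    finally have s: "1 - (LINT x|P 0. (f1 t x)^2) * (LINT y|Q 0. (f2 t y)^2) = s t"
      unfolding q(2) s_def by simp
    have g': "(\<lambda>(y, x). g (x, y)) \<in> L2 (Q 0 \<Otimes>\<^sub>M P 0)" by (rule L2_swap[OF P0 Q0 g])
    have N': "(LINT z|(Q 0 \<Otimes>\<^sub>M P 0). (2 * (f2 t (fst z) * f1 t (snd z) - 1) - t * (case z of (y, x) \<Rightarrow> g (x, y)))^2) = N t"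
    proof -
      have "(LINT (y, x)|(Q 0 \<Otimes>\<^sub>M P 0). (2 * (f1 t (fst (x, y)) * f2 t (snd (x, y)) - 1) - t * g (x, y))^2) = N t"
        unfolding N[symmetric] by (rule integral_swap[OF P0 Q0]) measurable
      then show ?thesis by (simp add: case_prod_beta' mult.commute)
    qed
    have g2: "(LINT z|(Q 0 \<Otimes>\<^sub>M P 0). (case z of (y, x) \<Rightarrow> g (x, y))^2) = (LINT z|?R 0. (g z)^2)"
      using integral_swap[OF P0 Q0, of "\<lambda>z. (g z)^2"] by (simp add: case_prod_beta')
    note s' = s[unfolded mult.commute[of "LINT x|P 0. (f1 t x)^2"]]
    show "measure (P t) {x \<in> space (P t). L1 t x = \<infinity>} \<le> s t"
      using marginal_bound(1)[OF P0 Q0 fL2 nn le g, unfolded s, unfolded q1(2)] by simp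
    show "(LINT x|P 0. (2 * (f1 t x - 1) - t * (LINT y|Q 0. g (x, y)))^2)
        \<le> 2 * N t + 8 * (s t / 2 + N t / 4 + t^2 * (LINT z|?R 0. (g z)^2) / 4)^2"
      using marginal_bound(2)[OF P0 Q0 fL2 nn le g, of t] unfolding s N .
    show "measure (Q t) {y \<in> space (Q t). L2' t y = \<infinity>} \<le> s t"
      using marginal_bound(1)[OF Q0 P0 fL2(2,1) nn(2,1) le(2,1) g', unfolded s', unfolded q2(2)] by simp
    show "(LINT y|Q 0. (2 * (f2 t y - 1) - t * (LINT x|P 0. g (x, y)))^2)
        \<le> 2 * N t + 8 * (s t / 2 + N t / 4 + t^2 * (LINT z|?R 0. (g z)^2) / 4)^2"
      using marginal_bound(2)[OF Q0 P0 fL2(2,1) nn(2,1) le(2,1) g', of t] unfolding s' N' g2 by simp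
  qed
  show "L2_differentiable \<epsilon> P (\<lambda>x. LINT y|Q 0. g (x, y))"
    by (rule L2_differentiable_if_bounds[where L=L1 and s=s and N=N, OF \<epsilon> L2_marginal(2)[OF P0 Q0 g]
          dq1 bounds(1) bounds(2)[unfolded f1_def] lims])
  show "L2_differentiable \<epsilon> Q (\<lambda>y. LINT x|P 0. g (x, y))"
    using L2_marginal(2)[OF Q0 P0 L2_swap[OF P0 Q0 g]]
    by (intro L2_differentiable_if_bounds[where L=L2' and s=s and N=N, OF \<epsilon> _
          dq2 bounds(3) bounds(4)[unfolded f2_def] lims]) simp_all
qed

text \<open>All quantities in the definition are integrals or masses, which are transported by image
  measures. T will be a projection from a product in which the other factor is held
  constant.\<close>

lemma L2_differentiable_pullback:
  assumes \<epsilon>: "\<epsilon> > 0" and sets: "\<And>t. \<bar>t\<bar> < \<epsilon> \<Longrightarrow> sets (R t) = sets (R 0)"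
    and T: "\<And>t. \<bar>t\<bar> < \<epsilon> \<Longrightarrow> T \<in> measurable (S t) (R t)" "\<And>t. \<bar>t\<bar> < \<epsilon> \<Longrightarrow> distr (S t) (R t) T = R t"
    and dq: "\<And>t L. \<bar>t\<bar> < \<epsilon> \<Longrightarrow> density_quotient (R t) (R 0) L \<Longrightarrow> density_quotient (S t) (S 0) (\<lambda>z. L (T z))"
    and diff: "L2_differentiable \<epsilon> R g"
  shows "L2_differentiable \<epsilon> S (\<lambda>z. g (T z))"
proof -
  obtain L where g: "g \<in> L2 (R 0)" and dqL: "\<And>t. \<bar>t\<bar> < \<epsilon> \<Longrightarrow> density_quotient (R t) (R 0) (L t)"
    and lim: "((\<lambda>t. (LINT x|R 0. (2 * (sqrt (enn2real (L t x)) - 1) - t * g x)^2) / t^2) \<longlongrightarrow> 0) (at 0)"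
    and mass: "((\<lambda>t. measure (R t) {x \<in> space (R t). L t x = \<infinity>} / t^2) \<longlongrightarrow> 0) (at 0)"
    using diff unfolding L2_differentiable_iff by blast
  have 0: "\<bar>0\<bar> < \<epsilon>" using \<epsilon> by simp
  have ev: "\<forall>\<^sub>F t in at 0. \<bar>t\<bar> < \<epsilon>"
    unfolding eventually_at using \<epsilon> by (auto simp: dist_real_def)
  note [measurable] = L2_measurable[OF g] T(1)[OF 0]
  have int: "(LINT x|R 0. h x) = (LINT z|S 0. h (T z))" if "h \<in> borel_measurable (R 0)" for h :: "'a \<Rightarrow> real"
    using integral_distr[OF T(1)[OF 0] that] unfolding T(2)[OF 0] .
  show ?thesis
    unfolding L2_differentiable_iff
  proof (intro conjI exI allI impI)
    have "integrable (distr (S 0) (R 0) T) (\<lambda>x. (g x)^2)"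
      unfolding T(2)[OF 0] by (rule L2_square_integrable[OF g])
    then have "integrable (S 0) (\<lambda>z. (g (T z))^2)" by (rule integrable_distr[OF T(1)[OF 0]])
    then show "(\<lambda>z. g (T z)) \<in> L2 (S 0)" by (simp add: L2_def)
    show "density_quotient (S t) (S 0) (\<lambda>z. L t (T z))" if "\<bar>t\<bar> < \<epsilon>" for t
      by (rule dq[OF that dqL[OF that]])
    show "((\<lambda>t. (LINT z|S 0. (2 * (sqrt (enn2real (L t (T z))) - 1) - t * g (T z))^2) / t^2) \<longlongrightarrow> 0) (at 0)"
    proof (rule Lim_transform_eventually[OF lim])
      show "\<forall>\<^sub>F t in at 0. (LINT x|R 0. (2 * (sqrt (enn2real (L t x)) - 1) - t * g x)^2) / t^2
          = (LINT z|S 0. (2 * (sqrt (enn2real (L t (T z))) - 1) - t * g (T z))^2) / t^2"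
        using ev
      proof eventually_elim
        case (elim t)
        have [measurable]: "L t \<in> borel_measurable (R 0)" using dqL[OF elim] by (simp add: density_quotient_def)
        show ?case by (subst int) auto
      qed
    qed
    show "((\<lambda>t. measure (S t) {z \<in> space (S t). L t (T z) = \<infinity>} / t^2) \<longlongrightarrow> 0) (at 0)"
    proof (rule Lim_transform_eventually[OF mass])
      show "\<forall>\<^sub>F t in at 0. measure (R t) {x \<in> space (R t). L t x = \<infinity>} / t^2
          = measure (S t) {z \<in> space (S t). L t (T z) = \<infinity>} / t^2"
        using ev
      proof eventually_elim
        case (elim t)
        have "L t \<in> borel_measurable (R t)"
          using dqL[OF elim] measurable_cong_sets[OF sets[OF elim] refl] by (auto simp: density_quotient_def)
        then have B: "{x \<in> space (R t). L t x = \<infinity>} \<in> sets (R t)" by measurable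
        have "T -` {x \<in> space (R t). L t x = \<infinity>} \<inter> space (S t) = {z \<in> space (S t). L t (T z) = \<infinity>}"
          using measurable_space[OF T(1)[OF elim]] by auto
        then show ?case
          using measure_distr[OF T(1)[OF elim] B] unfolding T(2)[OF elim] by simp
      qed
    qed
  qed
qed

lemma L2_differentiable_fst:
  assumes \<epsilon>: "\<epsilon> > 0"
    and P: "\<And>t. \<bar>t\<bar> < \<epsilon> \<Longrightarrow> prob_space (P t) \<and> sets (P t) = sets (P 0)"
    and Q0: "prob_space Q0" and diff: "L2_differentiable \<epsilon> P g"
  shows "L2_differentiable \<epsilon> (\<lambda>t. P t \<Otimes>\<^sub>M Q0) (\<lambda>z. g (fst z))"
proof (rule L2_differentiable_pullback[OF \<epsilon> _ measurable_fst prob_space.distr_pair_fst[OF Q0] _ diff])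
  fix t assume t: "\<bar>t\<bar> < \<epsilon>"
  show "sets (P t) = sets (P 0)" using P[OF t] by simp
  show "density_quotient (P t \<Otimes>\<^sub>M Q0) (P 0 \<Otimes>\<^sub>M Q0) (\<lambda>z. L (fst z))" if "density_quotient (P t) (P 0) L" for L
    using P[OF t] P[of 0] \<epsilon> by (intro density_quotient_fst that Q0) simp_all
qed

lemma L2_differentiable_snd:
  assumes \<epsilon>: "\<epsilon> > 0"
    and Q: "\<And>t. \<bar>t\<bar> < \<epsilon> \<Longrightarrow> prob_space (Q t) \<and> sets (Q t) = sets (Q 0)"
    and P0: "prob_space P0" and diff: "L2_differentiable \<epsilon> Q g"
  shows "L2_differentiable \<epsilon> (\<lambda>t. P0 \<Otimes>\<^sub>M Q t) (\<lambda>z. g (snd z))"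
proof (rule L2_differentiable_pullback[OF \<epsilon> _ measurable_snd _ _ diff])
  fix t assume t: "\<bar>t\<bar> < \<epsilon>"
  show "sets (Q t) = sets (Q 0)" using Q[OF t] by simp
  show "distr (P0 \<Otimes>\<^sub>M Q t) (Q t) snd = Q t" using Q[OF t] by (intro distr_pair_snd P0) simp
  show "density_quotient (P0 \<Otimes>\<^sub>M Q t) (P0 \<Otimes>\<^sub>M Q 0) (\<lambda>z. L (snd z))" if "density_quotient (Q t) (Q 0) L" for L
    using Q[OF t] Q[of 0] \<epsilon> by (intro density_quotient_snd that P0) simp_all
qed

text \<open>A curve is a total function with arbitrary values outside (-\<epsilon>, \<epsilon>).
  This permits replacing R t by a factorisation chosen only for small t.\<close>

lemma L2_differentiable_cong:
  assumes \<epsilon>: "\<epsilon> > 0" and eq: "\<And>t. \<bar>t\<bar> < \<epsilon> \<Longrightarrow> R t = R' t"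
  shows "L2_differentiable \<epsilon> R g \<longleftrightarrow> L2_differentiable \<epsilon> R' g"
proof -
  have 0: "R 0 = R' 0" using eq[of 0] \<epsilon> by simp
  have "\<forall>\<^sub>F t in at 0. \<bar>t\<bar> < \<epsilon>"
    unfolding eventually_at using \<epsilon> by (auto simp: dist_real_def)
  then have ev: "\<forall>\<^sub>F t in at 0. R t = R' t" by eventually_elim (rule eq)
  have "((\<lambda>t. measure (R t) {x \<in> space (R t). L t x = \<infinity>} / t^2) \<longlongrightarrow> 0) (at 0)
      \<longleftrightarrow> ((\<lambda>t. measure (R' t) {x \<in> space (R' t). L t x = \<infinity>} / t^2) \<longlongrightarrow> 0) (at 0)" for L :: "real \<Rightarrow> 'a \<Rightarrow> ennreal"
    by (rule tendsto_cong) (use ev in \<open>eventually_elim, simp\<close>)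
  then show ?thesis
    unfolding L2_differentiable_iff 0 using eq by (simp cong: conj_cong imp_cong)
qed

section \<open>Linear structure of the tangent cone\<close>

lemma tangent_cone_zero:
  assumes "R0 \<in> \<R>"
  shows "(\<lambda>x. 0) \<in> tangent_cone R0 \<R>"
proof -
  have "L2_differentiable 1 (\<lambda>t. R0) (\<lambda>x. 0)"
    unfolding L2_differentiable_iff
    by (intro conjI exI[of _ "\<lambda>t x. 1"]) (simp_all add: L2_def density_quotient_refl)
  then have "L2_curve \<R> R0 1 (\<lambda>t. R0) (\<lambda>x. 0)"
    using assms by (simp add: L2_curve_def)
  then show ?thesis by (auto simp: tangent_cone_def)
qed

text \<open>
  Curves are two-sided, so reparametrising by a negative factor is allowed; a convex tangent cone
  is therefore a linear space.
\<close>

lemma tangent_cone_scale: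
  assumes "g \<in> tangent_cone R0 \<R>"
  shows "(\<lambda>x. a * g x) \<in> tangent_cone R0 \<R>"
proof (cases "a = 0")
  case True
  obtain \<epsilon> R where "L2_curve \<R> R0 \<epsilon> R g" using assms by (auto simp: tangent_cone_def)
  then have "R0 \<in> \<R>" by (auto simp: L2_curve_def dest: spec[of _ 0])
  then show ?thesis using True tangent_cone_zero by simp
next
  case a: False
  obtain \<epsilon> R where "L2_curve \<R> R0 \<epsilon> R g" using assms by (auto simp: tangent_cone_def)
  then have \<epsilon>: "\<epsilon> > 0" and R: "\<And>t. \<bar>t\<bar> < \<epsilon> \<Longrightarrow> R t \<in> \<R>" "R 0 = R0" and diff: "L2_differentiable \<epsilon> R g"
    by (auto simp: L2_curve_def)
  obtain L where g: "g \<in> L2 (R 0)" and dq: "\<And>t. \<bar>t\<bar> < \<epsilon> \<Longrightarrow> density_quotient (R t) (R 0) (L t)"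
    and lim: "((\<lambda>t. (LINT x|R 0. (2 * (sqrt (enn2real (L t x)) - 1) - t * g x)^2) / t^2) \<longlongrightarrow> 0) (at 0)"
    and mass: "((\<lambda>t. measure (R t) {x \<in> space (R t). L t x = \<infinity>} / t^2) \<longlongrightarrow> 0) (at 0)"
    using diff unfolding L2_differentiable_iff by blast
  have small: "\<bar>a * t\<bar> < \<epsilon>" if "\<bar>t\<bar> < \<epsilon> / \<bar>a\<bar>" for t
    using that a by (simp add: abs_mult field_simps)
  have "((\<lambda>t. a * t) \<longlongrightarrow> a * 0) (at 0)" by (intro tendsto_intros)
  then have at0: "filterlim (\<lambda>t. a * t) (at 0) (at 0)"
    using a by (auto simp: filterlim_at eventually_at_filter)
  have resc: "((\<lambda>t. m (a * t) / t^2) \<longlongrightarrow> 0) (at 0)" if "((\<lambda>t. m t / t^2) \<longlongrightarrow> 0) (at 0)" for m :: "real \<Rightarrow> real"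
    using tendsto_mult[OF tendsto_const filterlim_compose[OF that at0], of "a^2"] a
    by (simp add: power_mult_distrib)
  have "L2_differentiable (\<epsilon> / \<bar>a\<bar>) (\<lambda>t. R (a * t)) (\<lambda>x. a * g x)"
    unfolding L2_differentiable_iff
  proof (intro conjI exI allI impI)
    show "(\<lambda>x. a * g x) \<in> L2 (R (a * 0))" using g by (simp add: L2_cmult)
    show "density_quotient (R (a * t)) (R (a * 0)) (L (a * t))" if "\<bar>t\<bar> < \<epsilon> / \<bar>a\<bar>" for t
      using dq[OF small[OF that]] by simp
    show "((\<lambda>t. (LINT x|R (a * 0). (2 * (sqrt (enn2real (L (a * t) x)) - 1) - t * (a * g x))^2) / t^2) \<longlongrightarrow> 0) (at 0)"
      using resc[OF lim] by (simp add: mult.assoc mult.left_commute)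
    show "((\<lambda>t. measure (R (a * t)) {x \<in> space (R (a * t)). L (a * t) x = \<infinity>} / t^2) \<longlongrightarrow> 0) (at 0)"
      using resc[OF mass] by simp
  qed
  then have "L2_curve \<R> R0 (\<epsilon> / \<bar>a\<bar>) (\<lambda>t. R (a * t)) (\<lambda>x. a * g x)"
    using \<epsilon> a R small by (simp add: L2_curve_def)
  then show ?thesis by (auto simp: tangent_cone_def)
qed

text \<open>The sum is the midpoint of 2 g and 2 h.\<close>

lemma tangent_cone_add:
  assumes conv: "convex_fun_set (tangent_cone R0 \<R>)"
    and g: "g \<in> tangent_cone R0 \<R>" and h: "h \<in> tangent_cone R0 \<R>"
  shows "(\<lambda>x. g x + h x) \<in> tangent_cone R0 \<R>"
proof -
  have "(\<lambda>x. 1 / 2 * (2 * g x) + 1 / 2 * (2 * h x)) \<in> tangent_cone R0 \<R>"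
    using conv[unfolded convex_fun_set_def, rule_format,
        OF tangent_cone_scale[OF g, of 2] tangent_cone_scale[OF h, of 2], of "1 / 2" "1 / 2"] by simp
  then show ?thesis by simp
qed

lemma fun_span_tangent_cone:
  assumes conv: "convex_fun_set (tangent_cone R0 \<R>)" and R0: "R0 \<in> \<R>"
  shows "fun_span (tangent_cone R0 \<R>) \<subseteq> tangent_cone R0 \<R>"
proof
  fix h assume "h \<in> fun_span (tangent_cone R0 \<R>)"
  then obtain F c where h: "h = (\<lambda>x. \<Sum>g\<in>F. c g * g x)" and F: "finite F" "F \<subseteq> tangent_cone R0 \<R>"
    by (auto simp: fun_span_def)
  from F show "h \<in> tangent_cone R0 \<R>"
    unfolding h
  proof (induction F rule: finite_induct)
    case empty
    then show ?case using tangent_cone_zero[OF R0] by simp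
  next
    case (insert g F)
    then show ?case
      using tangent_cone_add[OF conv tangent_cone_scale[of g R0 \<R> "c g"]] by simp
  qed
qed

text \<open>The sequences in \<open>F2\<close> come from curves known to pass through P0 and Q0 only
  in the sense of the product; taking marginals recovers the factors.\<close>

lemma pair_measure_eq_imp_factors_eq:
  assumes prob: "prob_space P" "prob_space Q" "prob_space P'" "prob_space Q'"
    and sets: "sets P = sets P'" "sets Q = sets Q'" and eq: "P \<Otimes>\<^sub>M Q = P' \<Otimes>\<^sub>M Q'"
  shows "P = P'" "Q = Q'"
  using distr_cong[OF eq sets(1), of fst fst] distr_cong[OF eq sets(2), of snd snd] prob
  by (simp_all add: prob_space.distr_pair_fst distr_pair_snd)

section \<open>Convergence in L2 under passage to and from marginals\<close>

lemma L2_conv_swap: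
  assumes "prob_space M1" "prob_space M2" and D: "L2_conv (M1 \<Otimes>\<^sub>M M2) D D'"
  shows "L2_conv (M2 \<Otimes>\<^sub>M M1) (\<lambda>n (y, x). D n (x, y)) (\<lambda>(y, x). D' (x, y))"
  unfolding L2_conv_def
proof (intro conjI allI)
  note [simp] = L2_convD(1,2)[OF D] and [measurable] = L2_convD(1,2)[OF D, THEN L2_measurable]
  show "(\<lambda>(y, x). D n (x, y)) \<in> L2 (M2 \<Otimes>\<^sub>M M1)" "(\<lambda>(y, x). D' (x, y)) \<in> L2 (M2 \<Otimes>\<^sub>M M1)" for n
    by (rule L2_swap[OF assms(1,2)]; simp)+
  have "(LINT (y, x)|(M2 \<Otimes>\<^sub>M M1). (D n (x, y) - D' (x, y))^2) = (LINT z|(M1 \<Otimes>\<^sub>M M2). (D n z - D' z)^2)" for n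
    by (rule integral_swap[OF assms(1,2)]) measurable
  then show "(\<lambda>n. LINT z|(M2 \<Otimes>\<^sub>M M1). ((case z of (y, x) \<Rightarrow> D n (x, y)) - (case z of (y, x) \<Rightarrow> D' (x, y)))^2) \<longlonglongrightarrow> 0"
    using L2_convD(3)[OF D] by (simp add: case_prod_beta')
qed

lemma L2_conv_marginal:
  assumes M1: "prob_space M1" and M2: "prob_space M2" and D: "L2_conv (M1 \<Otimes>\<^sub>M M2) D D'"
  shows "L2_conv M1 (\<lambda>n x. LINT y|M2. D n (x, y)) (\<lambda>x. LINT y|M2. D' (x, y))"
  unfolding L2_conv_def
proof (intro conjI allI L2_marginal(2)[OF M1 M2] L2_convD(1,2)[OF D])
  note D1 = L2_convD(1)[OF D] and D2 = L2_convD(2)[OF D]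
  show "(\<lambda>n. LINT x|M1. ((LINT y|M2. D n (x, y)) - (LINT y|M2. D' (x, y)))^2) \<longlonglongrightarrow> 0"
  proof (rule tendsto_sandwich[OF _ _ tendsto_const L2_convD(3)[OF D]]; intro always_eventually allI)
    fix n
    have "(LINT x|M1. ((LINT y|M2. D n (x, y)) - (LINT y|M2. D' (x, y)))^2)
        = (LINT x|M1. (LINT y|M2. D n (x, y) - D' (x, y))^2)"
    proof (rule integral_cong_AE)
      show "(\<lambda>x. ((LINT y|M2. D n (x, y)) - (LINT y|M2. D' (x, y)))^2) \<in> borel_measurable M1"
        by (intro borel_measurable_power borel_measurable_diff L2_measurable[OF L2_marginal(2)[OF M1 M2]] D1 D2)
      show "(\<lambda>x. (LINT y|M2. D n (x, y) - D' (x, y))^2) \<in> borel_measurable M1"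
        by (intro borel_measurable_power L2_measurable[OF L2_marginal(2)[OF M1 M2]] L2_diff D1 D2)
      show "AE x in M1. ((LINT y|M2. D n (x, y)) - (LINT y|M2. D' (x, y)))^2 = (LINT y|M2. D n (x, y) - D' (x, y))^2"
        using L2_marginal(1)[OF M1 M2 D1[of n]] L2_marginal(1)[OF M1 M2 D2] by eventually_elim simp
    qed
    also have "\<dots> \<le> (LINT z|(M1 \<Otimes>\<^sub>M M2). (D n z - D' z)^2)"
      using L2_marginal(3)[OF M1 M2 L2_diff[OF D1 D2]] .
    finally show "(LINT x|M1. ((LINT y|M2. D n (x, y)) - (LINT y|M2. D' (x, y)))^2)
        \<le> (LINT z|(M1 \<Otimes>\<^sub>M M2). (D n z - D' z)^2)" .
  qed simp
qed

lemma L2_conv_fst: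
  assumes M1: "prob_space M1" and M2: "prob_space M2" and F: "L2_conv M1 F F'"
  shows "L2_conv (M1 \<Otimes>\<^sub>M M2) (\<lambda>n z. F n (fst z)) (\<lambda>z. F' (fst z))"
  unfolding L2_conv_def
proof (intro conjI allI L2_fst[OF M1 M2] L2_convD(1,2)[OF F])
  have "(LINT z|(M1 \<Otimes>\<^sub>M M2). (F n (fst z) - F' (fst z))^2) = (LINT x|M1. (F n x - F' x)^2)" for n
    using integral_pair_mult(2)[OF M1 M2 L2_square_integrable[OF L2_diff[OF L2_convD(1,2)[OF F]]], of "\<lambda>_. 1" n]
      prob_space.finite_measure[OF M2] prob_space.prob_space[OF M2]
    by (simp add: finite_measure.integrable_const)
  then show "(\<lambda>n. LINT z|(M1 \<Otimes>\<^sub>M M2). (F n (fst z) - F' (fst z))^2) \<longlonglongrightarrow> 0"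
    using L2_convD(3)[OF F] by simp
qed

lemma L2_conv_snd:
  assumes M1: "prob_space M1" and M2: "prob_space M2" and F: "L2_conv M2 F F'"
  shows "L2_conv (M1 \<Otimes>\<^sub>M M2) (\<lambda>n z. F n (snd z)) (\<lambda>z. F' (snd z))"
  using L2_conv_swap[OF M2 M1 L2_conv_fst[OF M2 M1 F]] by (simp add: case_prod_beta')

text \<open>The hypothesis is the local sequence with direction 0, so the level of the test is an
  instance of the limit theorem for its power.\<close>

lemma local_sequence_const:
  assumes "prob_space M"
  shows "local_sequence M (\<lambda>n. M) (\<lambda>n x. 1) (\<lambda>x. 0)"
  using assms prob_space.prob_space[OF assms]
  by (intro local_sequence.intro local_sequence_axioms.intro)
     (auto simp: L2_const L2_conv_def)

section \<open>Implicit alternatives\<close>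

locale two_sample_problem =
  fixes M1 :: "'a measure" and M2 :: "'b measure"
    and \<P> :: "'a measure set" and \<Q> :: "'b measure set"
    and P0 :: "'a measure" and Q0 :: "'b measure"
    and k :: "('a \<times> 'b) measure \<Rightarrow> real"
    and kt :: "'a \<times> 'b \<Rightarrow> real" and kt1 :: "'a \<Rightarrow> real" and kt2 :: "'b \<Rightarrow> real"
    and n1 n2 :: "nat \<Rightarrow> nat" and d :: real
  assumes P_family: "\<forall>P\<in>\<P>. prob_space P \<and> sets P = sets M1"
    and Q_family: "\<forall>Q\<in>\<Q>. prob_space Q \<and> sets Q = sets M2"
    and P0: "P0 \<in> \<P>" and Q0: "Q0 \<in> \<Q>"
    and gradient: "canonical_gradient k (P0 \<Otimes>\<^sub>M Q0) (product_family \<P> \<Q>) kt"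
    and kt1: "kt1 \<in> L2_centered P0" and kt2: "kt2 \<in> L2_centered Q0"
    and decomposition: "AE \<omega> in P0 \<Otimes>\<^sub>M Q0. kt \<omega> = kt1 (fst \<omega>) + kt2 (snd \<omega>)"
    and nondegenerate: "(LINT \<omega>|(P0 \<Otimes>\<^sub>M Q0). (kt \<omega>)^2) \<noteq> 0"
    and sample_sizes: "\<forall>n. n1 n + n2 n = n"
    and d: "(\<lambda>n. real (n2 n) / real n) \<longlonglongrightarrow> d" "0 < d" "d < 1"
    and convex_cone: "convex_fun_set (tangent_cone (P0 \<Otimes>\<^sub>M Q0) (product_family \<P> \<Q>))"
begin

abbreviation "R0 \<equiv> P0 \<Otimes>\<^sub>M Q0"
abbreviation "tangents \<equiv> tangent_cone R0 (product_family \<P> \<Q>)"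

text \<open>The limiting variance of the test statistic; the critical value is u sqrt V.\<close>

definition V :: real where
  "V = 1 / (1 - d) * (LINT x|P0. (kt1 x)^2) + 1 / d * (LINT y|Q0. (kt2 y)^2)"

lemma P_prob: "P \<in> \<P> \<Longrightarrow> prob_space P \<and> sets P = sets P0"
  and Q_prob: "Q \<in> \<Q> \<Longrightarrow> prob_space Q \<and> sets Q = sets Q0"
  using P_family Q_family P0 Q0 by auto

lemma P0_prob: "prob_space P0" and Q0_prob: "prob_space Q0"
  using P_prob[OF P0] Q_prob[OF Q0] by auto

lemma R0_in_family: "R0 \<in> product_family \<P> \<Q>"
  using P0 Q0 by (auto simp: product_family_def)

lemma kt1_L2: "kt1 \<in> L2 P0" "(LINT x|P0. kt1 x) = 0" and kt2_L2: "kt2 \<in> L2 Q0" "(LINT y|Q0. kt2 y) = 0"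
  using kt1 kt2 by (auto simp: L2_centered_def)

lemma kt_L2: "kt \<in> L2 R0"
  using gradient by (simp add: canonical_gradient_def is_gradient_def L2_centered_def)

text \<open>Since kt is additive in the two coordinates, only the marginals of g enter the
  derivative of k. The limiting mean of the test statistic has the same form.\<close>

lemma integral_kt_mult:
  assumes g: "g \<in> L2 R0"
  shows "(LINT z|R0. kt z * g z) = (LINT x|P0. kt1 x * (LINT y|Q0. g (x, y))) + (LINT y|Q0. kt2 y * (LINT x|P0. g (x, y)))"
proof -
  note [measurable] = L2_measurable[OF g] L2_measurable[OF kt_L2] L2_measurable[OF kt1_L2(1)] L2_measurable[OF kt2_L2(1)]
  have i: "integrable R0 (\<lambda>z. kt1 (fst z) * g z)" "integrable R0 (\<lambda>z. kt2 (snd z) * g z)"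
    by (intro L2_mult_integrable L2_fst L2_snd P0_prob Q0_prob g kt1_L2 kt2_L2)+
  have "(LINT z|R0. kt z * g z) = (LINT z|R0. kt1 (fst z) * g z + kt2 (snd z) * g z)"
    by (rule integral_cong_AE) (use decomposition in \<open>auto simp: distrib_right elim!: eventually_mono\<close>)
  also have "\<dots> = (LINT z|R0. kt1 (fst z) * g z) + (LINT z|R0. kt2 (snd z) * g z)"
    using i by simp
  finally show ?thesis
    unfolding integral_fst_mult_marginal[OF P0_prob Q0_prob g kt1_L2(1)]
      integral_snd_mult_marginal[OF P0_prob Q0_prob g kt2_L2(1)] .
qed

lemma V_pos: "0 < V"
proof (rule ccontr)
  let ?A = "LINT x|P0. (kt1 x)^2" and ?B = "LINT y|Q0. (kt2 y)^2"
  assume "\<not> 0 < V"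
  moreover have "0 \<le> 1 / (1 - d) * ?A" "0 \<le> 1 / d * ?B" using d by auto
  ultimately have "1 / (1 - d) * ?A = 0" "1 / d * ?B = 0" unfolding V_def by linarith+
  then have "?A = 0" "?B = 0" using d by auto
  then have ae: "AE x in P0. (kt1 x)^2 = 0" "AE y in Q0. (kt2 y)^2 = 0"
    using integral_nonneg_eq_0_iff_AE[OF L2_square_integrable[OF kt1_L2(1)]]
      integral_nonneg_eq_0_iff_AE[OF L2_square_integrable[OF kt2_L2(1)]] by auto
  have "AE z in R0. (kt z)^2 = 0"
    using decomposition AE_pair_fst[OF Q0_prob ae(1)] AE_pair_snd[OF P0_prob Q0_prob ae(2)]
    by eventually_elim simp
  then have "(LINT z|R0. (kt z)^2) = 0" by (rule integral_eq_zero_AE)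
  then show False using nondegenerate by simp
qed

lemma product_curve:
  assumes "g \<in> tangents"
  obtains \<epsilon> P Q where "\<epsilon> > 0" "P 0 = P0" "Q 0 = Q0" "\<And>t. \<bar>t\<bar> < \<epsilon> \<Longrightarrow> P t \<in> \<P>" "\<And>t. \<bar>t\<bar> < \<epsilon> \<Longrightarrow> Q t \<in> \<Q>"
    "L2_differentiable \<epsilon> (\<lambda>t. P t \<Otimes>\<^sub>M Q t) g"
proof -
  obtain \<epsilon> R where "L2_curve (product_family \<P> \<Q>) R0 \<epsilon> R g" using assms by (auto simp: tangent_cone_def)
  then have \<epsilon>: "\<epsilon> > 0" and R: "\<And>t. \<bar>t\<bar> < \<epsilon> \<Longrightarrow> R t \<in> product_family \<P> \<Q>" "R 0 = R0" and diff: "L2_differentiable \<epsilon> R g"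
    by (auto simp: L2_curve_def)
  \<comment> \<open>The factors are obtained by choice for each t; prescribing them at t = 0 makes
    the factor curves start at P0 and Q0.\<close>
  have "\<exists>P Q. \<bar>t\<bar> < \<epsilon> \<longrightarrow> P \<in> \<P> \<and> Q \<in> \<Q> \<and> R t = P \<Otimes>\<^sub>M Q \<and> (t = 0 \<longrightarrow> P = P0 \<and> Q = Q0)" for t
  proof (cases "t = 0")
    case True
    then show ?thesis using R(2) P0 Q0 by blast
  next
    case False
    then show ?thesis using R(1)[of t] by (auto simp: product_family_def)
  qed
  then obtain P Q where PQ: "\<And>t. \<bar>t\<bar> < \<epsilon> \<longrightarrow> P t \<in> \<P> \<and> Q t \<in> \<Q> \<and> R t = P t \<Otimes>\<^sub>M Q t \<and> (t = 0 \<longrightarrow> P t = P0 \<and> Q t = Q0)"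
    by metis
  have "L2_differentiable \<epsilon> (\<lambda>t. P t \<Otimes>\<^sub>M Q t) g"
    using diff L2_differentiable_cong[OF \<epsilon>, of R "\<lambda>t. P t \<Otimes>\<^sub>M Q t"] PQ by auto
  then show thesis using that[of \<epsilon> P Q] PQ \<epsilon> by auto
qed

context
  fixes \<epsilon> :: real and P :: "real \<Rightarrow> 'a measure" and Q :: "real \<Rightarrow> 'b measure" and g :: "'a \<times> 'b \<Rightarrow> real"
  assumes \<epsilon>: "\<epsilon> > 0" and start: "P 0 = P0" "Q 0 = Q0"
    and P_in: "\<And>t. \<bar>t\<bar> < \<epsilon> \<Longrightarrow> P t \<in> \<P>" and Q_in: "\<And>t. \<bar>t\<bar> < \<epsilon> \<Longrightarrow> Q t \<in> \<Q>"
    and diff: "L2_differentiable \<epsilon> (\<lambda>t. P t \<Otimes>\<^sub>M Q t) g"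
begin

lemma P_curve: "\<bar>t\<bar> < \<epsilon> \<Longrightarrow> prob_space (P t) \<and> sets (P t) = sets (P 0)"
  and Q_curve: "\<bar>t\<bar> < \<epsilon> \<Longrightarrow> prob_space (Q t) \<and> sets (Q t) = sets (Q 0)"
  using P_prob[OF P_in] Q_prob[OF Q_in] by (auto simp: start)

lemma tangent_L2: "g \<in> L2 R0"
  using diff by (simp add: L2_differentiable_def start)

lemma P_diff: "L2_differentiable \<epsilon> P (\<lambda>x. LINT y|Q0. g (x, y))"
  using L2_differentiable_marginals(1)[OF \<epsilon> P_curve Q_curve diff] by (simp add: start)

lemma Q_diff: "L2_differentiable \<epsilon> Q (\<lambda>y. LINT x|P0. g (x, y))"
  using L2_differentiable_marginals(2)[OF \<epsilon> P_curve Q_curve diff] by (simp add: start)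

lemma local_sequences:
  assumes t: "\<And>n. \<bar>t n\<bar> < \<epsilon>" "t \<longlonglongrightarrow> 0" "(\<lambda>n. t n * sqrt (real n)) \<longlonglongrightarrow> s" "s \<noteq> 0"
  obtains f1 f2 where "local_sequence P0 (\<lambda>n. P (t n)) f1 (\<lambda>x. s * (LINT y|Q0. g (x, y)))"
    "local_sequence Q0 (\<lambda>n. Q (t n)) f2 (\<lambda>y. s * (LINT x|P0. g (x, y)))"
  using local_sequence_of_curve[OF P_curve P_diff t] local_sequence_of_curve[OF Q_curve Q_diff t]
  unfolding start by blast

text \<open>The gradient describes a limit from the right; s > 0 makes t n positive
  eventually.\<close>

lemma tendsto_functional:
  assumes t: "t \<longlonglongrightarrow> 0" "(\<lambda>n. t n * sqrt (real n)) \<longlonglongrightarrow> s" "s > 0"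
  shows "(\<lambda>n. sqrt (real n) * (k (P (t n) \<Otimes>\<^sub>M Q (t n)) - k R0)) \<longlonglongrightarrow> s * (LINT z|R0. kt z * g z)"
proof -
  have curve: "L2_curve (product_family \<P> \<Q>) R0 \<epsilon> (\<lambda>t. P t \<Otimes>\<^sub>M Q t) g"
    using \<epsilon> start P_in Q_in diff by (auto simp: L2_curve_def product_family_def)
  then have lim: "((\<lambda>t. (k (P t \<Otimes>\<^sub>M Q t) - k R0) / t) \<longlongrightarrow> (LINT z|R0. kt z * g z)) (at_right 0)"
    using gradient unfolding canonical_gradient_def is_gradient_def by blast
  have pos: "\<forall>\<^sub>F n in sequentially. t n > 0"
    using order_tendstoD(1)[OF t(2,3)] by eventually_elim (auto simp: zero_less_mult_iff)
  then have "filterlim t (at_right 0) sequentially"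
    using t(1) by (auto simp: filterlim_at elim: eventually_mono)
  from tendsto_mult[OF t(2) filterlim_compose[OF lim this]]
  show ?thesis
    by (rule Lim_transform_eventually) (use pos in \<open>eventually_elim, simp\<close>)
qed

end

lemma fst_marginal_in_cone:
  assumes "g \<in> tangents"
  shows "(\<lambda>z. LINT y|Q0. g (fst z, y)) \<in> tangents"
proof -
  obtain \<epsilon> P Q where *: "\<epsilon> > 0" "P 0 = P0" "Q 0 = Q0" "\<And>t. \<bar>t\<bar> < \<epsilon> \<Longrightarrow> P t \<in> \<P>" "\<And>t. \<bar>t\<bar> < \<epsilon> \<Longrightarrow> Q t \<in> \<Q>"
    "L2_differentiable \<epsilon> (\<lambda>t. P t \<Otimes>\<^sub>M Q t) g"
    by (rule product_curve[OF assms]) blast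
  have "L2_differentiable \<epsilon> (\<lambda>t. P t \<Otimes>\<^sub>M Q0) (\<lambda>z. LINT y|Q0. g (fst z, y))"
    by (rule L2_differentiable_fst[OF *(1) P_curve[OF *] Q0_prob P_diff[OF *]])
  then have "L2_curve (product_family \<P> \<Q>) R0 \<epsilon> (\<lambda>t. P t \<Otimes>\<^sub>M Q0) (\<lambda>z. LINT y|Q0. g (fst z, y))"
    using * Q0 by (auto simp: L2_curve_def product_family_def)
  then show ?thesis by (auto simp: tangent_cone_def)
qed

lemma snd_marginal_in_cone:
  assumes "g \<in> tangents"
  shows "(\<lambda>z. LINT x|P0. g (x, snd z)) \<in> tangents"
proof -
  obtain \<epsilon> P Q where *: "\<epsilon> > 0" "P 0 = P0" "Q 0 = Q0" "\<And>t. \<bar>t\<bar> < \<epsilon> \<Longrightarrow> P t \<in> \<P>" "\<And>t. \<bar>t\<bar> < \<epsilon> \<Longrightarrow> Q t \<in> \<Q>"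
    "L2_differentiable \<epsilon> (\<lambda>t. P t \<Otimes>\<^sub>M Q t) g"
    by (rule product_curve[OF assms]) blast
  have "L2_differentiable \<epsilon> (\<lambda>t. P0 \<Otimes>\<^sub>M Q t) (\<lambda>z. LINT x|P0. g (x, snd z))"
    by (rule L2_differentiable_snd[OF *(1) Q_curve[OF *] P0_prob Q_diff[OF *]])
  then have "L2_curve (product_family \<P> \<Q>) R0 \<epsilon> (\<lambda>t. P0 \<Otimes>\<^sub>M Q t) (\<lambda>z. LINT x|P0. g (x, snd z))"
    using * P0 by (auto simp: L2_curve_def product_family_def)
  then show ?thesis by (auto simp: tangent_cone_def)
qed

text \<open>The mean of the limit law is s <kt, g>, which is the limit of sqrt n times the increment
  of k and hence equals \<theta>. So the limiting power depends on the alternative through \<theta>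
  alone.\<close>

lemma tendsto_power_alternative:
  assumes S: "S \<in> implicit_alternatives k \<P> \<Q> P0 Q0 \<theta>"
    and T: "\<And>n \<omega>. T n \<omega> = sqrt (real n) / real (n1 n) * (\<Sum>i<n1 n. kt1 (fst \<omega> i))
        + sqrt (real n) / real (n2 n) * (\<Sum>j<n2 n. kt2 (snd \<omega> j))"
    and \<psi>: "\<And>n \<omega>. \<psi> n \<omega> = (if T n \<omega> > u * sqrt V then 1 else 0)"
  shows "power_seq n1 n2 \<psi> S \<longlonglongrightarrow> 1 - \<Phi> (u - \<theta> / sqrt V)"
proof -
  from S have "S \<in> F2 \<P> \<Q> P0 Q0"
    and lim\<theta>: "(\<lambda>n. (k (fst (S n) \<Otimes>\<^sub>M snd (S n)) - k R0) / real n powr (-1/2)) \<longlonglongrightarrow> \<theta>"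
    by (auto simp: implicit_alternatives_def K1_def)
  then obtain t \<epsilon> P Q g s where t: "t \<longlonglongrightarrow> 0" "(\<lambda>n. t n * sqrt (real n)) \<longlonglongrightarrow> s" "s > 0"
    and PQ: "\<And>t. \<bar>t\<bar> < \<epsilon> \<Longrightarrow> P t \<in> \<P>" "\<And>t. \<bar>t\<bar> < \<epsilon> \<Longrightarrow> Q t \<in> \<Q>"
    and curve: "L2_curve (product_family \<P> \<Q>) R0 \<epsilon> (\<lambda>s. P s \<Otimes>\<^sub>M Q s) g"
    and tn: "\<And>n. \<bar>t n\<bar> < \<epsilon>" and S_eq: "\<And>n. S n = (P (t n), Q (t n))"
    unfolding F2_def by blast
  have \<epsilon>: "\<epsilon> > 0" and diff: "L2_differentiable \<epsilon> (\<lambda>s. P s \<Otimes>\<^sub>M Q s) g" and R: "P 0 \<Otimes>\<^sub>M Q 0 = R0"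
    using curve by (auto simp: L2_curve_def)
  have start: "P 0 = P0" "Q 0 = Q0"
    using pair_measure_eq_imp_factors_eq[of "P 0" "Q 0" P0 Q0] P_prob[OF PQ(1)[of 0]] Q_prob[OF PQ(2)[of 0]]
      P0_prob Q0_prob R \<epsilon> by auto
  note c = \<epsilon> start PQ diff
  obtain f1 f2 where ls: "local_sequence P0 (\<lambda>n. P (t n)) f1 (\<lambda>x. s * (LINT y|Q0. g (x, y)))"
    "local_sequence Q0 (\<lambda>n. Q (t n)) f2 (\<lambda>y. s * (LINT x|P0. g (x, y)))"
    using local_sequences[OF c tn t(1,2)] t(3) by auto
  have "(\<lambda>n. sqrt (real n) * (k (P (t n) \<Otimes>\<^sub>M Q (t n)) - k R0)) \<longlonglongrightarrow> \<theta>"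
    using lim\<theta> unfolding S_eq
    by (rule Lim_transform_eventually)
       (use eventually_gt_at_top[of 0] in \<open>eventually_elim, simp add: powr_minus_divide powr_half_sqrt\<close>)
  then have \<theta>: "s * (LINT z|R0. kt z * g z) = \<theta>"
    using tendsto_functional[OF c t] by (rule LIMSEQ_unique[rotated])
  have "(LINT x|P0. kt1 x * (s * (LINT y|Q0. g (x, y)))) + (LINT y|Q0. kt2 y * (s * (LINT x|P0. g (x, y)))) = \<theta>"
  proof -
    have "(LINT z|R0. kt z * g z) = (LINT x|P0. kt1 x * (LINT y|Q0. g (x, y))) + (LINT y|Q0. kt2 y * (LINT x|P0. g (x, y)))"
      by (rule integral_kt_mult[OF tangent_L2[OF c]])
    then show ?thesis
      using \<theta> by (simp add: mult.left_commute distrib_left)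
  qed
  then show ?thesis
    using tendsto_power_two_sample_test[OF ls kt1 kt2 _ d V_def V_pos T, of u] sample_sizes
    by (simp add: power_seq_def[abs_def] S_eq \<psi>[abs_def])
qed

lemma similar_test:
  assumes T: "\<And>n \<omega>. T n \<omega> = sqrt (real n) / real (n1 n) * (\<Sum>i<n1 n. kt1 (fst \<omega> i))
        + sqrt (real n) / real (n2 n) * (\<Sum>j<n2 n. kt2 (snd \<omega> j))"
    and \<psi>: "\<And>n \<omega>. \<psi> n \<omega> = (if T n \<omega> > u * sqrt V then 1 else 0)"
    and u: "\<Phi> u = 1 - \<alpha>"
  shows "\<psi> \<in> similar_tests n1 n2 P0 Q0 \<alpha>"
  unfolding similar_tests_def
proof (intro CollectI conjI allI)
  fix n
  have [measurable]: "T n \<in> borel_measurable (two_sample (n1 n) (n2 n) P0 Q0)"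
    unfolding T[abs_def]
    by (intro borel_measurable_add borel_measurable_sum borel_measurable_times borel_measurable_const
        measurable_two_sample_fst[OF L2_measurable[OF kt1_L2(1)]] measurable_two_sample_snd[OF L2_measurable[OF kt2_L2(1)]]) auto
  show "is_test (two_sample (n1 n) (n2 n) P0 Q0) (\<psi> n)"
    unfolding is_test_def
  proof
    show "\<psi> n \<in> borel_measurable (two_sample (n1 n) (n2 n) P0 Q0)"
      unfolding \<psi>[abs_def] by measurable
  qed (simp add: \<psi>)
next
  show "(\<lambda>n. LINT \<omega>|two_sample (n1 n) (n2 n) P0 Q0. \<psi> n \<omega>) \<longlonglongrightarrow> \<alpha>"
    using tendsto_power_two_sample_test[OF local_sequence_const[OF P0_prob] local_sequence_const[OF Q0_prob]
        kt1 kt2 _ d V_def V_pos T, of u] sample_sizes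
    by (simp add: \<psi>[abs_def] u)
qed

text \<open>The scale s = \<theta> / <kt, g> is forced by the implicit parameter, and \<sigma> is
  the limiting standard deviation of the log-likelihood ratio in the direction s g.\<close>

lemma alternative_of_tangent:
  assumes g: "g \<in> tangents" and pos: "0 < (LINT z|R0. kt z * g z)" and \<theta>: "\<theta> > 0"
    and \<phi>: "\<phi> \<in> similar_tests n1 n2 P0 Q0 \<alpha>" and u: "\<Phi> u = 1 - \<alpha>"
  defines "\<sigma> \<equiv> \<theta> / (LINT z|R0. kt z * g z) *
    sqrt ((1 - d) * (LINT x|P0. (LINT y|Q0. g (x, y))^2) + d * (LINT y|Q0. (LINT x|P0. g (x, y))^2))"
  shows "\<exists>S\<in>implicit_alternatives k \<P> \<Q> P0 Q0 \<theta>.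
    limsup (\<lambda>n. ereal (power_seq n1 n2 \<phi> S n)) \<le> ereal (1 - \<Phi> (u - \<sigma>))"
proof -
  obtain \<epsilon> P Q where c: "\<epsilon> > 0" "P 0 = P0" "Q 0 = Q0" "\<And>t. \<bar>t\<bar> < \<epsilon> \<Longrightarrow> P t \<in> \<P>" "\<And>t. \<bar>t\<bar> < \<epsilon> \<Longrightarrow> Q t \<in> \<Q>"
    "L2_differentiable \<epsilon> (\<lambda>t. P t \<Otimes>\<^sub>M Q t) g"
    by (rule product_curve[OF g]) blast
  note gL2 = tangent_L2[OF c]
  define g1 where "g1 x = (LINT y|Q0. g (x, y))" for x
  define g2 where "g2 y = (LINT x|P0. g (x, y))" for y
  define s where "s = \<theta> / (LINT z|R0. kt z * g z)"
  have s: "s > 0" "s * (LINT z|R0. kt z * g z) = \<theta>" using \<theta> pos by (auto simp: s_def)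
  \<comment> \<open>\<open>F2\<close> demands that every t n lie in the domain of the curve. The
    default 0 affects finitely many n; at n = 0 the quotient itself is 0.\<close>
  define t where "t n = (if s / sqrt (real n) < \<epsilon> then s / sqrt (real n) else 0)" for n :: nat
  have tn: "\<bar>t n\<bar> < \<epsilon>" for n using c(1) s(1) by (auto simp: t_def)
  have lim0: "(\<lambda>n. s / sqrt (real n)) \<longlonglongrightarrow> 0" by real_asymp
  then have "\<forall>\<^sub>F n in sequentially. s / sqrt (real n) < \<epsilon>" using c(1) by (rule order_tendstoD(2))
  then have t_eq: "\<forall>\<^sub>F n in sequentially. t n = s / sqrt (real n)" by eventually_elim (simp add: t_def)
  have t0: "t \<longlonglongrightarrow> 0"
    by (rule Lim_transform_eventually[OF lim0]) (use t_eq in \<open>eventually_elim, simp\<close>)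
  have ts: "(\<lambda>n. t n * sqrt (real n)) \<longlonglongrightarrow> s"
    by (rule Lim_transform_eventually[OF tendsto_const])
       (use t_eq eventually_gt_at_top[of 0] in \<open>eventually_elim, simp\<close>)
  define S where "S n = (P (t n), Q (t n))" for n
  have lim: "(\<lambda>n. sqrt (real n) * (k (P (t n) \<Otimes>\<^sub>M Q (t n)) - k R0)) \<longlonglongrightarrow> \<theta>"
    using tendsto_functional[OF c t0 ts s(1)] s(2) by simp
  have "L2_curve (product_family \<P> \<Q>) R0 \<epsilon> (\<lambda>s. P s \<Otimes>\<^sub>M Q s) g"
    using c by (auto simp: L2_curve_def product_family_def)
  then have "S \<in> F2 \<P> \<Q> P0 Q0"
    unfolding F2_def using t0 ts s(1) c(4,5) tn S_def by blast
  then have "S \<in> K1 k \<P> \<Q> P0 Q0"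
    using lim \<theta> by (auto simp: K1_def S_def)
  moreover have "(\<lambda>n. (k (fst (S n) \<Otimes>\<^sub>M snd (S n)) - k R0) / real n powr (-1/2)) \<longlonglongrightarrow> \<theta>"
    using lim
    by (rule Lim_transform_eventually)
       (use eventually_gt_at_top[of 0] in \<open>eventually_elim, simp add: S_def powr_minus_divide powr_half_sqrt\<close>)
  ultimately have S_in: "S \<in> implicit_alternatives k \<P> \<Q> P0 Q0 \<theta>" by (simp add: implicit_alternatives_def)
  obtain f1 f2 where ls: "local_sequence P0 (\<lambda>n. P (t n)) f1 (\<lambda>x. s * g1 x)"
    "local_sequence Q0 (\<lambda>n. Q (t n)) f2 (\<lambda>y. s * g2 y)"
    using local_sequences[OF c tn t0 ts] s(1) unfolding g1_def g2_def by auto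
  let ?W = "(1 - d) * (LINT x|P0. (g1 x)^2) + d * (LINT y|Q0. (g2 y)^2)"
  have nn: "0 \<le> (1 - d) * (LINT x|P0. (g1 x)^2)" "0 \<le> d * (LINT y|Q0. (g2 y)^2)" using d by auto
  have g12: "g1 \<in> L2 P0" "g2 \<in> L2 Q0"
    using L2_marginal(2)[OF P0_prob Q0_prob gL2] L2_marginal(2)[OF Q0_prob P0_prob L2_swap[OF P0_prob Q0_prob gL2]]
    by (simp_all add: g1_def[abs_def] g2_def[abs_def])
  \<comment> \<open>If both marginals vanished, so would <kt, g>, against its positivity. The
    limiting log-likelihood ratio is therefore nondegenerate.\<close>
  have "?W \<noteq> 0"
  proof
    assume "?W = 0"
    then have "(1 - d) * (LINT x|P0. (g1 x)^2) = 0" "d * (LINT y|Q0. (g2 y)^2) = 0" using nn by linarith+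
    then have "(LINT x|P0. (g1 x)^2) = 0" "(LINT y|Q0. (g2 y)^2) = 0" using d by auto
    then have "(LINT x|P0. kt1 x * g1 x) = 0" "(LINT y|Q0. kt2 y * g2 y) = 0"
      using L2_Cauchy_Schwarz[OF kt1_L2(1) g12(1)] L2_Cauchy_Schwarz[OF kt2_L2(1) g12(2)] by auto
    then show False
      using pos integral_kt_mult[OF gL2] by (simp add: g1_def g2_def)
  qed
  then have W: "?W > 0" using nn by linarith
  have \<sigma>: "\<sigma> = s * sqrt ?W" by (simp add: \<sigma>_def s_def g1_def g2_def)
  have "\<sigma>^2 = (1 - d) * (LINT x|P0. (s * g1 x)^2) + d * (LINT y|Q0. (s * g2 y)^2)"
    using W by (simp add: \<sigma> power_mult_distrib distrib_left mult.left_commute)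
  moreover have "\<sigma> > 0" using s(1) W by (simp add: \<sigma>)
  ultimately have "limsup (\<lambda>n. ereal (power_seq n1 n2 \<phi> S n)) \<le> ereal (1 - \<Phi> (u - \<sigma>))"
    using limsup_power_le[OF ls _ d(1) _ _ \<phi> u, of \<sigma>] sample_sizes
    by (simp add: power_seq_def S_def)
  with S_in show ?thesis by blast
qed

text \<open>
  The least favourable direction \<open>kt1 / (1 - d) + kt2 / d\<close> need not be a tangent itself; it is
  approximated by elements of the cone.
\<close>

lemma least_favourable_sequence:
  obtains g where "\<And>m. g m \<in> tangents"
    "L2_conv R0 g (\<lambda>z. 1 / (1 - d) * kt1 (fst z) + 1 / d * kt2 (snd z))"
proof -
  have "\<exists>h\<in>tangents. L2_norm R0 (\<lambda>z. kt z - h z) < 1 / real (Suc m)" for m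
  proof -
    have "kt \<in> tangent_space R0 (product_family \<P> \<Q>)" using gradient by (simp add: canonical_gradient_def)
    then have "\<exists>h\<in>fun_span tangents. L2_norm R0 (\<lambda>z. kt z - h z) < 1 / real (Suc m)"
      unfolding tangent_space_def by auto
    then show ?thesis using fun_span_tangent_cone[OF convex_cone R0_in_family] by blast
  qed
  then obtain h where h: "\<And>m. h m \<in> tangents" and h_lim: "\<And>m. L2_norm R0 (\<lambda>z. kt z - h m z) < 1 / real (Suc m)"
    by metis
  have h_L2: "h m \<in> L2 R0" for m
    using product_curve[OF h[of m]] tangent_L2 by metis
  \<comment> \<open>An everywhere additive version of kt, whose marginals are kt1 and kt2 at every
    point and not merely almost everywhere.\<close>
  define kk where "kk z = kt1 (fst z) + kt2 (snd z)" for z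
  have kk: "kk \<in> L2 R0"
    unfolding kk_def[abs_def] by (intro L2_add L2_fst L2_snd P0_prob Q0_prob kt1_L2 kt2_L2)
  have h_conv: "L2_conv R0 h kk"
    unfolding L2_conv_def
  proof (intro conjI allI h_L2 kk)
    have eq: "(LINT z|R0. (h m z - kk z)^2) = (L2_norm R0 (\<lambda>z. kt z - h m z))^2" for m
    proof -
      have "(LINT z|R0. (h m z - kk z)^2) = (LINT z|R0. (kt z - h m z)^2)"
      proof (rule integral_cong_AE)
        show "AE z in R0. (h m z - kk z)^2 = (kt z - h m z)^2"
          using decomposition by eventually_elim (simp add: kk_def power2_commute)
      qed (intro borel_measurable_power borel_measurable_diff L2_measurable h_L2 kk kt_L2)+
      then show ?thesis by (simp add: L2_norm_def)
    qed
    have lim: "(\<lambda>m. (1 / real (Suc m))^2) \<longlonglongrightarrow> 0" by real_asymp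
    show "(\<lambda>m. LINT z|R0. (h m z - kk z)^2) \<longlonglongrightarrow> 0"
      unfolding eq
    proof (rule tendsto_sandwich[OF _ _ tendsto_const lim]; intro always_eventually allI)
      fix m
      show "(L2_norm R0 (\<lambda>z. kt z - h m z))^2 \<le> (1 / real (Suc m))^2"
        using h_lim[of m] by (intro power_mono) (auto simp: L2_norm_def)
    qed simp
  qed
  have m1: "(LINT y|Q0. kk (x, y)) = kt1 x" for x
    using kt2_L2 L2_integrable[OF Q0_prob kt2_L2(1)] prob_space.finite_measure[OF Q0_prob] prob_space.prob_space[OF Q0_prob]
    by (simp add: kk_def finite_measure.integrable_const)
  have m2: "(LINT x|P0. kk (x, y)) = kt2 y" for y
    using kt1_L2 L2_integrable[OF P0_prob kt1_L2(1)] prob_space.finite_measure[OF P0_prob] prob_space.prob_space[OF P0_prob]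
    by (simp add: kk_def finite_measure.integrable_const)
  have h1: "L2_conv P0 (\<lambda>m x. LINT y|Q0. h m (x, y)) kt1"
    using L2_conv_marginal[OF P0_prob Q0_prob h_conv] by (simp add: m1)
  have h2: "L2_conv Q0 (\<lambda>m y. LINT x|P0. h m (x, y)) kt2"
    using L2_conv_marginal[OF Q0_prob P0_prob L2_conv_swap[OF P0_prob Q0_prob h_conv]] by (simp add: m2)
  show thesis
  proof (rule that)
    show "(\<lambda>z. 1 / (1 - d) * (LINT y|Q0. h m (fst z, y)) + 1 / d * (LINT x|P0. h m (x, snd z))) \<in> tangents" for m
      by (intro tangent_cone_add[OF convex_cone] tangent_cone_scale fst_marginal_in_cone snd_marginal_in_cone h)
    show "L2_conv R0 (\<lambda>m z. 1 / (1 - d) * (LINT y|Q0. h m (fst z, y)) + 1 / d * (LINT x|P0. h m (x, snd z)))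
        (\<lambda>z. 1 / (1 - d) * kt1 (fst z) + 1 / d * kt2 (snd z))"
      by (intro L2_conv_add L2_conv_cmult L2_conv_fst[OF P0_prob Q0_prob h1] L2_conv_snd[OF P0_prob Q0_prob h2])
  qed
qed

text \<open>For g = kt1 / (1 - d) + kt2 / d both <kt, g> and the weighted squared norm (1 - d)
  |g1|^2 + d |g2|^2 equal V. Along tangents approximating it \<sigma> thus tends to \<theta> / V *
  sqrt V, and continuity of \<Phi> carries the bounds to the limit.\<close>

lemma maximin_upper_bound:
  assumes \<theta>: "\<theta> > 0" and \<phi>: "\<phi> \<in> similar_tests n1 n2 P0 Q0 \<alpha>" and u: "\<Phi> u = 1 - \<alpha>"
  shows "(INF S\<in>implicit_alternatives k \<P> \<Q> P0 Q0 \<theta>. limsup (\<lambda>n. ereal (power_seq n1 n2 \<phi> S n)))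
      \<le> ereal (1 - \<Phi> (u - \<theta> / sqrt V))" (is "?I \<le> _")
    and "implicit_alternatives k \<P> \<Q> P0 Q0 \<theta> \<noteq> {}"
proof -
  define g' where "g' z = 1 / (1 - d) * kt1 (fst z) + 1 / d * kt2 (snd z)" for z
  obtain g where g: "\<And>m. g m \<in> tangents" and conv: "L2_conv R0 g g'"
    using least_favourable_sequence unfolding g'_def by blast
  have m1: "(LINT y|Q0. g' (x, y)) = 1 / (1 - d) * kt1 x" for x
    using kt2_L2 L2_integrable[OF Q0_prob kt2_L2(1)] prob_space.finite_measure[OF Q0_prob] prob_space.prob_space[OF Q0_prob]
    by (simp add: g'_def finite_measure.integrable_const)
  have m2: "(LINT x|P0. g' (x, y)) = 1 / d * kt2 y" for y
    using kt1_L2 L2_integrable[OF P0_prob kt1_L2(1)] prob_space.finite_measure[OF P0_prob] prob_space.prob_space[OF P0_prob]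
    by (simp add: g'_def finite_measure.integrable_const)
  have g1: "L2_conv P0 (\<lambda>m x. LINT y|Q0. g m (x, y)) (\<lambda>x. 1 / (1 - d) * kt1 x)"
    using L2_conv_marginal[OF P0_prob Q0_prob conv] by (simp add: m1)
  have g2: "L2_conv Q0 (\<lambda>m y. LINT x|P0. g m (x, y)) (\<lambda>y. 1 / d * kt2 y)"
    using L2_conv_marginal[OF Q0_prob P0_prob L2_conv_swap[OF P0_prob Q0_prob conv]] by (simp add: m2)
  define W where "W m = (1 - d) * (LINT x|P0. (LINT y|Q0. g m (x, y))^2) + d * (LINT y|Q0. (LINT x|P0. g m (x, y))^2)" for m
  define q where "q m = (LINT z|R0. kt z * g m z)" for m
  have "q \<longlonglongrightarrow> (LINT z|R0. kt z * g' z)"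
    unfolding q_def[abs_def] by (rule L2_conv_inner[OF L2_conv_const[OF kt_L2] conv])
  also have "(LINT z|R0. kt z * g' z) = V"
    unfolding integral_kt_mult[OF L2_convD(2)[OF conv]] m1 m2
    by (simp add: V_def power2_eq_square mult.left_commute)
  finally have q: "q \<longlonglongrightarrow> V" .
  have "W \<longlonglongrightarrow> (1 - d) * (LINT x|P0. (1 / (1 - d) * kt1 x)^2) + d * (LINT y|Q0. (1 / d * kt2 y)^2)"
    unfolding W_def[abs_def] by (intro tendsto_intros L2_conv_norm g1 g2)
  also have "(1 - d) * (LINT x|P0. (1 / (1 - d) * kt1 x)^2) + d * (LINT y|Q0. (1 / d * kt2 y)^2) = V"
  proof -
    have "e * (1 / e)^2 = 1 / e" if "e \<noteq> 0" for e :: real using that by (simp add: power2_eq_square)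
    from this[of "1 - d"] this[of d] show ?thesis
      using d unfolding V_def power_mult_distrib Bochner_Integration.integral_mult_right_zero
      by (simp only: mult.assoc[symmetric])
  qed
  finally have W: "W \<longlonglongrightarrow> V" .
  define \<sigma> where "\<sigma> m = \<theta> / q m * sqrt (W m)" for m
  have "\<sigma> \<longlonglongrightarrow> \<theta> / V * sqrt V"
    unfolding \<sigma>_def[abs_def] using V_pos by (intro tendsto_intros q W) auto
  also have "\<theta> / V * sqrt V = \<theta> / sqrt V"
    using V_pos by (simp add: field_simps)
  finally have \<sigma>: "\<sigma> \<longlonglongrightarrow> \<theta> / sqrt V" .
  have ev: "\<forall>\<^sub>F m in sequentially. 0 < q m" using q V_pos by (rule order_tendstoD(1))
  have alt: "\<exists>S\<in>implicit_alternatives k \<P> \<Q> P0 Q0 \<theta>.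
      limsup (\<lambda>n. ereal (power_seq n1 n2 \<phi> S n)) \<le> ereal (1 - \<Phi> (u - \<sigma> m))"
    if "0 < q m" for m
    using alternative_of_tangent[OF g that[unfolded q_def] \<theta> \<phi> u] by (simp add: \<sigma>_def q_def W_def)
  have "\<exists>m. 0 < q m" using ev by (auto simp: eventually_sequentially)
  then show "implicit_alternatives k \<P> \<Q> P0 Q0 \<theta> \<noteq> {}" using alt by blast
  have lim: "(\<lambda>m. ereal (1 - \<Phi> (u - \<sigma> m))) \<longlonglongrightarrow> ereal (1 - \<Phi> (u - \<theta> / sqrt V))"
    by (intro tendsto_ereal tendsto_diff tendsto_const isCont_tendsto_compose[OF isCont_cdf_std_normal] \<sigma>)
  show "?I \<le> ereal (1 - \<Phi> (u - \<theta> / sqrt V))"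
  proof (rule tendsto_lowerbound[OF lim])
    show "\<forall>\<^sub>F m in sequentially. ?I \<le> ereal (1 - \<Phi> (u - \<sigma> m))"
      using ev
    proof eventually_elim
      case (elim m)
      then show ?case using alt[OF elim] by (blast intro: INF_lower2)
    qed
  qed simp
qed

end

theorem mainTheorem6:
  fixes M1 :: "'a measure" and M2 :: "'b measure"
    and \<P> :: "'a measure set" and \<Q> :: "'b measure set"
    and P0 :: "'a measure" and Q0 :: "'b measure"
    and k :: "('a \<times> 'b) measure \<Rightarrow> real"
    and kt :: "'a \<times> 'b \<Rightarrow> real" and kt1 :: "'a \<Rightarrow> real" and kt2 :: "'b \<Rightarrow> real"
    and n1 n2 :: "nat \<Rightarrow> nat" and d \<alpha> \<theta> c :: real
    and T \<psi> :: "nat \<Rightarrow> (nat \<Rightarrow> 'a) \<times> (nat \<Rightarrow> 'b) \<Rightarrow> real"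
  assumes P_family: "\<forall>P\<in>\<P>. prob_space P \<and> sets P = sets M1"
    and Q_family: "\<forall>Q\<in>\<Q>. prob_space Q \<and> sets Q = sets M2"
    and P0: "P0 \<in> \<P>" and Q0: "Q0 \<in> \<Q>"
    and gradient: "canonical_gradient k (P0 \<Otimes>\<^sub>M Q0) (product_family \<P> \<Q>) kt"
    and kt1: "kt1 \<in> L2_centered P0" and kt2: "kt2 \<in> L2_centered Q0"
    and decomposition: "AE \<omega> in P0 \<Otimes>\<^sub>M Q0. kt \<omega> = kt1 (fst \<omega>) + kt2 (snd \<omega>)"
    and nondegenerate: "(\<integral>\<omega>. (kt \<omega>)\<^sup>2 \<partial>(P0 \<Otimes>\<^sub>M Q0)) \<noteq> 0"
    and \<alpha>: "0 < \<alpha>" "\<alpha> < 1"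
    and sample_sizes: "\<forall>n. n1 n + n2 n = n"
    and d: "(\<lambda>n. real (n2 n) / real n) \<longlonglongrightarrow> d" "0 < d" "d < 1"
    and convex_cone: "convex_fun_set (tangent_cone (P0 \<Otimes>\<^sub>M Q0) (product_family \<P> \<Q>))"
    and T: "\<And>n \<omega>. T n \<omega> =
          sqrt (real n) / real (n1 n) * (\<Sum>i<n1 n. kt1 (fst \<omega> i))
        + sqrt (real n) / real (n2 n) * (\<Sum>j<n2 n. kt2 (snd \<omega> j))"
    and c: "c = inv (cdf std_normal_distribution) (1 - \<alpha>) *
          sqrt (1 / (1 - d) * (\<integral>x. (kt1 x)\<^sup>2 \<partial>P0) + 1 / d * (\<integral>y. (kt2 y)\<^sup>2 \<partial>Q0))"
    and \<psi>: "\<And>n \<omega>. \<psi> n \<omega> = (if T n \<omega> > c then 1 else 0)"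
    and \<theta>: "\<theta> > 0"
  shows "asymptotic_maximin n1 n2 (implicit_alternatives k \<P> \<Q> P0 Q0 \<theta>)
           (similar_tests n1 n2 P0 Q0 \<alpha>) \<psi>"
proof -
  interpret two_sample_problem M1 M2 \<P> \<Q> P0 Q0 k kt kt1 kt2 n1 n2 d
    by unfold_locales (fact assms)+
  define u where "u = inv (\<Phi>) (1 - \<alpha>)"
  define Alt where "Alt = implicit_alternatives k \<P> \<Q> P0 Q0 \<theta>"
  \<comment> \<open>The common limiting power of \<psi> along all alternatives, so that both infima
    for \<psi> are over constant families.\<close>
  define \<beta> where "\<beta> = 1 - \<Phi> (u - \<theta> / sqrt V)"
  have u: "\<Phi> u = 1 - \<alpha>"
    unfolding u_def using \<alpha> by (intro cdf_std_normal_inv) auto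
  have \<psi>': "\<psi> n \<omega> = (if T n \<omega> > u * sqrt V then 1 else 0)" for n \<omega>
    unfolding \<psi> c V_def u_def ..
  have test: "\<psi> \<in> similar_tests n1 n2 P0 Q0 \<alpha>"
    by (rule similar_test[OF T \<psi>' u])
  have power: "power_seq n1 n2 \<psi> S \<longlonglongrightarrow> \<beta>" if "S \<in> Alt" for S
    unfolding \<beta>_def by (rule tendsto_power_alternative[OF that[unfolded Alt_def] T \<psi>'])
  \<comment> \<open>In \<open>ereal\<close> an infimum over the empty set is infinity, not
    \<beta>.\<close>
  have ne: "Alt \<noteq> {}"
    unfolding Alt_def by (rule maximin_upper_bound(2)[OF \<theta> test u])
  have v: "(INF S\<in>Alt. ereal (lim (power_seq n1 n2 \<psi> S))) = ereal \<beta>"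
  proof -
    have "ereal (lim (power_seq n1 n2 \<psi> S)) = ereal \<beta>" if "S \<in> Alt" for S
      using limI[OF power[OF that]] by simp
    then show ?thesis using ne by (simp cong: INF_cong)
  qed
  have V\<psi>: "(INF S\<in>Alt. limsup (\<lambda>n. ereal (power_seq n1 n2 \<psi> S n))) = ereal \<beta>"
  proof -
    have "limsup (\<lambda>n. ereal (power_seq n1 n2 \<psi> S n)) = ereal \<beta>" if "S \<in> Alt" for S
      using power[OF that] by (intro lim_imp_Limsup) auto
    then show ?thesis using ne by (simp cong: INF_cong)
  qed
  have le: "(INF S\<in>Alt. limsup (\<lambda>n. ereal (power_seq n1 n2 \<phi> S n))) \<le> ereal \<beta>"
    if "\<phi> \<in> similar_tests n1 n2 P0 Q0 \<alpha>" for \<phi>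
    unfolding Alt_def \<beta>_def by (rule maximin_upper_bound(1)[OF \<theta> that u])
  show ?thesis
    unfolding asymptotic_maximin_def Let_def Alt_def[symmetric] v
    using test power V\<psi> le by (auto simp: convergent_def)
qed

end
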